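(* Let $\mathfrak{L}=\mathfrak{L}(\mathfrak{g},\sigma)$ be a twisted loop algebra with standard cobracket $\delta_\circ$, standard Manin triple $\mathfrak{D}=\mathfrak{C}\dotplus\mathfrak{W}^\circ$ and completed standard Manin triple $\widehat{\mathfrak{D}}=\mathfrak{C}\dotplus\widehat{\mathfrak{W}}^\circ$ (see context). For $\mathtt{t}\in\wedge^2\mathfrak{L}$ put $\delta_{\mathtt{t}}=\delta_\circ+\partial_{\mathtt{t}}$. Then the maps $$\{\mathtt{t}\in\wedge^2\mathfrak{L}\,|\,(\mathfrak{L},\delta_{\mathtt{t}})\text{ is a Lie bialgebra}\}\xrightarrow{\ \mathtt{t}\mapsto\mathfrak{W}_{\mathtt{t}}\ }\mathsf{MT}(\mathfrak{D},\mathfrak{C};\mathfrak{W}^\circ)\xrightarrow{\ \mathfrak{W}\mapsto\widehat{\mathfrak{W}}\ }\mathsf{MT}(\widehat{\mathfrak{D}},\mathfrak{C};\widehat{\mathfrak{W}}^\circ)$$ and their composition $\mathtt{t}\mapsto\widehat{\mathfrak{W}}_{\mathtt{t}}$ are (well-defined) bijections. Moreover, if $\delta_{\mathtt{t}}$ is a Lie bialgebra cobracket for some $\mathtt{t}\in\wedge^2\mathfrak{L}$, then it is determined by the Manin triple $\widehat{\mathfrak{D}}=\mathfrak{C}\dotplus\widehat{\mathfrak{W}}_{\mathtt{t}}$.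
   Context: Loop algebras. $\mathfrak{g}$ is a finite dimensional simple complex Lie algebra with Killing form $\kappa$, $\sigma$ an automorphism of order $m$, $\varepsilon=\exp(2\pi i/m)$, $\mathfrak{g}_k=\{a\,|\,\sigma(a)=\varepsilon^ka\}$, $\mathfrak{g}_k^\ddagger=\mathfrak{g}_{-k}$. $\mathfrak{L}=\bigoplus_k\mathfrak{g}_kz^k$, $\mathfrak{L}^\ddagger=\mathfrak{L}(\mathfrak{g},\sigma^{-1})=\bigoplus_k\mathfrak{g}_k^\ddagger z^k$, with forms $B$, $B^\ddagger$ given by $(az^k,bz^l)\mapsto\kappa(a,b)\delta_{k+l,0}$, and $(az^k)^\ddagger=az^{-k}$. $\mathfrak{L}_+$ is $\mathfrak{L}$ in the variable $z_+$, $\mathfrak{L}_-$ is $\mathfrak{L}^\ddagger$ in the variable $z_-$; $\mathfrak{D}=\mathfrak{L}_+\times\mathfrak{L}_-$ with $F((f_+,f_-),(g_+,g_-))=B(f_+,g_+)-B^\ddagger(f_-,g_-)$; $\mathfrak{C}=\{(f,f^\ddagger)\,|\,f\in\mathfrak{L}\}\cong\mathfrak{L}$. Fix a triangular decomposition $\mathfrak{g}_0=\mathfrak{g}_0^+\oplus\mathfrak{h}\oplus\mathfrak{g}_0^-$ of the reductive algebra $\mathfrak{g}_0$; $\mathfrak{B}_+=(\mathfrak{g}_0^+\oplus\mathfrak{h})\oplus\bigoplus_{k\ge1}\mathfrak{g}_kz_+^k$, $\mathfrak{B}_-=(\mathfrak{g}_0^-\oplus\mathfrak{h})\oplus\bigoplus_{k\ge1}\mathfrak{g}_k^\ddagger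 z_-^k$, $\pi_\pm:\mathfrak{B}_\pm\to\mathfrak{h}$ the projections, $\mathfrak{W}^\circ=\{(f_+,f_-)\in\mathfrak{B}_+\times\mathfrak{B}_-\,|\,\pi_+(f_+)+\pi_-(f_-)=0\}$. $\mathfrak{D}=\mathfrak{C}\dotplus\mathfrak{W}^\circ$ is a Manin triple, and $\delta_\circ$ is the Lie bialgebra cobracket on $\mathfrak{L}\cong\mathfrak{C}$ determined by it. For $\mathtt{t}=\sum_ia_i\otimes b_i\in\wedge^2\mathfrak{L}\cong\wedge^2\mathfrak{C}$: $\mathfrak{W}_{\mathtt{t}}=\{w+\sum_iF(w,a_i)b_i\,|\,w\in\mathfrak{W}^\circ\}$. Completions. $\widehat{\mathfrak{L}}=\mathbb{C}(\!(t)\!)\otimes_{\mathbb{C}[t,t^{-1}]}\mathfrak{L}$ with $t=z^m$, i.e. formal series $\sum_{k\gg-\infty}a_kz^k$, $a_k\in\mathfrak{g}_k$; similarly $\widehat{\mathfrak{L}}^\ddagger$. $\widehat{\mathfrak{D}}=\widehat{\mathfrak{L}}_+\times\widehat{\mathfrak{L}}_-$ (the completions of $\mathfrak{L}_\pm$ in positive powers of $z_\pm$), with $\widehat F$ given by the same formula as $F$. $\mathfrak{C}$ is regarded as a subalgebra of $\widehat{\mathfrak{D}}$ via $f\mapsto(f,f^\ddagger)$. $\widehat{\mathfrak{W}}^\circ$ is defined like $\mathfrak{W}^\circ$ with $\bigoplus_{k\ge1}$ replaced by $\prod_{k\ge1}$; $\widehat{\mathfrak{D}}=\mathfrak{C}\dotplus\widehat{\mathfrak{W}}^\circ$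 is a Manin triple. Let $t_\pm=z_\pm^m$, $O=\mathbb{C}[t_+,t_-]/(t_+t_-)$ acting on $\mathfrak{D}$ by $t_+\cdot(f_+,f_-)=(t_+f_+,0)$, $t_-\cdot(f_+,f_-)=(0,t_-f_-)$ (and $1$ as identity), $\mathfrak{m}=(t_+,t_-)\subset O$. Any $\mathfrak{W}\in\mathsf{MT}(\mathfrak{D},\mathfrak{C};\mathfrak{W}^\circ)$ is a finitely generated $O$-submodule of $\mathfrak{D}$, and $\widehat{\mathfrak{W}}:=\varprojlim_k\mathfrak{W}/\mathfrak{m}^k\mathfrak{W}\cong\mathbb{C}[[t_+,t_-]]/(t_+t_-)\otimes_O\mathfrak{W}\subset\widehat{\mathfrak{D}}$; equivalently $\widehat{\mathfrak{W}}=\mathfrak{W}+\mathfrak{m}^k\widehat{\mathfrak{W}}^\circ$ for all sufficiently large $k$. $\widehat{\mathfrak{W}}_{\mathtt{t}}$ is the completion of $\mathfrak{W}_{\mathtt{t}}$. General notions. $\wedge^2V$ = skew-symmetric tensors; $\partial_{\mathtt{t}}(a)=[a\otimes1+1\otimes a,\mathtt{t}]$. A Lie bialgebra $(\mathfrak{r},\delta)$: $\delta:\mathfrak{r}\to\wedge^2\mathfrak{r}$ a linear 1-cocycle ($\delta([a,b])=[a\otimes1+1\otimes a,\delta(b)]-[b\otimes1+1\otimes b,\delta(a)]$) with $\mathrm{alt}((\delta\otimes\mathbb{1})\circ\delta)=0$, $\mathrm{alt}(a\otimes b\otimes c)=a\otimes b\otimes c+c\otimes a\otimes b+b\otimes c\otimes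 a$. A Manin triple $\mathfrak{R}=\mathfrak{R}_+\dotplus\mathfrak{R}_-$: Lie algebra with symmetric invariant non-degenerate form and isotropic complementary Lie subalgebras $\mathfrak{R}_\pm$; it determines a cobracket $\delta$ on $\mathfrak{R}_+$ if $F(\delta(a),b_1\otimes b_2)=F(a,[b_1,b_2])$ for $a\in\mathfrak{R}_+$, $b_i\in\mathfrak{R}_-$, where $F(a_1\otimes a_2,b_1\otimes b_2)=F(a_1,b_1)F(a_2,b_2)$. $W'\asymp W''$ means $\dim((W'+W'')/(W'\cap W''))<\infty$. $\mathsf{MT}(\mathfrak{R},\mathfrak{R}_+;\mathfrak{R}_-)$ is the set of $\mathfrak{W}\subset\mathfrak{R}$ with $(\mathfrak{R},\mathfrak{R}_+,\mathfrak{W})$ a Manin triple and $\mathfrak{W}\asymp\mathfrak{R}_-$. *)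

theory Defs
  imports
    Complex_Main
    "HOL-Library.Function_Algebras"
    "HOL-Library.Product_Plus"
    "HOL-Library.Poly_Mapping"
begin

section \<open>Complex vector spaces\<close>

class scaleC =
  fixes scaleC :: "complex \<Rightarrow> 'a \<Rightarrow> 'a" (infixr \<open>*\<^sub>C\<close> 75)

class complex_vector = scaleC + ab_group_add +
  assumes scaleC_add_right: "c *\<^sub>C (x + y) = c *\<^sub>C x + c *\<^sub>C y"
    and scaleC_add_left: "(c + d) *\<^sub>C x = c *\<^sub>C x + d *\<^sub>C x"
    and scaleC_scaleC: "c *\<^sub>C d *\<^sub>C x = (c * d) *\<^sub>C x"
    and scaleC_one: "1 *\<^sub>C x = x"

global_interpretation cv: vector_space "scaleC :: complex \<Rightarrow> 'a \<Rightarrow> 'a::complex_vector"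
  by unfold_locales (rule scaleC_add_right scaleC_add_left scaleC_scaleC scaleC_one)+

instantiation complex :: complex_vector
begin
definition scaleC_complex_def: "c *\<^sub>C (z::complex) = c * z"
instance by standard (simp_all add: scaleC_complex_def algebra_simps)
end

instantiation "fun" :: (type, complex_vector) complex_vector
begin
definition scaleC_fun_def: "c *\<^sub>C f = (\<lambda>k. c *\<^sub>C f k)"
instance by standard
    (simp_all add: scaleC_fun_def fun_eq_iff cv.scale_right_distrib cv.scale_left_distrib)
end

instantiation prod :: (complex_vector, complex_vector) complex_vector
begin
definition scaleC_prod_def: "c *\<^sub>C x = (c *\<^sub>C fst x, c *\<^sub>C snd x)"
instance by standard
    (simp_all add: scaleC_prod_def prod_eq_iff cv.scale_right_distrib cv.scale_left_distrib)
end

instantiation poly_mapping :: (type, complex_vector) complex_vector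
begin
definition scaleC_poly_mapping_def: "c *\<^sub>C p = Poly_Mapping.map (scaleC c) p"
instance
proof
  have lk: "Poly_Mapping.lookup (c *\<^sub>C p) k = c *\<^sub>C Poly_Mapping.lookup p k"
    for c and p :: "'a \<Rightarrow>\<^sub>0 'b" and k
    by (simp add: scaleC_poly_mapping_def Poly_Mapping.map.rep_eq when_def)
  fix c d and x y :: "'a \<Rightarrow>\<^sub>0 'b"
  show "c *\<^sub>C (x + y) = c *\<^sub>C x + c *\<^sub>C y"
    by (rule poly_mapping_eqI) (simp add: lk lookup_add cv.scale_right_distrib)
  show "(c + d) *\<^sub>C x = c *\<^sub>C x + d *\<^sub>C x"
    by (rule poly_mapping_eqI) (simp add: lk lookup_add cv.scale_left_distrib)
  show "c *\<^sub>C d *\<^sub>C x = (c * d) *\<^sub>C x"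
    by (rule poly_mapping_eqI) (simp add: lk)
  show "1 *\<^sub>C x = x"
    by (rule poly_mapping_eqI) (simp add: lk)
qed
end

definition linear_on :: "'a::complex_vector set \<Rightarrow> ('a \<Rightarrow> 'b::complex_vector) \<Rightarrow> bool" where
  "linear_on S f \<longleftrightarrow>
     (\<forall>x\<in>S. \<forall>y\<in>S. f (x + y) = f x + f y) \<and> (\<forall>c. \<forall>x\<in>S. f (c *\<^sub>C x) = c *\<^sub>C f x)"

definition bilinear_on ::
    "'a::complex_vector set \<Rightarrow> 'b::complex_vector set \<Rightarrow> ('a \<Rightarrow> 'b \<Rightarrow> 'c::complex_vector) \<Rightarrow> bool" where
  "bilinear_on S T \<beta> \<longleftrightarrow>
     (\<forall>x\<in>S. linear_on T (\<beta> x)) \<and> (\<forall>y\<in>T. linear_on S (\<lambda>x. \<beta> x y))"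

definition finite_dimensional :: "'a::complex_vector set \<Rightarrow> bool" where
  "finite_dimensional S \<longleftrightarrow> (\<exists>B. finite B \<and> cv.span B = S)"

text \<open>\<open>W' \<asymp> W''\<close>: the quotient of \<open>W' + W''\<close> by \<open>W' \<inter> W''\<close> is spanned by finitely many classes.\<close>

definition commensurable :: "'a::complex_vector set \<Rightarrow> 'a set \<Rightarrow> bool" (infix \<open>\<asymp>\<close> 50) where
  "W' \<asymp> W'' \<longleftrightarrow>
     (\<exists>B. finite B \<and> {x + y | x y. x \<in> W' \<and> y \<in> W''} \<subseteq> cv.span ((W' \<inter> W'') \<union> B))"

definition endo_trace :: "('a::complex_vector \<Rightarrow> 'a) \<Rightarrow> complex" where
  "endo_trace f = (\<Sum>b\<in>cv.extend_basis {}. cv.representation (cv.extend_basis {}) (f b) b)"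


section \<open>Tensor products\<close>

text \<open>The free complex vector space on \<open>'a \<times> 'b\<close> modulo the relations of bilinearity.\<close>

definition tensor_relators ::
    "(('a::complex_vector \<times> 'b::complex_vector) \<Rightarrow>\<^sub>0 complex) set" where
  "tensor_relators =
     {Poly_Mapping.single (x + x', y) 1 - Poly_Mapping.single (x, y) 1
        - Poly_Mapping.single (x', y) 1 | x x' y. True}
   \<union> {Poly_Mapping.single (x, y + y') 1 - Poly_Mapping.single (x, y) 1
        - Poly_Mapping.single (x, y') 1 | x y y'. True}
   \<union> {Poly_Mapping.single (c *\<^sub>C x, y) 1 - c *\<^sub>C Poly_Mapping.single (x, y) 1 | c x y. True}
   \<union> {Poly_Mapping.single (x, c *\<^sub>C y) 1 - c *\<^sub>C Poly_Mapping.single (x, y) 1 | c x y. True}"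

definition tensor_rel ::
    "(('a::complex_vector \<times> 'b::complex_vector) \<Rightarrow>\<^sub>0 complex) \<Rightarrow> (('a \<times> 'b) \<Rightarrow>\<^sub>0 complex) \<Rightarrow> bool"
  where "tensor_rel p q \<longleftrightarrow> p - q \<in> cv.span tensor_relators"

quotient_type (overloaded) ('a, 'b) tensor =
  "('a::complex_vector \<times> 'b::complex_vector) \<Rightarrow>\<^sub>0 complex" / tensor_rel
proof (rule equivpI)
  show "reflp tensor_rel"
    by (simp add: reflp_def tensor_rel_def cv.span_zero)
  show "symp tensor_rel"
  proof (rule sympI)
    show "tensor_rel q p" if "tensor_rel p q" for p q
      using cv.span_neg[OF that[unfolded tensor_rel_def]] by (simp add: tensor_rel_def)
  qed
  show "transp tensor_rel"
  proof (rule transpI)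
    show "tensor_rel p r" if "tensor_rel p q" "tensor_rel q r" for p q r
      using cv.span_add[OF that[unfolded tensor_rel_def]] by (simp add: tensor_rel_def)
  qed
qed

instantiation tensor :: (complex_vector, complex_vector) complex_vector
begin

lift_definition zero_tensor :: "('a, 'b) tensor" is 0 .

lift_definition plus_tensor :: "('a, 'b) tensor \<Rightarrow> ('a, 'b) tensor \<Rightarrow> ('a, 'b) tensor" is "(+)"
  unfolding tensor_rel_def by (simp only: add_diff_add cv.span_add)

lift_definition minus_tensor :: "('a, 'b) tensor \<Rightarrow> ('a, 'b) tensor \<Rightarrow> ('a, 'b) tensor" is "(-)"
proof -
  fix p p' q q' :: "('a \<times> 'b) \<Rightarrow>\<^sub>0 complex"
  assume "tensor_rel p p'" "tensor_rel q q'"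
  then have "(p - p') - (q - q') \<in> cv.span tensor_relators"
    unfolding tensor_rel_def by (rule cv.span_diff)
  then show "tensor_rel (p - q) (p' - q')"
    by (simp add: tensor_rel_def algebra_simps)
qed

lift_definition uminus_tensor :: "('a, 'b) tensor \<Rightarrow> ('a, 'b) tensor" is uminus
proof -
  fix p q :: "('a \<times> 'b) \<Rightarrow>\<^sub>0 complex"
  assume "tensor_rel p q"
  then have "- (p - q) \<in> cv.span tensor_relators"
    unfolding tensor_rel_def by (rule cv.span_neg)
  then show "tensor_rel (- p) (- q)"
    by (simp add: tensor_rel_def)
qed

lift_definition scaleC_tensor :: "complex \<Rightarrow> ('a, 'b) tensor \<Rightarrow> ('a, 'b) tensor" is scaleC
  unfolding tensor_rel_def by (metis cv.scale_right_diff_distrib cv.span_scale)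

instance
  by standard (transfer, simp add: tensor_rel_def cv.span_zero algebra_simps)+

end

lift_definition tensor_prod ::
    "'a::complex_vector \<Rightarrow> 'b::complex_vector \<Rightarrow> ('a, 'b) tensor" (infixl \<open>\<otimes>\<^sub>C\<close> 72)
  is "\<lambda>a b. Poly_Mapping.single (a, b) 1" .

lemma tensor_prod_bilinear: "bilinear_on UNIV UNIV (\<otimes>\<^sub>C)"
proof -
  have "(x + x') \<otimes>\<^sub>C y = x \<otimes>\<^sub>C y + x' \<otimes>\<^sub>C y" for x x' :: 'a and y :: 'b
    by transfer (unfold tensor_rel_def tensor_relators_def diff_diff_eq[symmetric],
      intro cv.span_base UnI1, blast)
  moreover have "x \<otimes>\<^sub>C (y + y') = x \<otimes>\<^sub>C y + x \<otimes>\<^sub>C y'" for x :: 'a and y y' :: 'b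
    by transfer (unfold tensor_rel_def tensor_relators_def diff_diff_eq[symmetric],
      rule cv.span_base, rule UnI1, rule UnI1, rule UnI2, blast)
  moreover have "(c *\<^sub>C x) \<otimes>\<^sub>C y = c *\<^sub>C (x \<otimes>\<^sub>C y)" for c and x :: 'a and y :: 'b
    by transfer (unfold tensor_rel_def tensor_relators_def,
      rule cv.span_base, rule UnI1, rule UnI2, blast)
  moreover have "x \<otimes>\<^sub>C (c *\<^sub>C y) = c *\<^sub>C (x \<otimes>\<^sub>C y)" for c and x :: 'a and y :: 'b
    by transfer (unfold tensor_rel_def tensor_relators_def,
      rule cv.span_base, rule UnI2, blast)
  ultimately show ?thesis
    by (auto simp: bilinear_on_def linear_on_def)
qed

text \<open>For subspaces \<open>S\<close> and \<open>T\<close>, the tensor product of \<open>S\<close> and \<open>T\<close> is identified with its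
  (injective) image in the tensor product of the ambient spaces.\<close>

definition tensor_space ::
    "'a::complex_vector set \<Rightarrow> 'b::complex_vector set \<Rightarrow> ('a, 'b) tensor set" where
  "tensor_space S T = cv.span {a \<otimes>\<^sub>C b | a b. a \<in> S \<and> b \<in> T}"

text \<open>The linear map on \<open>tensor_space S T\<close> induced by a map \<open>\<beta>\<close> that is bilinear on \<open>S \<times> T\<close>:
  it sends \<open>\<Sum>\<^sub>i a\<^sub>i \<otimes> b\<^sub>i\<close> with \<open>a\<^sub>i \<in> S\<close>, \<open>b\<^sub>i \<in> T\<close> to \<open>\<Sum>\<^sub>i \<beta> a\<^sub>i b\<^sub>i\<close>.\<close>

definition tensor_lift ::
    "'a::complex_vector set \<Rightarrow> 'b::complex_vector set \<Rightarrow> ('a \<Rightarrow> 'b \<Rightarrow> 'c::complex_vector)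
      \<Rightarrow> ('a, 'b) tensor \<Rightarrow> 'c" where
  "tensor_lift S T \<beta> t =
     (THE y. \<exists>xs. set xs \<subseteq> S \<times> T \<and> t = (\<Sum>(a, b)\<leftarrow>xs. a \<otimes>\<^sub>C b) \<and> y = (\<Sum>(a, b)\<leftarrow>xs. \<beta> a b))"

definition wedge2 :: "'a::complex_vector set \<Rightarrow> ('a, 'a) tensor set" where
  "wedge2 S = {t \<in> tensor_space S S. tensor_lift S S (\<lambda>a b. b \<otimes>\<^sub>C a) t = - t}"


section \<open>Lie algebras, Lie bialgebras and Manin triples\<close>

text \<open>Algebras are carried by subspaces \<open>R\<close> of an ambient vector space; brackets, forms and cobrackets
  are total functions that only matter on the carrier.\<close>

definition lie_algebra :: "'a::complex_vector set \<Rightarrow> ('a \<Rightarrow> 'a \<Rightarrow> 'a) \<Rightarrow> bool" where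
  "lie_algebra R br \<longleftrightarrow>
     cv.subspace R \<and> (\<forall>x\<in>R. \<forall>y\<in>R. br x y \<in> R) \<and> bilinear_on R R br \<and>
     (\<forall>x\<in>R. br x x = 0) \<and>
     (\<forall>x\<in>R. \<forall>y\<in>R. \<forall>z\<in>R. br x (br y z) + br y (br z x) + br z (br x y) = 0)"

definition lie_subalgebra :: "'a::complex_vector set \<Rightarrow> ('a \<Rightarrow> 'a \<Rightarrow> 'a) \<Rightarrow> 'a set \<Rightarrow> bool" where
  "lie_subalgebra R br S \<longleftrightarrow> S \<subseteq> R \<and> cv.subspace S \<and> (\<forall>x\<in>S. \<forall>y\<in>S. br x y \<in> S)"

definition lie_ideal :: "'a::complex_vector set \<Rightarrow> ('a \<Rightarrow> 'a \<Rightarrow> 'a) \<Rightarrow> 'a set \<Rightarrow> bool" where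
  "lie_ideal R br I \<longleftrightarrow> I \<subseteq> R \<and> cv.subspace I \<and> (\<forall>x\<in>R. \<forall>y\<in>I. br x y \<in> I)"

definition simple_lie_algebra :: "'a::complex_vector set \<Rightarrow> ('a \<Rightarrow> 'a \<Rightarrow> 'a) \<Rightarrow> bool" where
  "simple_lie_algebra R br \<longleftrightarrow>
     lie_algebra R br \<and> (\<exists>x\<in>R. \<exists>y\<in>R. br x y \<noteq> 0) \<and>
     (\<forall>I. lie_ideal R br I \<longrightarrow> I = {0} \<or> I = R)"

definition killing_form :: "('g::complex_vector \<Rightarrow> 'g \<Rightarrow> 'g) \<Rightarrow> 'g \<Rightarrow> 'g \<Rightarrow> complex" where
  "killing_form br a b = endo_trace (\<lambda>x. br a (br b x))"

definition lie_automorphism :: "('g::complex_vector \<Rightarrow> 'g \<Rightarrow> 'g) \<Rightarrow> ('g \<Rightarrow> 'g) \<Rightarrow> bool" where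
  "lie_automorphism br \<sigma> \<longleftrightarrow>
     linear_on UNIV \<sigma> \<and> bij \<sigma> \<and> (\<forall>x y. \<sigma> (br x y) = br (\<sigma> x) (\<sigma> y))"

definition has_order :: "('g \<Rightarrow> 'g) \<Rightarrow> nat \<Rightarrow> bool" where
  "has_order \<sigma> m \<longleftrightarrow> 0 < m \<and> \<sigma> ^^ m = id \<and> (\<forall>k. 0 < k \<and> k < m \<longrightarrow> \<sigma> ^^ k \<noteq> id)"

text \<open>\<open>tensor_ad R br a t = [a \<otimes> 1 + 1 \<otimes> a, t]\<close>\<close>

definition tensor_ad ::
    "'a::complex_vector set \<Rightarrow> ('a \<Rightarrow> 'a \<Rightarrow> 'a) \<Rightarrow> 'a \<Rightarrow> ('a, 'a) tensor \<Rightarrow> ('a, 'a) tensor" where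
  "tensor_ad R br a = tensor_lift R R (\<lambda>x y. br a x \<otimes>\<^sub>C y + x \<otimes>\<^sub>C br a y)"

definition tensor_alt ::
    "'a::complex_vector set \<Rightarrow> (('a, 'a) tensor, 'a) tensor \<Rightarrow> (('a, 'a) tensor, 'a) tensor" where
  "tensor_alt R = tensor_lift (tensor_space R R) R
     (\<lambda>s c. tensor_lift R R
        (\<lambda>a b. a \<otimes>\<^sub>C b \<otimes>\<^sub>C c + c \<otimes>\<^sub>C a \<otimes>\<^sub>C b + b \<otimes>\<^sub>C c \<otimes>\<^sub>C a) s)"

definition lie_bialgebra ::
    "'a::complex_vector set \<Rightarrow> ('a \<Rightarrow> 'a \<Rightarrow> 'a) \<Rightarrow> ('a \<Rightarrow> ('a, 'a) tensor) \<Rightarrow> bool" where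
  "lie_bialgebra R br \<delta> \<longleftrightarrow>
     lie_algebra R br \<and> linear_on R \<delta> \<and> (\<forall>a\<in>R. \<delta> a \<in> wedge2 R) \<and>
     (\<forall>a\<in>R. \<forall>b\<in>R. \<delta> (br a b) = tensor_ad R br a (\<delta> b) - tensor_ad R br b (\<delta> a)) \<and>
     (\<forall>a\<in>R. tensor_alt R (tensor_lift R R (\<lambda>x y. \<delta> x \<otimes>\<^sub>C y) (\<delta> a)) = 0)"

definition manin_triple ::
    "'a::complex_vector set \<Rightarrow> ('a \<Rightarrow> 'a \<Rightarrow> 'a) \<Rightarrow> ('a \<Rightarrow> 'a \<Rightarrow> complex) \<Rightarrow> 'a set \<Rightarrow> 'a set \<Rightarrow> bool"
  where
  "manin_triple R br F Rp Rm \<longleftrightarrow>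
     lie_algebra R br \<and> bilinear_on R R F \<and>
     (\<forall>x\<in>R. \<forall>y\<in>R. F x y = F y x) \<and>
     (\<forall>x\<in>R. \<forall>y\<in>R. \<forall>z\<in>R. F (br x y) z = F x (br y z)) \<and>
     (\<forall>x\<in>R. (\<forall>y\<in>R. F x y = 0) \<longrightarrow> x = 0) \<and>
     lie_subalgebra R br Rp \<and> lie_subalgebra R br Rm \<and>
     (\<forall>x\<in>Rp. \<forall>y\<in>Rp. F x y = 0) \<and> (\<forall>x\<in>Rm. \<forall>y\<in>Rm. F x y = 0) \<and>
     Rp \<inter> Rm = {0} \<and> {x + y | x y. x \<in> Rp \<and> y \<in> Rm} = R"

definition determines_cobracket ::
    "('a::complex_vector \<Rightarrow> 'a \<Rightarrow> 'a) \<Rightarrow> ('a \<Rightarrow> 'a \<Rightarrow> complex) \<Rightarrow> 'a set \<Rightarrow> 'a set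
      \<Rightarrow> ('a \<Rightarrow> ('a, 'a) tensor) \<Rightarrow> bool" where
  "determines_cobracket br F Rp Rm \<delta> \<longleftrightarrow>
     (\<forall>a\<in>Rp. \<delta> a \<in> wedge2 Rp \<and>
        (\<forall>b\<^sub>1\<in>Rm. \<forall>b\<^sub>2\<in>Rm.
           tensor_lift Rp Rp (\<lambda>a\<^sub>1 a\<^sub>2. F a\<^sub>1 b\<^sub>1 * F a\<^sub>2 b\<^sub>2) (\<delta> a) = F a (br b\<^sub>1 b\<^sub>2)))"

definition manin_triples ::
    "'a::complex_vector set \<Rightarrow> ('a \<Rightarrow> 'a \<Rightarrow> 'a) \<Rightarrow> ('a \<Rightarrow> 'a \<Rightarrow> complex) \<Rightarrow> 'a set \<Rightarrow> 'a set
      \<Rightarrow> 'a set set" where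
  "manin_triples R br F Rp Rm = {W. W \<subseteq> R \<and> manin_triple R br F Rp W \<and> W \<asymp> Rm}"


section \<open>Triangular decompositions\<close>

text \<open>\<open>k\<close> is a reductive Lie algebra with bracket \<open>br\<close>; for such algebras the Cartan subalgebras are
  the abelian self-normalising subalgebras.\<close>

definition cartan_subalgebra :: "'g::complex_vector set \<Rightarrow> ('g \<Rightarrow> 'g \<Rightarrow> 'g) \<Rightarrow> 'g set \<Rightarrow> bool" where
  "cartan_subalgebra k br h \<longleftrightarrow>
     lie_subalgebra k br h \<and> (\<forall>x\<in>h. \<forall>y\<in>h. br x y = 0) \<and>
     {x \<in> k. \<forall>y\<in>h. br x y \<in> h} = h"

definition root_space ::
    "'g::complex_vector set \<Rightarrow> ('g \<Rightarrow> 'g \<Rightarrow> 'g) \<Rightarrow> 'g set \<Rightarrow> ('g \<Rightarrow> complex) \<Rightarrow> 'g set" where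
  "root_space k br h \<alpha> = {x \<in> k. \<forall>y\<in>h. br y x = \<alpha> y *\<^sub>C x}"

text \<open>A functional on \<open>h\<close> is encoded by its extension by zero outside \<open>h\<close>.\<close>

definition root_set ::
    "'g::complex_vector set \<Rightarrow> ('g \<Rightarrow> 'g \<Rightarrow> 'g) \<Rightarrow> 'g set \<Rightarrow> ('g \<Rightarrow> complex) set" where
  "root_set k br h =
     {\<alpha>. linear_on h \<alpha> \<and> (\<forall>x. x \<notin> h \<longrightarrow> \<alpha> x = 0) \<and> \<alpha> \<noteq> 0 \<and> root_space k br h \<alpha> \<noteq> {0}}"

text \<open>Systems of positive roots, in the form: closed subsets \<open>P\<close> of the root system \<open>\<Phi>\<close> such that
  \<open>\<Phi>\<close> is the disjoint union of \<open>P\<close> and \<open>- P\<close>.\<close>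

definition positive_system :: "('g \<Rightarrow> complex) set \<Rightarrow> ('g \<Rightarrow> complex) set \<Rightarrow> bool" where
  "positive_system \<Phi> P \<longleftrightarrow>
     P \<union> uminus ` P = \<Phi> \<and> P \<inter> uminus ` P = {} \<and>
     (\<forall>\<alpha>\<in>P. \<forall>\<beta>\<in>P. \<alpha> + \<beta> \<in> \<Phi> \<longrightarrow> \<alpha> + \<beta> \<in> P)"

definition triangular_decomposition ::
    "'g::complex_vector set \<Rightarrow> ('g \<Rightarrow> 'g \<Rightarrow> 'g) \<Rightarrow> 'g set \<Rightarrow> 'g set \<Rightarrow> 'g set \<Rightarrow> bool" where
  "triangular_decomposition k br np h nm \<longleftrightarrow>
     cartan_subalgebra k br h \<and>
     (\<exists>P. positive_system (root_set k br h) P \<and>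
        np = cv.span (\<Union>\<alpha>\<in>P. root_space k br h \<alpha>) \<and>
        nm = cv.span (\<Union>\<alpha>\<in>P. root_space k br h (- \<alpha>))) \<and>
     {x + y + z | x y z. x \<in> np \<and> y \<in> h \<and> z \<in> nm} = k \<and>
     (\<forall>x\<in>np. \<forall>y\<in>h. \<forall>z\<in>nm. x + y + z = 0 \<longrightarrow> x = 0 \<and> y = 0 \<and> z = 0)"


section \<open>Twisted loop algebras and their standard Manin triples\<close>

text \<open>A formal series \<open>\<Sum>\<^sub>k a\<^sub>k z\<^sup>k\<close> is the function \<open>k \<mapsto> a\<^sub>k\<close> on the integers, in each of the variables
  \<open>z\<close>, \<open>z\<^sub>+\<close>, \<open>z\<^sub>-\<close>.\<close>

type_synonym 'g series = "int \<Rightarrow> 'g"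

definition eigen_grade :: "('g::complex_vector \<Rightarrow> 'g) \<Rightarrow> nat \<Rightarrow> int \<Rightarrow> 'g set" where
  "eigen_grade \<sigma> m k = {a. \<sigma> a = (exp (2 * pi * \<i> / of_nat m) powi k) *\<^sub>C a}"

definition loop_space :: "(int \<Rightarrow> 'g::complex_vector set) \<Rightarrow> 'g series set" where
  "loop_space G = {f. (\<forall>k. f k \<in> G k) \<and> finite {k. f k \<noteq> 0}}"

definition completed_loop_space :: "(int \<Rightarrow> 'g::complex_vector set) \<Rightarrow> 'g series set" where
  "completed_loop_space G = {f. (\<forall>k. f k \<in> G k) \<and> (\<exists>N. \<forall>k<N. f k = 0)}"

definition loop_algebra :: "('g::complex_vector \<Rightarrow> 'g) \<Rightarrow> nat \<Rightarrow> 'g series set" where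
  "loop_algebra \<sigma> m = loop_space (eigen_grade \<sigma> m)"

definition loop_double :: "('g::complex_vector \<Rightarrow> 'g) \<Rightarrow> nat \<Rightarrow> ('g series \<times> 'g series) set" where
  "loop_double \<sigma> m = loop_space (eigen_grade \<sigma> m) \<times> loop_space (\<lambda>k. eigen_grade \<sigma> m (- k))"

definition completed_loop_double :: "('g::complex_vector \<Rightarrow> 'g) \<Rightarrow> nat \<Rightarrow> ('g series \<times> 'g series) set" where
  "completed_loop_double \<sigma> m =
     completed_loop_space (eigen_grade \<sigma> m) \<times> completed_loop_space (\<lambda>k. eigen_grade \<sigma> m (- k))"

text \<open>Bracket and form are given by the same formulas on Laurent polynomials and Laurent series; all sums
  are finite there.\<close>

definition series_bracket ::
    "('g::complex_vector \<Rightarrow> 'g \<Rightarrow> 'g) \<Rightarrow> 'g series \<Rightarrow> 'g series \<Rightarrow> 'g series" where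
  "series_bracket br f g = (\<lambda>n. \<Sum>k | f k \<noteq> 0 \<and> g (n - k) \<noteq> 0. br (f k) (g (n - k)))"

definition series_form ::
    "('g::complex_vector \<Rightarrow> 'g \<Rightarrow> 'g) \<Rightarrow> 'g series \<Rightarrow> 'g series \<Rightarrow> complex" where
  "series_form br f g = (\<Sum>k | f k \<noteq> 0 \<and> g (- k) \<noteq> 0. killing_form br (f k) (g (- k)))"

definition loop_double_bracket ::
    "('g::complex_vector \<Rightarrow> 'g \<Rightarrow> 'g) \<Rightarrow> 'g series \<times> 'g series \<Rightarrow> 'g series \<times> 'g series
      \<Rightarrow> 'g series \<times> 'g series" where
  "loop_double_bracket br x y =
     (series_bracket br (fst x) (fst y), series_bracket br (snd x) (snd y))"

definition loop_double_form ::
    "('g::complex_vector \<Rightarrow> 'g \<Rightarrow> 'g) \<Rightarrow> 'g series \<times> 'g series \<Rightarrow> 'g series \<times> 'g series \<Rightarrow> complex"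
  where
  "loop_double_form br x y = series_form br (fst x) (fst y) - series_form br (snd x) (snd y)"

definition dagger :: "'g series \<Rightarrow> 'g series" where
  "dagger f = (\<lambda>k. f (- k))"

definition diag_embed :: "'g series \<Rightarrow> 'g series \<times> 'g series" where
  "diag_embed f = (f, dagger f)"

definition diagonal :: "('g::complex_vector \<Rightarrow> 'g) \<Rightarrow> nat \<Rightarrow> ('g series \<times> 'g series) set" where
  "diagonal \<sigma> m = diag_embed ` loop_algebra \<sigma> m"

definition borel_part :: "'g::complex_vector series set \<Rightarrow> 'g set \<Rightarrow> 'g set \<Rightarrow> 'g series set" where
  "borel_part L n h = {f \<in> L. (\<forall>k<0. f k = 0) \<and> f 0 \<in> {x + y | x y. x \<in> n \<and> y \<in> h}}"

definition cartan_proj :: "'g::complex_vector set \<Rightarrow> 'g set \<Rightarrow> 'g series \<Rightarrow> 'g" where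
  "cartan_proj n h f = (THE y. y \<in> h \<and> f 0 - y \<in> n)"

definition standard_complement ::
    "'g::complex_vector series set \<Rightarrow> 'g series set \<Rightarrow> 'g set \<Rightarrow> 'g set \<Rightarrow> 'g set
      \<Rightarrow> ('g series \<times> 'g series) set" where
  "standard_complement Lp Lm np h nm =
     {(f, g) | f g. f \<in> borel_part Lp np h \<and> g \<in> borel_part Lm nm h \<and>
        cartan_proj np h f + cartan_proj nm h g = 0}"

definition W_std ::
    "('g::complex_vector \<Rightarrow> 'g) \<Rightarrow> nat \<Rightarrow> 'g set \<Rightarrow> 'g set \<Rightarrow> 'g set \<Rightarrow> ('g series \<times> 'g series) set" where
  "W_std \<sigma> m np h nm =
     standard_complement (loop_space (eigen_grade \<sigma> m)) (loop_space (\<lambda>k. eigen_grade \<sigma> m (- k))) np h nm"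

definition W_std_completed ::
    "('g::complex_vector \<Rightarrow> 'g) \<Rightarrow> nat \<Rightarrow> 'g set \<Rightarrow> 'g set \<Rightarrow> 'g set \<Rightarrow> ('g series \<times> 'g series) set" where
  "W_std_completed \<sigma> m np h nm =
     standard_complement (completed_loop_space (eigen_grade \<sigma> m))
       (completed_loop_space (\<lambda>k. eigen_grade \<sigma> m (- k))) np h nm"

text \<open>Transport of a cobracket along the isomorphism \<open>diag_embed\<close> from the loop algebra onto \<open>diagonal \<sigma> m\<close>,
  whose inverse is \<open>fst\<close>.\<close>

definition diagonal_cobracket ::
    "('g::complex_vector \<Rightarrow> 'g) \<Rightarrow> nat \<Rightarrow> ('g series \<Rightarrow> ('g series, 'g series) tensor)
      \<Rightarrow> 'g series \<times> 'g series \<Rightarrow> ('g series \<times> 'g series, 'g series \<times> 'g series) tensor" where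
  "diagonal_cobracket \<sigma> m \<delta> x =
     tensor_lift (loop_algebra \<sigma> m) (loop_algebra \<sigma> m) (\<lambda>a b. diag_embed a \<otimes>\<^sub>C diag_embed b) (\<delta> (fst x))"

text \<open>The choice is unique on the loop algebra, because the form pairs the diagonal with \<open>W_std\<close>
  non-degenerately.\<close>

definition standard_cobracket ::
    "('g::complex_vector \<Rightarrow> 'g \<Rightarrow> 'g) \<Rightarrow> ('g \<Rightarrow> 'g) \<Rightarrow> nat \<Rightarrow> 'g set \<Rightarrow> 'g set \<Rightarrow> 'g set
      \<Rightarrow> 'g series \<Rightarrow> ('g series, 'g series) tensor" where
  "standard_cobracket br \<sigma> m np h nm =
     (SOME \<delta>. (\<forall>a\<in>loop_algebra \<sigma> m. \<delta> a \<in> wedge2 (loop_algebra \<sigma> m)) \<and>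
        determines_cobracket (loop_double_bracket br) (loop_double_form br) (diagonal \<sigma> m)
          (W_std \<sigma> m np h nm) (diagonal_cobracket \<sigma> m \<delta>))"

definition twisted_cobracket ::
    "('g::complex_vector \<Rightarrow> 'g \<Rightarrow> 'g) \<Rightarrow> ('g \<Rightarrow> 'g) \<Rightarrow> nat \<Rightarrow> 'g set \<Rightarrow> 'g set \<Rightarrow> 'g set
      \<Rightarrow> ('g series, 'g series) tensor \<Rightarrow> 'g series \<Rightarrow> ('g series, 'g series) tensor" where
  "twisted_cobracket br \<sigma> m np h nm t a =
     standard_cobracket br \<sigma> m np h nm a + tensor_ad (loop_algebra \<sigma> m) (series_bracket br) a t"

definition W_twist ::
    "('g::complex_vector \<Rightarrow> 'g \<Rightarrow> 'g) \<Rightarrow> ('g \<Rightarrow> 'g) \<Rightarrow> nat \<Rightarrow> 'g set \<Rightarrow> 'g set \<Rightarrow> 'g set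
      \<Rightarrow> ('g series, 'g series) tensor \<Rightarrow> ('g series \<times> 'g series) set" where
  "W_twist br \<sigma> m np h nm t =
     {w + tensor_lift (loop_algebra \<sigma> m) (loop_algebra \<sigma> m)
            (\<lambda>a b. loop_double_form br w (diag_embed a) *\<^sub>C diag_embed b) t | w. w \<in> W_std \<sigma> m np h nm}"


section \<open>Completions\<close>

definition t_mult :: "nat \<Rightarrow> 'g series \<Rightarrow> 'g series" where
  "t_mult m f = (\<lambda>k. f (k - int m))"

text \<open>\<open>\<mm>\<close> is generated by \<open>t\<^sub>+\<close> and \<open>t\<^sub>-\<close>, hence \<open>\<mm>W = t\<^sub>+W + t\<^sub>-W\<close> for an \<open>O\<close>-submodule \<open>W\<close>.\<close>

definition max_ideal_mult ::
    "nat \<Rightarrow> ('g::complex_vector series \<times> 'g series) set \<Rightarrow> ('g series \<times> 'g series) set" where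
  "max_ideal_mult m W =
     {(t_mult m (fst x), 0) + (0, t_mult m (snd y)) | x y. x \<in> W \<and> y \<in> W}"

text \<open>The inverse limit of the quotients \<open>W / \<mm>\<^sup>kW\<close>, realised inside \<open>completed_loop_double \<sigma> m\<close>: the class
  of a compatible family \<open>(w\<^sub>k)\<close> is identified with the coefficientwise limit of \<open>w\<^sub>k\<close>.\<close>

definition W_completion ::
    "('g::complex_vector \<Rightarrow> 'g) \<Rightarrow> nat \<Rightarrow> ('g series \<times> 'g series) set \<Rightarrow> ('g series \<times> 'g series) set"
  where
  "W_completion \<sigma> m W =
     {x \<in> completed_loop_double \<sigma> m.
        \<exists>w :: nat \<Rightarrow> 'g series \<times> 'g series.
          (\<forall>k. w k \<in> W \<and> w (Suc k) - w k \<in> (max_ideal_mult m ^^ k) W) \<and>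
          (\<forall>n::int. \<exists>K. \<forall>k\<ge>K. \<forall>j<n. fst (w k) j = fst x j \<and> snd (w k) j = snd x j)}"

end

(* Work with the form F on D: it pairs L = C non-degenerately with every Lagrangian complement W of C, so
   a tensor over L is known from its values on W. Relative to W, a skew map W -> C of finite rank is the same as
   an element t of the exterior square of L, and its graph is W_t; since commensurability gives finite
   rank, every Lagrangian complement commensurable with the standard one is such a graph. The cobracket
   delta_t is dual to the bracket on W_t, projected to W_t along C. Hence it is always a cocycle, and it
   satisfies co-Jacobi if W_t is a subalgebra. Conversely, co-Jacobi makes the C-component of [W_t, W_t]
   invariant up to bounded degree, and no nonzero element of L has an L-orbit of bounded degree.

   The argument works for D and for its completion alike; since t only sees finitely many degrees, the
   completion of W_t is the graph of t over the completed standard complement. The form F is non-degenerate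
   by Cartan's criterion: if the Killing form vanished, conjugating the eigenvalues of ad x would give
   a derivation whose product with ad x has trace 0, so ad x would be nilpotent, contradicting Engel. *)
theory Submission
  imports Defs "HOL-Computational_Algebra.Fundamental_Theorem_Algebra"
begin

section \<open>Linear maps on subspaces and tensor products\<close>

text \<open>Tensors stay over the loop algebra itself, and \<open>pair\<close>,
  \<open>contract\<close> and \<open>graph\<close> see the form only through
  \<open>diag_embed\<close>. They are therefore literally the same functions for D and for its
  completion, and one locale, \<open>loop_model\<close>, serves every double R between the two.

  All finiteness comes from one filtration: \<open>low n\<close> says that both components vanish
  below degree n. For given t there is an N such that \<open>graph t W0\<close> contains everything
  of R in degrees >= N and lies in degrees >= -N. Brackets of its elements then live in degrees >=
  -2N and are orthogonal to the tail in degrees >= 2N + 1; this is how the obstruction to closure is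
  bounded. That tail still detects every element of L, because the eigenspaces of \<sigma> repeat
  with period m: the homogeneous parts of high degree already span the simple Lie algebra.

  The standard cobracket is a choice that refers to D alone. Its duality with the completed
  complement is derived: a cobracket dual to the completed complement exists, and by uniqueness over
  D it is the chosen one.\<close>

interpretation cvp: vector_space_pair
    "scaleC :: complex \<Rightarrow> 'a \<Rightarrow> 'a::complex_vector" "scaleC :: complex \<Rightarrow> 'b \<Rightarrow> 'b::complex_vector"
  by unfold_locales

lemma linear_on_UNIV_iff: "linear_on UNIV f \<longleftrightarrow> Vector_Spaces.linear scaleC scaleC f"
  by (simp add: linear_on_def Vector_Spaces.linear_iff cv.vector_space_axioms)

lemma mem_subspace_if_spanning:
  assumes "cv.span A = UNIV" "cv.subspace V" "A \<subseteq> V"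
  shows "x \<in> V"
  using cv.span_minimal[OF assms(3,2)] assms(1) by auto

lemma linear_onI:
  assumes "\<And>x y. x \<in> S \<Longrightarrow> y \<in> S \<Longrightarrow> f (x + y) = f x + f y"
    and "\<And>c x. x \<in> S \<Longrightarrow> f (c *\<^sub>C x) = c *\<^sub>C f x"
  shows "linear_on S f"
  using assms by (simp add: linear_on_def)

lemma linear_on_add: "linear_on S f \<Longrightarrow> x \<in> S \<Longrightarrow> y \<in> S \<Longrightarrow> f (x + y) = f x + f y"
  by (simp add: linear_on_def)

lemma linear_on_scale: "linear_on S f \<Longrightarrow> x \<in> S \<Longrightarrow> f (c *\<^sub>C x) = c *\<^sub>C f x"
  by (simp add: linear_on_def)

lemma linear_on_zero: "linear_on S f \<Longrightarrow> cv.subspace S \<Longrightarrow> f 0 = 0"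
  using linear_on_scale[of S f 0 0] by (simp add: cv.subspace_0)

lemma linear_on_neg: "linear_on S f \<Longrightarrow> cv.subspace S \<Longrightarrow> x \<in> S \<Longrightarrow> f (- x) = - f x"
  using linear_on_scale[of S f x "-1"] by simp

lemma linear_on_diff:
  "linear_on S f \<Longrightarrow> cv.subspace S \<Longrightarrow> x \<in> S \<Longrightarrow> y \<in> S \<Longrightarrow> f (x - y) = f x - f y"
  using linear_on_add[of S f x "- y"] by (simp add: linear_on_neg cv.subspace_neg)

lemma linear_on_sum:
  assumes "linear_on S f" "cv.subspace S" "\<And>i. i \<in> I \<Longrightarrow> g i \<in> S"
  shows "f (\<Sum>i\<in>I. g i) = (\<Sum>i\<in>I. f (g i))"
proof (cases "finite I")
  case True
  then show ?thesis using assms(3)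
    by (induction I) (auto simp: linear_on_zero[OF assms(1,2)]
        linear_on_add[OF assms(1)] cv.subspace_sum[OF assms(2)])
qed (simp add: linear_on_zero[OF assms(1,2)])

lemma linear_on_mono: "linear_on S f \<Longrightarrow> T \<subseteq> S \<Longrightarrow> linear_on T f"
  unfolding linear_on_def by blast

lemma bilinear_onD:
  assumes "bilinear_on S T \<beta>"
  shows "x \<in> S \<Longrightarrow> linear_on T (\<beta> x)" and "y \<in> T \<Longrightarrow> linear_on S (\<lambda>x. \<beta> x y)"
  using assms by (auto simp: bilinear_on_def)

lemma bilinear_on_mono: "bilinear_on S T \<beta> \<Longrightarrow> S' \<subseteq> S \<Longrightarrow> T' \<subseteq> T \<Longrightarrow> bilinear_on S' T' \<beta>"
  by (auto simp: bilinear_on_def intro: linear_on_mono)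

text \<open>Bilinear data are only given on subspaces. Precomposing with such a projection in each
  argument extends them to the ambient spaces, where the universal property of the tensor type is
  available.\<close>

lemma ex_linear_projection:
  fixes S :: "'a::complex_vector set"
  assumes "cv.subspace S"
  obtains p where "linear_on UNIV p" "\<And>x. p x \<in> S" "\<And>x. x \<in> S \<Longrightarrow> p x = x"
proof -
  have "Vector_Spaces.linear scaleC scaleC (id :: 'a \<Rightarrow> 'a)"
    by (simp add: linear_on_UNIV_iff[symmetric] linear_on_def)
  from cvp.linear_exists_left_inverse_on[OF this assms]
  have "\<exists>p. range p \<subseteq> S \<and> Vector_Spaces.linear scaleC scaleC p \<and> (\<forall>x\<in>S. p x = x)"
    by simp
  then show ?thesis using that by (auto simp: linear_on_UNIV_iff)
qed

section \<open>Universal property of the tensor product\<close>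

definition free_lift ::
    "('a \<Rightarrow> 'b \<Rightarrow> 'c::complex_vector) \<Rightarrow> (('a \<times> 'b) \<Rightarrow>\<^sub>0 complex) \<Rightarrow> 'c" where
  "free_lift \<beta> p = (\<Sum>k\<in>Poly_Mapping.keys p. Poly_Mapping.lookup p k *\<^sub>C \<beta> (fst k) (snd k))"

lemma free_lift_superset:
  assumes "finite A" "Poly_Mapping.keys p \<subseteq> A"
  shows "free_lift \<beta> p = (\<Sum>k\<in>A. Poly_Mapping.lookup p k *\<^sub>C \<beta> (fst k) (snd k))"
  unfolding free_lift_def using assms
  by (intro sum.mono_neutral_left) (auto simp: in_keys_iff)

lemma free_lift_add: "free_lift \<beta> (p + q) = free_lift \<beta> p + free_lift \<beta> q"
proof -
  let ?A = "Poly_Mapping.keys p \<union> Poly_Mapping.keys q"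
  have "Poly_Mapping.keys (p + q) \<subseteq> ?A" by (rule Poly_Mapping.keys_add)
  then show ?thesis
    by (subst (1 2 3) free_lift_superset[of ?A])
      (auto simp: lookup_add cv.scale_left_distrib sum.distrib)
qed

lemma lookup_scaleC: "Poly_Mapping.lookup (c *\<^sub>C p) k = c *\<^sub>C Poly_Mapping.lookup p k"
  by (simp add: scaleC_poly_mapping_def Poly_Mapping.map.rep_eq when_def)

lemma free_lift_scale: "free_lift \<beta> (c *\<^sub>C p) = c *\<^sub>C free_lift \<beta> p"
proof -
  let ?A = "Poly_Mapping.keys p"
  have "Poly_Mapping.keys (c *\<^sub>C p) \<subseteq> ?A"
    by (auto simp: in_keys_iff lookup_scaleC)
  then show ?thesis
    by (subst (1 2) free_lift_superset[of ?A])
      (auto simp: lookup_scaleC cv.scale_sum_right scaleC_complex_def)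
qed

lemma free_lift_linear: "linear_on UNIV (free_lift \<beta>)"
  by (simp add: linear_on_def free_lift_add free_lift_scale)

lemma free_lift_single: "free_lift \<beta> (Poly_Mapping.single (a, b) 1) = \<beta> a b"
  by (simp add: free_lift_def)

lemma free_lift_diff: "free_lift \<beta> (p - q) = free_lift \<beta> p - free_lift \<beta> q"
  by (simp add: linear_on_diff[OF free_lift_linear])

lemma free_lift_relators:
  assumes "bilinear_on UNIV UNIV \<beta>" "p \<in> cv.span tensor_relators"
  shows "free_lift \<beta> p = 0"
  using assms(2)
proof (rule cv.span_induct)
  show "cv.subspace {p. free_lift \<beta> p = 0}"
    using cv.module_axioms by (auto simp: cv.subspace_def free_lift_add free_lift_scale linear_on_zero[OF free_lift_linear])
  have l: "\<beta> (x + x') y = \<beta> x y + \<beta> x' y" "\<beta> x (y + y') = \<beta> x y + \<beta> x y'"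
    "\<beta> (c *\<^sub>C x) y = c *\<^sub>C \<beta> x y" "\<beta> x (c *\<^sub>C y) = c *\<^sub>C \<beta> x y" for x x' y y' c
    using assms(1) by (auto simp: bilinear_on_def linear_on_def)
  show "free_lift \<beta> q = 0" if "q \<in> tensor_relators" for q
    using that unfolding tensor_relators_def
    by (auto simp: free_lift_diff free_lift_scale free_lift_single l)
qed

text \<open>\<open>free_lift\<close> of a bilinear map kills the relators, so evaluating it on an
  arbitrary representative of a class is well defined.\<close>

lemma ex_tensor_map_UNIV:
  fixes \<beta> :: "'a::complex_vector \<Rightarrow> 'b::complex_vector \<Rightarrow> 'c::complex_vector"
  assumes "bilinear_on UNIV UNIV \<beta>"
  obtains h where "linear_on UNIV h" "\<And>a b. h (a \<otimes>\<^sub>C b) = \<beta> a b"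
proof
  let ?h = "\<lambda>t. free_lift \<beta> (rep_tensor t)"
  have abs: "?h (abs_tensor p) = free_lift \<beta> p" for p
  proof -
    have "tensor_rel (rep_tensor (abs_tensor p)) p"
      using Quotient_rep_abs[OF Quotient_tensor] by (simp add: tensor_rel_def cv.span_zero)
    then have "free_lift \<beta> (rep_tensor (abs_tensor p) - p) = 0"
      unfolding tensor_rel_def by (rule free_lift_relators[OF assms])
    then show ?thesis by (simp add: free_lift_diff)
  qed
  have rep: "abs_tensor (rep_tensor t) = t" for t :: "('a, 'b) tensor"
    by (rule Quotient_abs_rep[OF Quotient_tensor])
  show "linear_on UNIV ?h"
  proof (rule linear_onI)
    fix s t :: "('a, 'b) tensor" and c
    show "?h (s + t) = ?h s + ?h t"
      using abs[of "rep_tensor s + rep_tensor t"]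
      by (simp add: plus_tensor.abs_eq[symmetric] rep free_lift_add)
    show "?h (c *\<^sub>C t) = c *\<^sub>C ?h t"
      using abs[of "c *\<^sub>C rep_tensor t"]
      by (simp add: scaleC_tensor.abs_eq[symmetric] rep free_lift_scale)
  qed
  show "?h (a \<otimes>\<^sub>C b) = \<beta> a b" for a b
    by (simp add: tensor_prod.abs_eq abs free_lift_single)
qed

lemma tensor_prod_simps:
  "(x + x') \<otimes>\<^sub>C y = x \<otimes>\<^sub>C y + x' \<otimes>\<^sub>C y" "x \<otimes>\<^sub>C (y + y') = x \<otimes>\<^sub>C y + x \<otimes>\<^sub>C y'"
  "(c *\<^sub>C x) \<otimes>\<^sub>C y = c *\<^sub>C (x \<otimes>\<^sub>C y)" "x \<otimes>\<^sub>C (c *\<^sub>C y) = c *\<^sub>C (x \<otimes>\<^sub>C y)"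
  using bilinear_onD(1)[OF tensor_prod_bilinear, of x] bilinear_onD(2)[OF tensor_prod_bilinear, of y]
  unfolding linear_on_def by blast+

lemma tensor_prod_zero_left: "0 \<otimes>\<^sub>C y = 0"
  using tensor_prod_simps(3)[of 0 0 y] by simp

lemma tensor_prod_zero_right: "x \<otimes>\<^sub>C 0 = 0"
  using tensor_prod_simps(4)[of x 0 0] by simp

lemma tensor_prod_sum_right: "x \<otimes>\<^sub>C (\<Sum>i\<in>I. f i) = (\<Sum>i\<in>I. x \<otimes>\<^sub>C f i)"
  by (induction I rule: infinite_finite_induct) (simp_all add: tensor_prod_zero_right tensor_prod_simps)

lemma subspace_tensor_space [simp]: "cv.subspace (tensor_space S T)"
  by (simp add: tensor_space_def)

lemma tensor_space_prod: "a \<in> S \<Longrightarrow> b \<in> T \<Longrightarrow> a \<otimes>\<^sub>C b \<in> tensor_space S T"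
  by (auto simp: tensor_space_def intro: cv.span_base)

text \<open>There is no case for scalar multiples: a scalar is absorbed into the left factor, which
  stays in the subspace S.\<close>

lemma tensor_space_induct [consumes 2, case_names zero prod add]:
  assumes t: "t \<in> tensor_space S T" and S: "cv.subspace S"
    and zero: "P 0"
    and prod: "\<And>a b. a \<in> S \<Longrightarrow> b \<in> T \<Longrightarrow> P (a \<otimes>\<^sub>C b)"
    and add: "\<And>s t. s \<in> tensor_space S T \<Longrightarrow> t \<in> tensor_space S T \<Longrightarrow> P s \<Longrightarrow> P t \<Longrightarrow> P (s + t)"
  shows "P t"
proof -
  have "P t \<and> t \<in> tensor_space S T" using t unfolding tensor_space_def
  proof (induction rule: cv.span_induct_alt)
    case base then show ?case by (simp add: zero cv.span_zero)
  next
    case (step c x y)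
    then obtain a b where ab: "x = a \<otimes>\<^sub>C b" "a \<in> S" "b \<in> T" by auto
    have "c *\<^sub>C x = (c *\<^sub>C a) \<otimes>\<^sub>C b" by (simp add: ab tensor_prod_simps)
    moreover have ca: "c *\<^sub>C a \<in> S" using S ab by (simp add: cv.subspace_scale)
    ultimately have cx: "P (c *\<^sub>C x)" "c *\<^sub>C x \<in> tensor_space S T"
      using prod[OF ca ab(3)] tensor_space_prod[OF ca ab(3)] by simp_all
    then have "P (c *\<^sub>C x + y)" using add[of "c *\<^sub>C x" y] step
      by (simp add: tensor_space_def)
    moreover have "c *\<^sub>C x + y \<in> tensor_space S T"
      using cx(2) step by (simp add: tensor_space_def cv.span_add)
    ultimately show ?case by (simp add: tensor_space_def)
  qed
  then show ?thesis ..
qed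

lemma tensor_space_list:
  assumes "t \<in> tensor_space S T" "cv.subspace S"
  shows "\<exists>xs. set xs \<subseteq> S \<times> T \<and> t = (\<Sum>(a, b)\<leftarrow>xs. a \<otimes>\<^sub>C b)"
  using assms
proof (induction rule: tensor_space_induct)
  case zero
  show ?case by (intro exI[of _ "[]"]) simp
next
  case (prod a b)
  then show ?case by (intro exI[of _ "[(a, b)]"]) simp
next
  case (add s t)
  then obtain xs ys where "set xs \<subseteq> S \<times> T" "s = (\<Sum>(a, b)\<leftarrow>xs. a \<otimes>\<^sub>C b)"
    "set ys \<subseteq> S \<times> T" "t = (\<Sum>(a, b)\<leftarrow>ys. a \<otimes>\<^sub>C b)" by auto
  then show ?case by (intro exI[of _ "xs @ ys"]) auto
qed

text \<open>\<open>tensor_lift\<close> is a definite description over list representations. A linear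
  map on the ambient tensor space that agrees with \<beta> on pure tensors forces all
  representations to give the same value.\<close>

lemma tensor_lift_eqI:
  fixes \<beta> :: "'a::complex_vector \<Rightarrow> 'b::complex_vector \<Rightarrow> 'c::complex_vector"
  assumes S: "cv.subspace S" and h: "linear_on UNIV h" "\<And>a b. a \<in> S \<Longrightarrow> b \<in> T \<Longrightarrow> h (a \<otimes>\<^sub>C b) = \<beta> a b"
    and t: "t \<in> tensor_space S T"
  shows "tensor_lift S T \<beta> t = h t"
proof -
  have *: "h (\<Sum>(a, b)\<leftarrow>xs. a \<otimes>\<^sub>C b) = (\<Sum>(a, b)\<leftarrow>xs. \<beta> a b)" if "set xs \<subseteq> S \<times> T" for xs
    using that by (induction xs) (auto simp: h linear_on_zero[OF h(1)] linear_on_add[OF h(1)])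
  obtain xs where xs: "set xs \<subseteq> S \<times> T" "t = (\<Sum>(a, b)\<leftarrow>xs. a \<otimes>\<^sub>C b)"
    using tensor_space_list[OF t S] by blast
  show ?thesis unfolding tensor_lift_def
  proof (rule the_equality)
    show "\<exists>xs. set xs \<subseteq> S \<times> T \<and> t = (\<Sum>(a, b)\<leftarrow>xs. a \<otimes>\<^sub>C b) \<and> h t = (\<Sum>(a, b)\<leftarrow>xs. \<beta> a b)"
      using xs *[OF xs(1)] by auto
  qed (use * in auto)
qed

text \<open>Projections onto S and T make \<beta> bilinear on the ambient spaces without changing it
  on S and T. All later facts about \<open>tensor_lift\<close> of a bilinear map are read off from
  the linear map obtained here.\<close>

lemma ex_tensor_map:
  fixes \<beta> :: "'a::complex_vector \<Rightarrow> 'b::complex_vector \<Rightarrow> 'c::complex_vector"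
  assumes S: "cv.subspace S" and T: "cv.subspace T" and b: "bilinear_on S T \<beta>"
  shows "\<exists>h. linear_on UNIV h \<and> (\<forall>a\<in>S. \<forall>b\<in>T. h (a \<otimes>\<^sub>C b) = \<beta> a b) \<and>
    (\<forall>t\<in>tensor_space S T. tensor_lift S T \<beta> t = h t)"
proof -
  obtain p where p: "linear_on UNIV p" "\<And>x. p x \<in> S" "\<And>x. x \<in> S \<Longrightarrow> p x = x"
    using ex_linear_projection[OF S] by blast
  obtain q where q: "linear_on UNIV q" "\<And>x. q x \<in> T" "\<And>x. x \<in> T \<Longrightarrow> q x = x"
    using ex_linear_projection[OF T] by blast
  have "bilinear_on UNIV UNIV (\<lambda>x y. \<beta> (p x) (q y))"
    using b p q by (auto simp: bilinear_on_def linear_on_def)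
  then obtain h where h: "linear_on UNIV h" "\<And>a b. h (a \<otimes>\<^sub>C b) = \<beta> (p a) (q b)"
    using ex_tensor_map_UNIV by blast
  have "h (a \<otimes>\<^sub>C b) = \<beta> a b" if "a \<in> S" "b \<in> T" for a b
    using that by (simp add: h p q)
  then show ?thesis using tensor_lift_eqI[OF S h(1)] h(1) by blast
qed

lemma tensor_lift_prod:
  assumes "cv.subspace S" "cv.subspace T" "bilinear_on S T \<beta>" "a \<in> S" "b \<in> T"
  shows "tensor_lift S T \<beta> (a \<otimes>\<^sub>C b) = \<beta> a b"
proof -
  obtain h where l: "linear_on UNIV h" and h: "\<And>a b. a \<in> S \<Longrightarrow> b \<in> T \<Longrightarrow> h (a \<otimes>\<^sub>C b) = \<beta> a b"
    "\<And>t. t \<in> tensor_space S T \<Longrightarrow> tensor_lift S T \<beta> t = h t"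
    using ex_tensor_map[OF assms(1-3)] by blast
  show ?thesis using h(1)[OF assms(4,5)] h(2)[OF tensor_space_prod[OF assms(4,5)]] by simp
qed

lemma tensor_lift_linear:
  assumes "cv.subspace S" "cv.subspace T" "bilinear_on S T \<beta>"
  shows "linear_on (tensor_space S T) (tensor_lift S T \<beta>)"
proof -
  obtain h where h: "linear_on UNIV h" "\<And>a b. a \<in> S \<Longrightarrow> b \<in> T \<Longrightarrow> h (a \<otimes>\<^sub>C b) = \<beta> a b"
    "\<And>t. t \<in> tensor_space S T \<Longrightarrow> tensor_lift S T \<beta> t = h t"
    using ex_tensor_map[OF assms] by blast
  show ?thesis
    by (rule linear_onI) (simp_all add: h(3) linear_on_add[OF h(1)] linear_on_scale[OF h(1)]
        cv.subspace_add cv.subspace_scale)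
qed

lemma linear_on_tensor_eq:
  assumes "linear_on (tensor_space S T) f" "linear_on (tensor_space S T) g"
    and "\<And>a b. a \<in> S \<Longrightarrow> b \<in> T \<Longrightarrow> f (a \<otimes>\<^sub>C b) = g (a \<otimes>\<^sub>C b)"
    and "cv.subspace S" "t \<in> tensor_space S T"
  shows "f t = g t"
  using assms(5,4)
proof (induction rule: tensor_space_induct)
  case zero
  then show ?case using linear_on_zero[OF assms(1)] linear_on_zero[OF assms(2)] by simp
qed (simp_all add: assms(3) linear_on_add[OF assms(1)] linear_on_add[OF assms(2)])

lemma tensor_lift_in:
  assumes "cv.subspace S" "cv.subspace T" "bilinear_on S T \<beta>" "t \<in> tensor_space S T"
    and "cv.subspace U" "\<And>a b. a \<in> S \<Longrightarrow> b \<in> T \<Longrightarrow> \<beta> a b \<in> U"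
  shows "tensor_lift S T \<beta> t \<in> U"
  using assms(4,1)
proof (induction rule: tensor_space_induct)
  case zero
  then show ?case using linear_on_zero[OF tensor_lift_linear[OF assms(1-3)]] assms(5)
    by (simp add: cv.subspace_0)
next
  case (prod a b)
  then show ?case using assms(6) tensor_lift_prod[OF assms(1-3)] by simp
next
  case (add s t)
  then show ?case
    using assms(5) linear_on_add[OF tensor_lift_linear[OF assms(1-3)]] by (simp add: cv.subspace_add)
qed

text \<open>Naturality of the lift; it moves a pairing through a swap, an embedding or a cobracket
  below.\<close>

lemma linear_on_compose_tensor_lift:
  assumes "cv.subspace S" "cv.subspace T" "bilinear_on S T \<beta>" "t \<in> tensor_space S T"
    and "cv.subspace U" "\<And>a b. a \<in> S \<Longrightarrow> b \<in> T \<Longrightarrow> \<beta> a b \<in> U" "linear_on U f"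
  shows "f (tensor_lift S T \<beta> t) = tensor_lift S T (\<lambda>a b. f (\<beta> a b)) t"
proof -
  have b: "bilinear_on S T (\<lambda>a b. f (\<beta> a b))"
    using assms(3,6,7) by (auto simp: bilinear_on_def linear_on_def)
  have l: "linear_on (tensor_space S T) (\<lambda>t. f (tensor_lift S T \<beta> t))"
    by (rule linear_onI)
      (simp_all add: tensor_lift_in[OF assms(1-3) _ assms(5,6)]
        linear_on_add[OF tensor_lift_linear[OF assms(1-3)]] linear_on_add[OF assms(7)]
        linear_on_scale[OF tensor_lift_linear[OF assms(1-3)]] linear_on_scale[OF assms(7)])
  show ?thesis
    by (rule linear_on_tensor_eq[OF l tensor_lift_linear[OF assms(1,2) b] _ assms(1) assms(4)])
      (simp add: tensor_lift_prod[OF assms(1,2)] assms(3) b)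
qed

text \<open>Independence of the right factors lets the left factors be recovered one by one from
  evaluations on the right.\<close>

lemma tensor_space_independent_rep:
  fixes S :: "'a::complex_vector set" and T :: "'b::complex_vector set"
  assumes t: "t \<in> tensor_space S T" and S: "cv.subspace S"
  obtains E a where "finite E" "E \<subseteq> T" "cv.independent E" "\<And>e. e \<in> E \<Longrightarrow> a e \<in> S"
    "t = (\<Sum>e\<in>E. a e \<otimes>\<^sub>C e)"
proof -
  obtain xs where xs: "set xs \<subseteq> S \<times> T" "t = (\<Sum>(a, b)\<leftarrow>xs. a \<otimes>\<^sub>C b)"
    using tensor_space_list[OF t S] by blast
  \<comment> \<open>Choosing E among the second factors of the list keeps it finite and inside
    T.\<close>
  obtain E where E: "E \<subseteq> snd ` set xs" "cv.independent E" "snd ` set xs \<subseteq> cv.span E"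
    using cv.maximal_independent_subset[of "snd ` set xs"] by blast
  have fE: "finite E" using E(1) finite_subset by blast
  have "\<exists>a. (\<forall>e\<in>E. a e \<in> S) \<and> (\<Sum>(a, b)\<leftarrow>ys. a \<otimes>\<^sub>C b) = (\<Sum>e\<in>E. a e \<otimes>\<^sub>C e)"
    if "set ys \<subseteq> S \<times> cv.span E" for ys
    using that
  proof (induction ys)
    case Nil
    then show ?case using S
      by (intro exI[of _ "\<lambda>_. 0"]) (simp add: cv.subspace_0 tensor_prod_zero_left)
  next
    case (Cons y ys)
    obtain u v where y: "y = (u, v)" "u \<in> S" "v \<in> cv.span E" using Cons by auto
    obtain a where a: "\<forall>e\<in>E. a e \<in> S" "(\<Sum>(a, b)\<leftarrow>ys. a \<otimes>\<^sub>C b) = (\<Sum>e\<in>E. a e \<otimes>\<^sub>C e)"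
      using Cons by auto
    obtain r where r: "v = (\<Sum>e\<in>E. r e *\<^sub>C e)"
      using y(3) unfolding cv.span_finite[OF fE] by blast
    show ?case
      by (rule exI[of _ "\<lambda>e. r e *\<^sub>C u + a e"])
        (use S y a in \<open>simp add: cv.subspace_add cv.subspace_scale r tensor_prod_sum_right
          tensor_prod_simps sum.distrib\<close>)
  qed
  from this[of xs] obtain a where "\<forall>e\<in>E. a e \<in> S" "t = (\<Sum>e\<in>E. a e \<otimes>\<^sub>C e)"
    using xs E(3) by (fastforce simp: image_subset_iff)
  moreover have "E \<subseteq> T" using E(1) xs(1) by fastforce
  ultimately show ?thesis using that[OF fE _ E(2)] by blast
qed

text \<open>Write the tensor as \<open>\<Sum>\<^sub>e a e \<otimes> e\<close> with linearly independent \<open>e\<close>: the \<open>\<psi> j\<close> then detect each \<open>\<phi> i (a e)\<close>.\<close>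

lemma tensor_separation:
  fixes S :: "'a::complex_vector set" and T :: "'b::complex_vector set"
    and \<phi> :: "'i \<Rightarrow> 'a \<Rightarrow> complex" and \<psi> :: "'j \<Rightarrow> 'b \<Rightarrow> complex"
  assumes S: "cv.subspace S" and T: "cv.subspace T" and t: "t \<in> tensor_space S T"
    and \<phi>: "\<And>i. i \<in> I \<Longrightarrow> linear_on S (\<phi> i)" "\<And>x. x \<in> S \<Longrightarrow> (\<And>i. i \<in> I \<Longrightarrow> \<phi> i x = 0) \<Longrightarrow> x = 0"
    and \<psi>: "\<And>j. j \<in> J \<Longrightarrow> linear_on T (\<psi> j)" "\<And>x. x \<in> T \<Longrightarrow> (\<And>j. j \<in> J \<Longrightarrow> \<psi> j x = 0) \<Longrightarrow> x = 0"
    and z: "\<And>i j. i \<in> I \<Longrightarrow> j \<in> J \<Longrightarrow> tensor_lift S T (\<lambda>a b. \<phi> i a * \<psi> j b) t = 0"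
  shows "t = 0"
proof -
  obtain E a where E: "finite E" "E \<subseteq> T" "cv.independent E" and a: "\<And>e. e \<in> E \<Longrightarrow> a e \<in> S"
    and te: "t = (\<Sum>e\<in>E. a e \<otimes>\<^sub>C e)"
    using tensor_space_independent_rep[OF t S] by metis
  have "\<phi> i (a e) = 0" if e: "e \<in> E" and i: "i \<in> I" for e i
  proof -
    have "\<psi> j (\<Sum>e\<in>E. \<phi> i (a e) *\<^sub>C e) = 0" if j: "j \<in> J" for j
    proof -
      have b: "bilinear_on S T (\<lambda>a b. \<phi> i a * \<psi> j b)"
        using \<phi>(1)[OF i] \<psi>(1)[OF j]
        by (auto simp: bilinear_on_def linear_on_def scaleC_complex_def algebra_simps)
      have "0 = tensor_lift S T (\<lambda>a b. \<phi> i a * \<psi> j b) t" using z[OF i j] by simp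
      also have "\<dots> = (\<Sum>e\<in>E. \<phi> i (a e) * \<psi> j e)"
        unfolding te using E a
        by (subst linear_on_sum[OF tensor_lift_linear[OF S T b]])
          (auto intro!: sum.cong tensor_space_prod simp: tensor_lift_prod[OF S T b] subset_eq)
      also have "\<dots> = \<psi> j (\<Sum>e\<in>E. \<phi> i (a e) *\<^sub>C e)"
        using E T by (subst linear_on_sum[OF \<psi>(1)[OF j] T])
          (auto intro!: sum.cong cv.subspace_scale simp: linear_on_scale[OF \<psi>(1)[OF j]] scaleC_complex_def subset_eq)
      finally show ?thesis by simp
    qed
    then have "(\<Sum>e\<in>E. \<phi> i (a e) *\<^sub>C e) = 0"
      using E T by (intro \<psi>(2)) (auto intro!: cv.subspace_sum cv.subspace_scale)
    then show ?thesis using cv.independentD[OF E(3,1) order.refl, of "\<lambda>e. \<phi> i (a e)"] e by blast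
  qed
  then have "a e = 0" if "e \<in> E" for e using \<phi>(2)[OF a[OF that]] that by blast
  then show ?thesis by (simp add: te tensor_prod_zero_left)
qed

section \<open>Traces and generalised eigenspaces\<close>

lemma finite_dimensional_basis:
  assumes "finite_dimensional (UNIV :: 'g::complex_vector set)" "cv.independent (B :: 'g set)"
  shows "finite B"
proof -
  obtain C :: "'g set" where "finite C" "cv.span C = UNIV"
    using assms(1) by (auto simp: finite_dimensional_def)
  then show ?thesis using cv.independent_span_bound[of C B] assms(2) by simp
qed

lemma sum_representation_UNIV:
  assumes "cv.independent B" "cv.span B = UNIV" "finite B"
  shows "(\<Sum>b\<in>B. cv.representation B v b *\<^sub>C b) = v"
  by (rule cv.sum_representation_eq) (use assms in auto)

lemma representation_linear:
  assumes "cv.independent B" "cv.span B = UNIV"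
  shows "linear_on UNIV (\<lambda>v. cv.representation B v b)"
  by (rule linear_onI) (simp_all add: cv.representation_add cv.representation_scale assms scaleC_complex_def)

text \<open>Both sides expand to the same double sum over B and C. With g = \<open>id\<close> this
  is independence of the basis, with B = C it is cyclicity of the trace.\<close>

lemma trace_swap:
  fixes B C :: "'g::complex_vector set"
  assumes B: "cv.independent B" "cv.span B = UNIV" "finite B"
    and C: "cv.independent C" "cv.span C = UNIV" "finite C"
    and f: "linear_on UNIV f" and g: "linear_on UNIV g"
  shows "(\<Sum>b\<in>B. cv.representation B (f (g b)) b) = (\<Sum>c\<in>C. cv.representation C (g (f c)) c)"
proof -
  have *: "(\<Sum>b\<in>B. cv.representation B (f (g b)) b) =
      (\<Sum>b\<in>B. \<Sum>c\<in>C. cv.representation C (g b) c * cv.representation B (f c) b)"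
    if B: "cv.independent B" "cv.span B = UNIV" "finite B"
    and C: "cv.independent C" "cv.span C = UNIV" "finite C"
    and f: "linear_on UNIV f" and g: "linear_on UNIV g" for B C :: "'g set" and f g
  proof (rule sum.cong[OF refl])
    fix b assume "b \<in> B"
    have "f (g b) = f (\<Sum>c\<in>C. cv.representation C (g b) c *\<^sub>C c)"
      by (simp add: sum_representation_UNIV[OF C])
    also have "\<dots> = (\<Sum>c\<in>C. cv.representation C (g b) c *\<^sub>C f c)"
      by (simp add: linear_on_sum[OF f] linear_on_scale[OF f])
    finally show "cv.representation B (f (g b)) b =
        (\<Sum>c\<in>C. cv.representation C (g b) c * cv.representation B (f c) b)"
      by (simp add: linear_on_sum[OF representation_linear[OF B(1,2)]]
          linear_on_scale[OF representation_linear[OF B(1,2)]] scaleC_complex_def)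
  qed
  show ?thesis
    unfolding *[OF B C f g] *[OF C B g f] by (subst sum.swap) (simp add: mult.commute)
qed

lemma independent_extend_basis_empty: "cv.independent (cv.extend_basis {})"
  and span_extend_basis_empty: "cv.span (cv.extend_basis {}) = UNIV"
  using cv.independent_extend_basis[OF cv.independent_empty]
    cv.span_extend_basis[OF cv.independent_empty] by auto

context
  assumes fd: "finite_dimensional (UNIV :: 'g::complex_vector set)"
begin

lemma endo_trace_basis:
  fixes B :: "'g set"
  assumes B: "cv.independent B" "cv.span B = UNIV" and f: "linear_on UNIV f"
  shows "endo_trace f = (\<Sum>b\<in>B. cv.representation B (f b) b)"
  using trace_swap[OF independent_extend_basis_empty span_extend_basis_empty
      finite_dimensional_basis[OF fd independent_extend_basis_empty] B
      finite_dimensional_basis[OF fd B(1)] f, of id]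
  by (simp add: endo_trace_def linear_on_def)

lemma endo_trace_cyclic:
  fixes f g :: "'g \<Rightarrow> 'g"
  assumes "linear_on UNIV f" "linear_on UNIV g"
  shows "endo_trace (\<lambda>x. f (g x)) = endo_trace (\<lambda>x. g (f x))"
  unfolding endo_trace_def
  by (rule trace_swap) (intro independent_extend_basis_empty span_extend_basis_empty
      finite_dimensional_basis[OF fd] assms)+

end

lemma endo_trace_add: "endo_trace (\<lambda>x. f x + g x) = endo_trace f + endo_trace g"
  by (simp add: endo_trace_def sum.distrib cv.representation_add
      independent_extend_basis_empty span_extend_basis_empty)

lemma endo_trace_diff: "endo_trace (\<lambda>x. f x - g x) = endo_trace f - endo_trace g"
  by (simp add: endo_trace_def sum_subtractf cv.representation_diff
      independent_extend_basis_empty span_extend_basis_empty)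

lemma endo_trace_scale: "endo_trace (\<lambda>x. c *\<^sub>C f x) = c * endo_trace f"
  by (simp add: endo_trace_def sum_distrib_left cv.representation_scale
      independent_extend_basis_empty span_extend_basis_empty)

section \<open>Generalised eigenspaces\<close>

definition shift :: "('a::complex_vector \<Rightarrow> 'a) \<Rightarrow> complex \<Rightarrow> 'a \<Rightarrow> 'a" where
  "shift A l x = A x - l *\<^sub>C x"

definition gen_eigenspace :: "('a::complex_vector \<Rightarrow> 'a) \<Rightarrow> complex \<Rightarrow> 'a set" where
  "gen_eigenspace A l = {v. \<exists>n. (shift A l ^^ n) v = 0}"

lemma linear_on_funpow: "linear_on UNIV (f :: 'a::complex_vector \<Rightarrow> 'a) \<Longrightarrow> linear_on UNIV (f ^^ n)"
  by (induction n) (auto simp: linear_on_def)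

lemma linear_on_shift: "linear_on UNIV A \<Longrightarrow> linear_on UNIV (shift A l)"
  by (auto simp: linear_on_def shift_def cv.scale_right_distrib cv.scale_right_diff_distrib mult.commute)

lemma funpow_zero_mono:
  assumes "linear_on UNIV (f :: 'a::complex_vector \<Rightarrow> 'a)" "(f ^^ n) v = 0" "n \<le> k"
  shows "(f ^^ k) v = 0"
proof -
  obtain d where "k = d + n" using assms(3) by (metis add.commute le_Suc_ex)
  then show ?thesis
    using assms(2) linear_on_zero[OF linear_on_funpow[OF assms(1)], of d] by (simp add: funpow_add)
qed

lemma gen_eigenspaceI: "(shift A l ^^ n) v = 0 \<Longrightarrow> v \<in> gen_eigenspace A l"
  by (auto simp: gen_eigenspace_def)

lemma subspace_gen_eigenspace:
  assumes A: "linear_on UNIV A"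
  shows "cv.subspace (gen_eigenspace A l)"
proof (rule cv.subspaceI)
  let ?S = "\<lambda>n. shift A l ^^ n"
  note lin = linear_on_shift[OF A]
  note S = linear_on_funpow[OF lin]
  show "0 \<in> gen_eigenspace A l" by (rule gen_eigenspaceI[of 0]) simp
  fix x y c assume "x \<in> gen_eigenspace A l" "y \<in> gen_eigenspace A l"
  then obtain n k where nk: "?S n x = 0" "?S k y = 0" by (auto simp: gen_eigenspace_def)
  then have "?S (max n k) x = 0" "?S (max n k) y = 0"
    using funpow_zero_mono[OF lin, of n l x "max n k"] funpow_zero_mono[OF lin, of k l y "max n k"] by auto
  then show "x + y \<in> gen_eigenspace A l"
    by (intro gen_eigenspaceI[of "max n k"]) (simp add: linear_on_add[OF S])
  show "c *\<^sub>C x \<in> gen_eigenspace A l"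
    using nk by (intro gen_eigenspaceI[of n]) (simp add: linear_on_scale[OF S])
qed

lemma shift_gen_eigenspace:
  assumes A: "linear_on UNIV A"
  shows "shift A l v \<in> gen_eigenspace A l \<longleftrightarrow> v \<in> gen_eigenspace A l"
proof
  assume "shift A l v \<in> gen_eigenspace A l"
  then obtain n where "(shift A l ^^ n) (shift A l v) = 0" by (auto simp: gen_eigenspace_def)
  then show "v \<in> gen_eigenspace A l" by (intro gen_eigenspaceI[of "Suc n"]) (simp add: funpow_swap1)
next
  assume "v \<in> gen_eigenspace A l"
  then obtain n where "(shift A l ^^ n) v = 0" by (auto simp: gen_eigenspace_def)
  then have "(shift A l ^^ n) (shift A l v) = 0"
    using funpow_zero_mono[OF linear_on_shift[OF A], of n l v "Suc n"]
    by (simp add: funpow_Suc_right del: funpow.simps)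
  then show "shift A l v \<in> gen_eigenspace A l" by (rule gen_eigenspaceI)
qed

lemma shift_change: "shift A l v = shift A m v + (m - l) *\<^sub>C v"
  by (simp add: shift_def cv.scale_left_diff_distrib)

lemma shift_gen_eigenspace_other:
  assumes A: "linear_on UNIV A" and v: "v \<in> gen_eigenspace A m"
  shows "shift A l v \<in> gen_eigenspace A m"
  unfolding shift_change[of A l v m] using shift_gen_eigenspace[OF A, of m v] v
    subspace_gen_eigenspace[OF A, of m] by (auto intro: cv.subspace_add cv.subspace_scale)

text \<open>A - m acts nilpotently on v, so A - l = (A - m) + (m - l) is invertible there; the
  induction builds the preimage one power of A - m at a time.\<close>

lemma shift_solve:
  assumes A: "linear_on UNIV A" and "l \<noteq> m" and "(shift A m ^^ n) v = 0"
  shows "\<exists>u\<in>gen_eigenspace A m. shift A l u = v"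
  using assms(3)
proof (induction n arbitrary: v)
  case 0
  then show ?case using subspace_gen_eigenspace[OF A, of m]
    by (intro bexI[of _ 0]) (auto simp: cv.subspace_0 linear_on_zero[OF linear_on_shift[OF A]])
next
  case (Suc n)
  from Suc.prems have v: "v \<in> gen_eigenspace A m" by (rule gen_eigenspaceI)
  have "(shift A m ^^ n) (shift A m v) = 0" using Suc.prems by (simp add: funpow_swap1)
  from Suc.IH[OF this] obtain u where u: "u \<in> gen_eigenspace A m" "shift A l u = shift A m v" by auto
  \<comment> \<open>(A - l)(v - u) = (A - l) v - (A - m) v = (m - l) v.\<close>
  let ?w = "(1 / (m - l)) *\<^sub>C (v - u)"
  have "?w \<in> gen_eigenspace A m"
    using u v subspace_gen_eigenspace[OF A] by (simp add: cv.subspace_diff cv.subspace_scale)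
  moreover have "shift A l ?w = v"
    using u(2) \<open>l \<noteq> m\<close> shift_change[of A l v m]
    by (simp add: linear_on_scale[OF linear_on_shift[OF A]] linear_on_diff[OF linear_on_shift[OF A]])
  ultimately show ?case by blast
qed

text \<open>A vector killed by A - l is an eigenvector of A - m with nonzero eigenvalue l - m, or
  zero, while A - m acts nilpotently on it.\<close>

lemma shift_injective:
  assumes A: "linear_on UNIV A" and lm: "l \<noteq> m" and v: "v \<in> gen_eigenspace A m" and z: "shift A l v = 0"
  shows "v = 0"
proof -
  obtain n where n: "(shift A m ^^ n) v = 0" using v by (auto simp: gen_eigenspace_def)
  have "shift A m v = (l - m) *\<^sub>C v" using z shift_change[of A m v l] by simp
  then have "(shift A m ^^ k) v = (l - m) ^ k *\<^sub>C v" for k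
    by (induction k) (simp_all add: linear_on_scale[OF linear_on_shift[OF A]] mult.commute)
  then show ?thesis using n lm by simp
qed

text \<open>A power of A - m removes the m-component from the relation and is injective on the other
  generalised eigenspaces, so the induction hypothesis applies to what is left.\<close>

lemma gen_eigenspaces_independent:
  assumes A: "linear_on UNIV A" and "finite S" and "\<And>l. l \<in> S \<Longrightarrow> v l \<in> gen_eigenspace A l"
    and "(\<Sum>l\<in>S. v l) = 0" and "l \<in> S"
  shows "v l = 0"
  using assms(2-5)
proof (induction S arbitrary: v l rule: finite_induct)
  case (insert m S)
  obtain n where n: "(shift A m ^^ n) (v m) = 0" using insert.prems(1)[of m] by (auto simp: gen_eigenspace_def)
  note lin = linear_on_funpow[OF linear_on_shift[OF A]]
  have "0 = (shift A m ^^ n) (\<Sum>l\<in>insert m S. v l)"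
    by (simp only: insert.prems(2) linear_on_zero[OF lin] cv.subspace_UNIV)
  also have "\<dots> = (\<Sum>l\<in>S. (shift A m ^^ n) (v l))"
    using insert.hyps n by (simp add: linear_on_add[OF lin] linear_on_sum[OF lin])
  finally have z: "(\<Sum>l\<in>S. (shift A m ^^ n) (v l)) = 0" by simp
  have pw: "(shift A m ^^ k) u \<in> gen_eigenspace A l \<and>
      ((shift A m ^^ k) u = 0 \<longrightarrow> m \<noteq> l \<longrightarrow> u = 0)" if "u \<in> gen_eigenspace A l" for k u l
  proof (induction k)
    case (Suc k)
    then show ?case using shift_gen_eigenspace_other[OF A] shift_injective[OF A] by auto
  qed (simp add: that)
  have "(shift A m ^^ n) (v l) = 0" if "l \<in> S" for l
    by (rule insert.IH[OF _ z that]) (use pw insert.prems(1) in blast)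
  then have S0: "v l = 0" if "l \<in> S" for l
    using pw[of "v l" l n] insert.prems(1)[of l] insert.hyps that by auto
  then show ?case using insert by auto
qed simp

section \<open>Polynomials in an endomorphism\<close>

definition poly_apply :: "complex poly \<Rightarrow> ('a::complex_vector \<Rightarrow> 'a) \<Rightarrow> 'a \<Rightarrow> 'a" where
  "poly_apply p A v = (\<Sum>i\<le>degree p. coeff p i *\<^sub>C (A ^^ i) v)"

lemma poly_apply_superset:
  assumes "degree p \<le> n"
  shows "poly_apply p A v = (\<Sum>i\<le>n. coeff p i *\<^sub>C (A ^^ i) v)"
  unfolding poly_apply_def using assms
  by (intro sum.mono_neutral_left) (auto simp: coeff_eq_0)

text \<open>A root is traded for one application of A - l to the vector, which is the step of the
  later induction on the degree.\<close>

lemma poly_apply_linear_factor: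
  assumes A: "linear_on UNIV A"
  shows "poly_apply ([:- l, 1:] * q) A v = poly_apply q A (shift A l v)"
proof -
  let ?n = "degree q"
  have "poly_apply ([:- l, 1:] * q) A v =
      (\<Sum>i\<le>Suc ?n. coeff ([:- l, 1:] * q) i *\<^sub>C (A ^^ i) v)"
    by (rule poly_apply_superset) (use degree_mult_le[of "[:- l, 1:]" q] in simp)
  also have "\<dots> = (\<Sum>i\<le>Suc ?n. coeff (pCons 0 q) i *\<^sub>C (A ^^ i) v) - l *\<^sub>C (\<Sum>i\<le>Suc ?n. coeff q i *\<^sub>C (A ^^ i) v)"
    by (simp add: cv.scale_left_diff_distrib sum_subtractf cv.scale_sum_right cv.scale_right_distrib
        del: sum.atMost_Suc)
  also have "(\<Sum>i\<le>Suc ?n. coeff (pCons 0 q) i *\<^sub>C (A ^^ i) v) = (\<Sum>i\<le>?n. coeff q i *\<^sub>C (A ^^ i) (A v))"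
    by (subst sum.atMost_Suc_shift) (simp add: funpow_swap1)
  also have "(\<Sum>i\<le>Suc ?n. coeff q i *\<^sub>C (A ^^ i) v) = (\<Sum>i\<le>?n. coeff q i *\<^sub>C (A ^^ i) v)"
    by (simp add: coeff_eq_0)
  finally show ?thesis
    by (simp add: poly_apply_def shift_def cv.scale_sum_right linear_on_diff[OF linear_on_funpow[OF A]]
        linear_on_scale[OF linear_on_funpow[OF A]] cv.scale_right_diff_distrib sum_subtractf mult.commute)
qed

lemma ex_annihilating_poly:
  assumes fd: "finite_dimensional (UNIV :: 'g::complex_vector set)"
  shows "\<exists>p. p \<noteq> 0 \<and> poly_apply p A (v :: 'g) = 0"
proof -
  obtain C :: "'g set" where C: "finite C" "cv.span C = UNIV"
    using fd by (auto simp: finite_dimensional_def)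
  define n where "n = card C"
  have "\<exists>c. (\<exists>i\<le>n. c i \<noteq> 0) \<and> (\<Sum>i\<le>n. c i *\<^sub>C (A ^^ i) v) = 0"
  proof (cases "inj_on (\<lambda>i. (A ^^ i) v) {..n}")
    case True
    let ?S = "(\<lambda>i. (A ^^ i) v) ` {..n}"
    have "cv.dependent ?S"
      using cv.independent_span_bound[OF C(1), of ?S] card_image[OF True] C(2) n_def by fastforce
    then obtain u where u: "\<exists>x\<in>?S. u x \<noteq> 0" "(\<Sum>x\<in>?S. u x *\<^sub>C x) = 0"
      using cv.dependent_finite[of ?S] by auto
    then show ?thesis
      by (intro exI[of _ "\<lambda>i. u ((A ^^ i) v)"]) (auto simp: sum.reindex[OF True])
  next
    \<comment> \<open>Two coinciding iterates give the annihilating polynomial X^i - X^j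
      directly.\<close>
    case False
    then obtain i j where ij: "i \<le> n" "j \<le> n" "i \<noteq> j" "(A ^^ i) v = (A ^^ j) v"
      by (auto simp: inj_on_def)
    have "(\<Sum>k\<le>n. (if k = i then 1 else if k = j then -1 else 0) *\<^sub>C (A ^^ k) v) =
        (\<Sum>k\<in>{i, j}. (if k = i then 1 else if k = j then -1 else 0) *\<^sub>C (A ^^ k) v)"
      by (rule sum.mono_neutral_right) (use ij in auto)
    also have "\<dots> = 0" using ij by simp
    finally show ?thesis using ij
      by (intro exI[of _ "\<lambda>k. if k = i then 1 else if k = j then -1 else 0"]) auto
  qed
  then obtain c i where c: "i \<le> n" "c i \<noteq> 0" "(\<Sum>i\<le>n. c i *\<^sub>C (A ^^ i) v) = 0" by blast
  define p where "p = Poly (map c [0..<Suc n])"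
  have cp: "coeff p k = (if k \<le> n then c k else 0)" for k
    by (simp add: p_def nth_default_def less_Suc_eq_le del: upt_Suc)
  have "degree p \<le> n" by (rule degree_le) (simp add: cp)
  then have "poly_apply p A v = 0" using c(3) by (simp add: poly_apply_superset cp)
  moreover have "p \<noteq> 0" using c(1,2) cp[of i] by auto
  ultimately show ?thesis by blast
qed

text \<open>Each v is annihilated by a nonzero polynomial in A. Splitting off a root l replaces v by
  (A - l) v and lowers the degree, so it is enough that (A - l) v in the span forces v into the
  span.\<close>

lemma span_gen_eigenspaces:
  fixes A :: "'g::complex_vector \<Rightarrow> 'g"
  assumes fd: "finite_dimensional (UNIV :: 'g set)" and A: "linear_on UNIV A"
  shows "cv.span (\<Union>l. gen_eigenspace A l) = UNIV"
proof -
  let ?E = "cv.span (\<Union>l. gen_eigenspace A l)"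
  note lin = linear_on_shift[OF A]
  have inE: "v \<in> ?E" if "v \<in> gen_eigenspace A l" for v l
    using that by (intro cv.span_base) auto
  have lift: "v \<in> ?E" if "shift A l v \<in> ?E" for l v
  proof -
    \<comment> \<open>Modulo the l-component A - l is surjective on the span, being invertible on
      every other generalised eigenspace.\<close>
    have "\<exists>u\<in>?E. shift A l u - w \<in> gen_eigenspace A l" if "w \<in> ?E" for w
      using that
    proof (induction rule: cv.span_induct_alt)
      case base
      then show ?case
        by (intro bexI[of _ 0]) (simp_all add: linear_on_zero[OF lin] cv.span_zero
            cv.subspace_0[OF subspace_gen_eigenspace[OF A]])
    next
      case (step c x y)
      obtain u where u: "u \<in> ?E" "shift A l u - y \<in> gen_eigenspace A l" using step by auto
      obtain m where m: "x \<in> gen_eigenspace A m" using step by auto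
      obtain u' where u': "u' \<in> ?E" "shift A l u' - x \<in> gen_eigenspace A l"
      proof (cases "m = l")
        case True
        then have "shift A l 0 - x \<in> gen_eigenspace A l"
          using m cv.subspace_neg[OF subspace_gen_eigenspace[OF A]] by (simp add: linear_on_zero[OF lin])
        then show ?thesis using that[of 0] cv.span_zero by blast
      next
        case False
        then obtain u' where "u' \<in> gen_eigenspace A m" "shift A l u' = x"
          using shift_solve[OF A, of l m _ x] m by (auto simp: gen_eigenspace_def)
        then show ?thesis using that[of u'] inE cv.subspace_0[OF subspace_gen_eigenspace[OF A]] by simp
      qed
      have "shift A l (c *\<^sub>C u' + u) - (c *\<^sub>C x + y) = c *\<^sub>C (shift A l u' - x) + (shift A l u - y)"
        by (simp add: linear_on_add[OF lin] linear_on_scale[OF lin] cv.scale_right_diff_distrib)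
      also have "\<dots> \<in> gen_eigenspace A l"
        using u u' subspace_gen_eigenspace[OF A] by (intro cv.subspace_add cv.subspace_scale) auto
      finally show ?case
        using u u' by (intro bexI[of _ "c *\<^sub>C u' + u"]) (auto intro: cv.span_add cv.span_scale)
    qed
    from this[OF that] obtain u where u: "u \<in> ?E" "shift A l u - shift A l v \<in> gen_eigenspace A l" by blast
    then have "shift A l (u - v) \<in> gen_eigenspace A l" by (simp add: linear_on_diff[OF lin])
    then have "u - v \<in> ?E" using shift_gen_eigenspace[OF A] inE by blast
    then have "u - (u - v) \<in> ?E" using u(1) cv.span_diff by blast
    then show ?thesis by simp
  qed
  have "v \<in> ?E" if "p \<noteq> 0" "poly_apply p A v = 0" for p v
    using that
  proof (induction "degree p" arbitrary: p v)
    case 0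
    then have "coeff p 0 \<noteq> 0" using 0 leading_coeff_neq_0[of p] by simp
    then show ?case using 0 by (simp add: poly_apply_def cv.span_zero)
  next
    case (Suc n)
    then have "\<not> constant (poly p)" by (simp add: constant_degree)
    then obtain l where "poly p l = 0" using fundamental_theorem_of_algebra by blast
    then obtain q where q: "p = [:- l, 1:] * q" by (auto simp: poly_eq_0_iff_dvd elim: dvdE)
    then have "q \<noteq> 0" using Suc by auto
    then have "degree p = 1 + degree q" unfolding q by (subst degree_mult_eq) auto
    then have "degree q = n" using Suc.hyps(2) by simp
    moreover have "poly_apply q A (shift A l v) = 0"
      using Suc q poly_apply_linear_factor[OF A] by simp
    ultimately show ?case using lift Suc.hyps(1)[of q] \<open>q \<noteq> 0\<close> by blast
  qed
  then show ?thesis using ex_annihilating_poly[OF fd, of A] by blast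
qed

text \<open>A maximal independent set of generalised eigenvectors is a basis because they span. The
  last clause says that coordinates respect the blocks, so that multiplying each block by a scalar
  is well behaved on generalised eigenvectors.\<close>

lemma ex_gen_eigenbasis:
  fixes A :: "'g::complex_vector \<Rightarrow> 'g"
  assumes fd: "finite_dimensional (UNIV :: 'g set)" and A: "linear_on UNIV A"
  shows "\<exists>B ev. cv.independent B \<and> cv.span B = UNIV \<and> finite B \<and>
    (\<forall>b\<in>B. b \<in> gen_eigenspace A (ev b)) \<and>
    (\<forall>l. \<forall>v\<in>gen_eigenspace A l. \<forall>b\<in>B. cv.representation B v b \<noteq> 0 \<longrightarrow> ev b = l)"
proof -
  obtain B where B: "B \<subseteq> (\<Union>l. gen_eigenspace A l)" "cv.independent B"
    "(\<Union>l. gen_eigenspace A l) \<subseteq> cv.span B"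
    using cv.maximal_independent_subset by blast
  have sp: "cv.span B = UNIV"
    using span_gen_eigenspaces[OF fd A] cv.span_minimal[OF B(3)] by auto
  note fB = finite_dimensional_basis[OF fd B(2)]
  have "\<forall>b\<in>B. \<exists>l. b \<in> gen_eigenspace A l" using B(1) by auto
  then obtain ev where ev: "\<forall>b\<in>B. b \<in> gen_eigenspace A (ev b)" by metis
  have "ev b = l" if v: "v \<in> gen_eigenspace A l" and b: "b \<in> B" "cv.representation B v b \<noteq> 0" for l v b
  proof (rule ccontr)
    assume ne: "ev b \<noteq> l"
    let ?r = "cv.representation B v"
    let ?S = "insert l (ev ` B)"
    \<comment> \<open>x m is the part of v in the block of m. Subtracting v from the part at l gives
      components that sum to zero, so each of them vanishes.\<close>
    define x where "x m = (\<Sum>b\<in>{b\<in>B. ev b = m}. ?r b *\<^sub>C b)" for m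
    define w where "w m = x m - (if m = l then v else 0)" for m
    have x: "x m \<in> gen_eigenspace A m" for m
      unfolding x_def using ev
      by (auto intro!: cv.subspace_sum cv.subspace_scale subspace_gen_eigenspace[OF A])
    have "w m \<in> gen_eigenspace A m" for m
      unfolding w_def using x v cv.subspace_diff[OF subspace_gen_eigenspace[OF A]] by auto
    moreover have "(\<Sum>m\<in>?S. w m) = 0"
    proof -
      have "(\<Sum>m\<in>?S. x m) = (\<Sum>b\<in>B. ?r b *\<^sub>C b)"
        unfolding x_def by (rule sum.group) (use fB in auto)
      then show ?thesis using fB
        by (simp add: w_def sum_subtractf sum_representation_UNIV[OF B(2) sp fB] sum.delta del: sum.insert_if)
    qed
    ultimately have "w (ev b) = 0"
      using gen_eigenspaces_independent[OF A, of ?S w "ev b"] fB b by blast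
    then have "x (ev b) = 0" using ne by (simp add: w_def)
    then have "?r b = 0"
      unfolding x_def using cv.independentD[OF B(2), of "{c\<in>B. ev c = ev b}" ?r b] fB b by auto
    then show False using b by simp
  qed
  then show ?thesis using B(2) sp fB ev by blast
qed

text \<open>In a basis adapted to the chain of kernels of the powers of M, each new basis vector is
  sent into the span of the earlier ones, so every diagonal coefficient is zero.\<close>

lemma nilpotent_trace:
  fixes M :: "'g::complex_vector \<Rightarrow> 'g"
  assumes fd: "finite_dimensional (UNIV :: 'g set)" and M: "linear_on UNIV M"
    and nil: "\<And>v. \<exists>n. (M ^^ n) v = 0"
  shows "endo_trace M = 0"
proof -
  note lin = linear_on_funpow[OF M]
  have "\<exists>B. cv.independent B \<and> B \<subseteq> {v. (M ^^ k) v = 0} \<and> {v. (M ^^ k) v = 0} \<subseteq> cv.span B \<and>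
      (\<forall>b\<in>B. cv.representation B (M b) b = 0)" for k
  proof (induction k)
    case 0
    show ?case by (intro exI[of _ "{}"]) (simp add: cv.independent_empty)
  next
    case (Suc k)
    then obtain B where B: "cv.independent B" "B \<subseteq> {v. (M ^^ k) v = 0}"
      "{v. (M ^^ k) v = 0} \<subseteq> cv.span B" "\<forall>b\<in>B. cv.representation B (M b) b = 0" by blast
    let ?K = "{v. (M ^^ Suc k) v = 0}"
    have "B \<subseteq> ?K" using B(2) linear_on_zero[OF M] by auto
    then obtain C where C: "B \<subseteq> C" "C \<subseteq> ?K" "cv.independent C" "?K \<subseteq> cv.span C"
      using cv.maximal_independent_subset_extend[OF _ B(1)] by metis
    have "cv.representation C (M b) b = 0" if b: "b \<in> C" for b
    proof -
      have "(M ^^ k) (M b) = 0" using C(2) b by (auto simp: funpow_swap1)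
      then have Mb: "M b \<in> cv.span B" using B(3) by auto
      then have r: "cv.representation C (M b) = cv.representation B (M b)"
        using cv.representation_extend[OF C(3) _ C(1)] by simp
      show ?thesis
      proof (cases "b \<in> B")
        case False
        then show ?thesis unfolding r using cv.representation_ne_zero by blast
      qed (simp add: r B(4))
    qed
    then show ?case using C by blast
  qed
  moreover obtain k where "{v. (M ^^ k) v = 0} = UNIV"
  proof -
    obtain C :: "'g set" where C: "finite C" "cv.span C = UNIV"
      using fd by (auto simp: finite_dimensional_def)
    obtain n where n: "\<And>v. (M ^^ n v) v = 0" using nil by metis
    let ?k = "Max (n ` C)"
    have "cv.subspace {v. (M ^^ ?k) v = 0}"
      by (rule cv.subspaceI) (simp_all add: linear_on_zero[OF lin] linear_on_add[OF lin] linear_on_scale[OF lin])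
    moreover have "C \<subseteq> {v. (M ^^ ?k) v = 0}"
      using funpow_zero_mono[OF M n] C(1) by auto
    ultimately have "v \<in> {v. (M ^^ ?k) v = 0}" for v by (rule mem_subspace_if_spanning[OF C(2)])
    then show ?thesis using that[of ?k] by blast
  qed
  ultimately obtain B where B: "cv.independent B" "cv.span B = UNIV"
      "\<forall>b\<in>B. cv.representation B (M b) b = 0" by (metis top.extremum_uniqueI)
  show ?thesis unfolding endo_trace_basis[OF fd B(1,2) M] using B(3) by simp
qed

text \<open>If \<open>S\<close> is the semisimple part of \<open>A\<close>, then \<open>D (A - S)\<close> is nilpotent, so the trace of \<open>D A\<close> is that of
  \<open>D S\<close>, which is the sum of the squared absolute values of the eigenvalues.\<close>

lemma ex_eigenvalue_function:
  fixes A :: "'g::complex_vector \<Rightarrow> 'g"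
  assumes fd: "finite_dimensional (UNIV :: 'g set)" and A: "linear_on UNIV A"
  shows "\<exists>D. linear_on UNIV D \<and> (\<forall>l. \<forall>v\<in>gen_eigenspace A l. D v = cnj l *\<^sub>C v) \<and>
    (endo_trace (\<lambda>x. D (A x)) = 0 \<longrightarrow> gen_eigenspace A 0 = UNIV)"
proof -
  obtain B ev where B: "cv.independent B" "cv.span B = UNIV" "finite B"
    and ev: "\<forall>b\<in>B. b \<in> gen_eigenspace A (ev b)"
    and rep: "\<And>l v b. v \<in> gen_eigenspace A l \<Longrightarrow> b \<in> B \<Longrightarrow> cv.representation B v b \<noteq> 0 \<Longrightarrow> ev b = l"
    using ex_gen_eigenbasis[OF fd A] by metis
  \<comment> \<open>D h multiplies the block of l by h l. The identity function gives the semisimple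
    part S of A, and \<open>cnj\<close> gives the required map.\<close>
  define D where "D h v = (\<Sum>b\<in>B. (h (ev b) * cv.representation B v b) *\<^sub>C b)" for h :: "complex \<Rightarrow> complex" and v
  have Dlin: "linear_on UNIV (D h)" for h
    by (rule linear_onI)
      (simp_all add: D_def cv.representation_add cv.representation_scale B cv.scale_left_distrib
        distrib_left sum.distrib cv.scale_sum_right mult.left_commute)
  have D: "D h v = h l *\<^sub>C v" if "v \<in> gen_eigenspace A l" for h l v
  proof -
    have "D h v = (\<Sum>b\<in>B. (h l * cv.representation B v b) *\<^sub>C b)"
      unfolding D_def by (rule sum.cong[OF refl]) (use rep[OF that] in fastforce)
    also have "\<dots> = h l *\<^sub>C v"
      by (simp add: cv.scale_sum_right[symmetric] sum_representation_UNIV[OF B] flip: cv.scale_scale)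
    finally show ?thesis .
  qed
  let ?M = "\<lambda>x. D cnj (A x - D (\<lambda>z. z) x)"
  have "endo_trace (\<lambda>x. D cnj (D (\<lambda>z. z) x)) = (\<Sum>b\<in>B. cv.representation B (D cnj (D (\<lambda>z. z) b)) b)"
    by (rule endo_trace_basis[OF fd B(1,2)]) (use Dlin[of cnj] Dlin[of "\<lambda>z. z"] in \<open>simp add: linear_on_def\<close>)
  also have "\<dots> = (\<Sum>b\<in>B. ev b * cnj (ev b))"
  proof (rule sum.cong[OF refl])
    fix b assume b: "b \<in> B"
    then have "D cnj (D (\<lambda>z. z) b) = (ev b * cnj (ev b)) *\<^sub>C b"
      using D[of b "ev b"] ev linear_on_scale[OF Dlin, of b cnj] by simp
    then show "cv.representation B (D cnj (D (\<lambda>z. z) b)) b = ev b * cnj (ev b)"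
      using b B by (simp add: cv.representation_scale cv.representation_basis)
  qed
  finally have tr1: "endo_trace (\<lambda>x. D cnj (D (\<lambda>z. z) x)) = (\<Sum>b\<in>B. of_real ((cmod (ev b))\<^sup>2))"
    by (simp only: complex_norm_square)
  have Mlin: "linear_on UNIV ?M"
    using A Dlin[of "\<lambda>z. z"] Dlin[of cnj]
    by (auto simp: linear_on_def add_diff_add simp flip: cv.scale_right_diff_distrib)
  have "v \<in> gen_eigenspace ?M 0" for v
  proof -
    have "v \<in> gen_eigenspace ?M 0" if v: "v \<in> gen_eigenspace A l" for l v
    proof -
      \<comment> \<open>On the block of l both S and \<open>D cnj\<close> are scalars, so M is
        \<open>cnj l\<close> times the locally nilpotent A - l.\<close>
      have Mv: "?M u = cnj l *\<^sub>C shift A l u" if u: "u \<in> gen_eigenspace A l" for u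
        using D[OF u, of "\<lambda>z. z"] D[of "shift A l u" l cnj] shift_gen_eigenspace[OF A] u
        by (simp add: shift_def)
      have "(?M ^^ n) v = cnj l ^ n *\<^sub>C (shift A l ^^ n) v \<and> (shift A l ^^ n) v \<in> gen_eigenspace A l" for n
      proof (induction n)
        case (Suc n)
        then show ?case
          using shift_gen_eigenspace[OF A] Mv[of "(shift A l ^^ n) v"] linear_on_scale[OF Mlin, of "(shift A l ^^ n) v" "cnj l ^ n"]
          by (auto simp: mult.commute)
      qed (use v in simp)
      moreover obtain n where "(shift A l ^^ n) v = 0" using v by (auto simp: gen_eigenspace_def)
      ultimately have "(?M ^^ n) v = 0" by simp
      moreover have "shift ?M 0 = ?M" by (simp add: shift_def fun_eq_iff)
      ultimately show ?thesis by (intro gen_eigenspaceI[of n]) simp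
    qed
    then have "(\<Union>l. gen_eigenspace A l) \<subseteq> gen_eigenspace ?M 0" by auto
    then show ?thesis
      by (rule mem_subspace_if_spanning[OF span_gen_eigenspaces[OF fd A] subspace_gen_eigenspace[OF Mlin]])
  qed
  moreover have "shift ?M 0 = ?M" by (simp add: shift_def fun_eq_iff)
  ultimately have "\<exists>n. (?M ^^ n) v = 0" for v by (auto simp: gen_eigenspace_def)
  then have tr2: "endo_trace ?M = 0" by (rule nilpotent_trace[OF fd Mlin])
  have "endo_trace (\<lambda>x. D cnj (A x)) = endo_trace (\<lambda>x. ?M x + D cnj (D (\<lambda>z. z) x))"
    by (rule arg_cong[of _ _ endo_trace]) (simp add: fun_eq_iff linear_on_add[OF Dlin, symmetric])
  also have "\<dots> = of_real (\<Sum>b\<in>B. (cmod (ev b))\<^sup>2)"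
    by (simp add: endo_trace_add tr1 tr2)
  finally have tr: "endo_trace (\<lambda>x. D cnj (A x)) = of_real (\<Sum>b\<in>B. (cmod (ev b))\<^sup>2)" .
  have "gen_eigenspace A 0 = UNIV" if "endo_trace (\<lambda>x. D cnj (A x)) = 0"
  proof -
    have "(\<Sum>b\<in>B. (cmod (ev b))\<^sup>2) = 0" using that tr by (simp only: of_real_eq_0_iff)
    then have "\<forall>b\<in>B. ev b = 0" using B(3) by (simp add: sum_nonneg_eq_0_iff)
    then have "B \<subseteq> gen_eigenspace A 0" using ev by auto
    then have "v \<in> gen_eigenspace A 0" for v
      by (rule mem_subspace_if_spanning[OF B(2) subspace_gen_eigenspace[OF A]])
    then show ?thesis by blast
  qed
  then show ?thesis using Dlin D by blast
qed


section \<open>The Killing form\<close>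

locale finite_dim_lie_algebra =
  fixes br :: "'g::complex_vector \<Rightarrow> 'g \<Rightarrow> 'g"
  assumes fd: "finite_dimensional (UNIV :: 'g set)" and lie: "lie_algebra UNIV br"
begin

abbreviation \<kappa> :: "'g \<Rightarrow> 'g \<Rightarrow> complex" where "\<kappa> \<equiv> killing_form br"

lemma br_linear_right: "linear_on UNIV (br x)" and br_linear_left: "linear_on UNIV (\<lambda>x. br x y)"
  using lie by (auto simp: lie_algebra_def bilinear_on_def)

lemmas br_simps = linear_on_add[OF br_linear_right] linear_on_scale[OF br_linear_right]
  linear_on_diff[OF br_linear_right] linear_on_neg[OF br_linear_right]
  linear_on_zero[OF br_linear_right]
  linear_on_add[OF br_linear_left] linear_on_scale[OF br_linear_left]
  linear_on_diff[OF br_linear_left] linear_on_neg[OF br_linear_left]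
  linear_on_zero[OF br_linear_left]

lemma br_self: "br x x = 0"
  using lie by (auto simp: lie_algebra_def)

lemma br_skew: "br y x = - br x y"
proof -
  have "0 = br (x + y) (x + y)" by (simp only: br_self)
  also have "\<dots> = (br x x + br y x) + (br x y + br y y)" by (simp add: br_simps)
  also have "\<dots> = br x y + br y x" by (simp add: br_self)
  finally show ?thesis using minus_unique[of "br x y" "br y x"] by simp
qed

lemma jacobi: "br x (br y z) + br y (br z x) + br z (br x y) = 0"
  using lie by (auto simp: lie_algebra_def)

lemma jacobi_left: "br (br x y) z = br x (br y z) - br y (br x z)"
proof -
  have "br z (br x y) = - br (br x y) z" "br y (br z x) = - br y (br x z)"
    using br_skew[of z "br x y"] br_skew[of z x] by (simp_all add: br_simps)
  then have "br x (br y z) - br y (br x z) - br (br x y) z = 0" using jacobi[of x y z] by simp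
  then show ?thesis by (simp add: algebra_simps)
qed

lemma jacobi_right: "br x (br y z) = br (br x y) z + br y (br x z)"
  by (simp add: jacobi_left)

lemma killing_bilinear: "bilinear_on UNIV UNIV \<kappa>"
  unfolding bilinear_on_def linear_on_def killing_form_def
  by (simp add: br_simps endo_trace_add endo_trace_scale scaleC_complex_def)

lemma killing_sym: "\<kappa> a b = \<kappa> b a"
  unfolding killing_form_def by (rule endo_trace_cyclic[OF fd br_linear_right br_linear_right])

text \<open>For a derivation D the commutator of D and ad y is ad (D y). Expanding ad [y, z] and
  rotating one trace leaves exactly this commutator composed with ad z. Inner D gives invariance of
  \<kappa>; another D gives Cartan's criterion.\<close>

lemma killing_derivation:
  assumes D: "linear_on UNIV D" and der: "\<And>x y. D (br x y) = br (D x) y + br x (D y)"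
  shows "endo_trace (\<lambda>x. D (br (br y z) x)) = \<kappa> (D y) z"
proof -
  have lin: "linear_on UNIV (\<lambda>x. D (br z x))"
    using D br_linear_right[of z] by (simp add: linear_on_def)
  have "endo_trace (\<lambda>x. D (br (br y z) x)) =
      endo_trace (\<lambda>x. D (br y (br z x))) - endo_trace (\<lambda>x. D (br z (br y x)))"
    by (simp add: endo_trace_diff[symmetric] jacobi_left linear_on_diff[OF D])
  also have "endo_trace (\<lambda>x. D (br z (br y x))) = endo_trace (\<lambda>x. br y (D (br z x)))"
    by (rule endo_trace_cyclic[OF fd lin br_linear_right])
  also have "endo_trace (\<lambda>x. D (br y (br z x))) - endo_trace (\<lambda>x. br y (D (br z x))) =
      endo_trace (\<lambda>x. br (D y) (br z x))"
    by (simp add: endo_trace_diff[symmetric] der)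
  finally show ?thesis by (simp add: killing_form_def)
qed

lemma killing_invariant: "\<kappa> (br a b) c = \<kappa> a (br b c)"
proof -
  have "endo_trace (\<lambda>x. br a (br (br b c) x)) = \<kappa> (br a b) c"
    by (rule killing_derivation[OF br_linear_right]) (rule jacobi_right)
  then show ?thesis by (simp add: killing_form_def)
qed

text \<open>ad (\<sigma> a) is the conjugate of ad a by \<sigma>, and the trace is invariant under
  conjugation.\<close>

lemma killing_automorphism:
  assumes "lie_automorphism br \<sigma>"
  shows "\<kappa> (\<sigma> a) (\<sigma> b) = \<kappa> a b"
proof -
  have \<sigma>: "linear_on UNIV \<sigma>" "bij \<sigma>" "\<And>x y. \<sigma> (br x y) = br (\<sigma> x) (\<sigma> y)"
    using assms by (auto simp: lie_automorphism_def)
  let ?i = "inv \<sigma>"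
  have i: "\<sigma> (?i x) = x" "?i (\<sigma> x) = x" for x
    using \<sigma>(2) by (simp_all add: bij_is_inj bij_is_surj surj_f_inv_f)
  have il: "linear_on UNIV ?i"
  proof (rule linear_onI)
    show "?i (x + y) = ?i x + ?i y" for x y
      using i linear_on_add[OF \<sigma>(1), of "?i x" "?i y"] by (metis UNIV_I)
    show "?i (c *\<^sub>C x) = c *\<^sub>C ?i x" for c x
      using i linear_on_scale[OF \<sigma>(1), of "?i x" c] by (metis UNIV_I)
  qed
  have "\<kappa> (\<sigma> a) (\<sigma> b) = endo_trace (\<lambda>x. \<sigma> (br a (br b (?i x))))"
    unfolding killing_form_def by (simp add: \<sigma>(3) i)
  also have "\<dots> = endo_trace (\<lambda>x. br a (br b (?i (\<sigma> x))))"
    by (rule endo_trace_cyclic[OF fd \<sigma>(1)])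
      (use il br_linear_right[of a] br_linear_right[of b] in \<open>simp add: linear_on_def\<close>)
  finally show ?thesis by (simp add: i killing_form_def)
qed

text \<open>ad x is a derivation, so its shift by l + m splits into a shift by l on u and a shift by
  m on v. After N >= n + k of them each term carries n shifts on u or k shifts on v.\<close>

lemma gen_eigenspace_ad:
  assumes "u \<in> gen_eigenspace (br x) l" "v \<in> gen_eigenspace (br x) m"
  shows "br u v \<in> gen_eigenspace (br x) (l + m)"
proof -
  let ?s = "shift (br x)"
  have step: "?s (l + m) (br u v) = br (?s l u) v + br u (?s m v)" for u v
    by (simp add: shift_def br_simps jacobi_right[of x u v] cv.scale_left_distrib algebra_simps)
  have "(?s (l + m) ^^ N) (br u v) = 0" if "(?s l ^^ n) u = 0" "(?s m ^^ k) v = 0" "n + k \<le> N" for n k N u v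
    using that
  proof (induction N arbitrary: n k u v)
    case 0
    then show ?case by (simp add: br_simps)
  next
    case (Suc N)
    show ?case
    proof (cases "n = 0 \<or> k = 0")
      case True
      then have "br u v = 0" using Suc.prems by (auto simp: br_simps)
      then show ?thesis
        using linear_on_zero[OF linear_on_funpow[OF linear_on_shift[OF br_linear_right]], of "Suc N"]
        by (simp del: funpow.simps)
    next
      case False
      then obtain n' k' where nk: "n = Suc n'" "k = Suc k'" by (metis not0_implies_Suc)
      have "(?s (l + m) ^^ N) (br (?s l u) v) = 0"
        by (rule Suc.IH[of n' _ k]) (use Suc.prems nk in \<open>simp_all add: funpow_swap1\<close>)
      moreover have "(?s (l + m) ^^ N) (br u (?s m v)) = 0"
        by (rule Suc.IH[of n _ k']) (use Suc.prems nk in \<open>simp_all add: funpow_swap1\<close>)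
      ultimately show ?thesis
        by (simp add: funpow_Suc_right step linear_on_add[OF linear_on_funpow[OF linear_on_shift[OF br_linear_right]]]
            del: funpow.simps)
    qed
  qed
  then show ?thesis using assms unfolding gen_eigenspace_def by blast
qed

text \<open>Complex conjugation of the eigenvalues of \<open>ad x\<close> defines a derivation \<open>D\<close>, because conjugation is
  additive; and the trace of \<open>D \<circ> ad [y, z]\<close> is \<open>\<kappa> (D y) z\<close>.\<close>

lemma ad_nilpotent:
  assumes \<kappa>0: "\<And>a b. \<kappa> a b = 0" and perfect: "cv.span {br a b | a b. True} = UNIV"
  shows "gen_eigenspace (br x) 0 = UNIV"
proof -
  obtain D where D: "linear_on UNIV D" "\<And>l v. v \<in> gen_eigenspace (br x) l \<Longrightarrow> D v = cnj l *\<^sub>C v"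
    and tr: "endo_trace (\<lambda>y. D (br x y)) = 0 \<Longrightarrow> gen_eigenspace (br x) 0 = UNIV"
    using ex_eigenvalue_function[OF fd br_linear_right, of x] by blast
  let ?E = "\<Union>l. gen_eigenspace (br x) l"
  have sp: "cv.span ?E = UNIV" by (rule span_gen_eigenspaces[OF fd br_linear_right])
  have der1: "D (br u v) = br (D u) v + br u (D v)" if uv: "u \<in> ?E" "v \<in> ?E" for u v
  proof -
    obtain l m where "u \<in> gen_eigenspace (br x) l" "v \<in> gen_eigenspace (br x) m" using uv by blast
    then show ?thesis
      using gen_eigenspace_ad[of u x l v m] by (simp add: D(2) br_simps cv.scale_left_distrib)
  qed
  have der2: "D (br u v) = br (D u) v + br u (D v)" if "u \<in> ?E" for u v
  proof -
    have "cv.subspace {v. D (br u v) = br (D u) v + br u (D v)}"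
      by (rule cv.subspaceI)
        (simp_all add: br_simps linear_on_add[OF D(1)] linear_on_scale[OF D(1)] linear_on_zero[OF D(1)]
          cv.scale_right_distrib)
    from mem_subspace_if_spanning[OF sp this, of v] show ?thesis using der1[OF that] by auto
  qed
  have der: "D (br u v) = br (D u) v + br u (D v)" for u v
  proof -
    have "cv.subspace {u. D (br u v) = br (D u) v + br u (D v)}"
      by (rule cv.subspaceI)
        (simp_all add: br_simps linear_on_add[OF D(1)] linear_on_scale[OF D(1)] linear_on_zero[OF D(1)]
          cv.scale_right_distrib)
    from mem_subspace_if_spanning[OF sp this, of u] show ?thesis using der2 by auto
  qed
  \<comment> \<open>x is a linear combination of brackets, so it suffices that the trace vanishes on
    brackets, where it is a value of \<kappa>.\<close>
  have "cv.subspace {a. endo_trace (\<lambda>y. D (br a y)) = 0}"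
    by (rule cv.subspaceI)
      (simp_all add: br_simps linear_on_add[OF D(1)] linear_on_scale[OF D(1)] linear_on_zero[OF D(1)]
        endo_trace_add endo_trace_scale, simp add: endo_trace_def cv.representation_zero)
  moreover have "{br a b | a b. True} \<subseteq> {a. endo_trace (\<lambda>y. D (br a y)) = 0}"
    using killing_derivation[OF D(1) der] \<kappa>0 by auto
  ultimately have "endo_trace (\<lambda>y. D (br x y)) = 0"
    using mem_subspace_if_spanning[OF perfect, of "{a. endo_trace (\<lambda>y. D (br a y)) = 0}" x] by simp
  then show ?thesis by (rule tr)
qed

text \<open>Engel's theorem for an invariant pair \<open>U \<subset> V\<close>, by induction on the dimension of \<open>K\<close>: apply the
  hypothesis to a maximal proper subalgebra \<open>K'\<close>, first inside \<open>K\<close> and then on the pair \<open>(U, V)\<close>.\<close>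

lemma engel:
  assumes nil: "\<And>x y. \<exists>n. (br x ^^ n) y = 0"
    and K: "lie_subalgebra UNIV br K"
    and U: "cv.subspace U" "\<And>x u. x \<in> K \<Longrightarrow> u \<in> U \<Longrightarrow> br x u \<in> U"
    and V: "cv.subspace V" "\<And>x v. x \<in> K \<Longrightarrow> v \<in> V \<Longrightarrow> br x v \<in> V"
    and UV: "U \<subset> V"
  shows "\<exists>v\<in>V - U. \<forall>x\<in>K. br x v \<in> U"
  using K U V UV
proof (induction "cv.dim K" arbitrary: K U V rule: less_induct)
  case less
  obtain B :: "'g set" where B: "cv.independent B" "cv.span B = UNIV" "finite B"
    using independent_extend_basis_empty span_extend_basis_empty finite_dimensional_basis[OF fd] by blast
  interpret fdv: finite_dimensional_vector_space scaleC B
    by unfold_locales (use B in auto)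
  have subK: "cv.subspace K" "\<And>x y. x \<in> K \<Longrightarrow> y \<in> K \<Longrightarrow> br x y \<in> K"
    using less.prems(1) by (auto simp: lie_subalgebra_def)
  show ?case
  proof (cases "K = {0}")
    case True
    then show ?thesis using less.prems(2,6) by (auto simp: br_simps cv.subspace_0)
  next
    case False
    define P where "P J \<longleftrightarrow> lie_subalgebra UNIV br J \<and> J \<subset> K" for J
    have P0: "P {0}" using False subK cv.subspace_0[OF subK(1)]
      by (auto simp: P_def lie_subalgebra_def br_simps)
    have bound: "\<forall>J. P J \<longrightarrow> cv.dim J < Suc (card B)"
      using fdv.dim_subset_UNIV by (simp add: less_Suc_eq_le fdv.dimension_def)
    obtain K' where K': "P K'" "\<And>J. P J \<Longrightarrow> cv.dim J \<le> cv.dim K'"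
      using ex_has_greatest_nat[of P "{0}" cv.dim "Suc (card B)"] P0 bound by blast
    have sK': "lie_subalgebra UNIV br K'" "cv.subspace K'" "K' \<subset> K"
      "\<And>x y. x \<in> K' \<Longrightarrow> y \<in> K' \<Longrightarrow> br x y \<in> K'"
      using K'(1) by (auto simp: P_def lie_subalgebra_def)
    have dK': "cv.dim K' < cv.dim K"
      using fdv.dim_psubset[of K' K] sK' subK(1) by (metis cv.span_eq_iff)
    \<comment> \<open>The induction hypothesis for K' acting on the pair (K', K): some x outside K'
      normalises K'.\<close>
    obtain x where x: "x \<in> K - K'" "\<forall>k\<in>K'. br k x \<in> K'"
      using less.hyps[OF dK' sK'(1,2,4) subK(1) _ sK'(3)] subK(2) sK'(3) by blast
    define J where "J = cv.span (insert x K')"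
    have J: "j \<in> J \<longleftrightarrow> (\<exists>c. j - c *\<^sub>C x \<in> K')" for j
      unfolding J_def cv.span_insert using sK'(2) cv.span_eq_iff by fastforce
    have "J \<subseteq> K" unfolding J_def by (rule cv.span_minimal) (use x sK'(3) subK(1) in auto)
    \<comment> \<open>K' together with x spans a subalgebra, so maximality of K' makes it all of
      K.\<close>
    have JK: "J = K"
    proof (rule ccontr)
      assume "J \<noteq> K"
      have "br u v \<in> J" if uv: "u \<in> J" "v \<in> J" for u v
      proof -
        obtain c d where c: "u - c *\<^sub>C x \<in> K'" and d: "v - d *\<^sub>C x \<in> K'" using uv J by blast
        have "br u v = br (u - c *\<^sub>C x) (v - d *\<^sub>C x) + d *\<^sub>C br (u - c *\<^sub>C x) x - c *\<^sub>C br (v - d *\<^sub>C x) x"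
          using br_skew[of v x] br_self by (simp add: br_simps cv.scale_right_diff_distrib)
        also have "\<dots> \<in> K'"
          using c d x(2) sK' by (intro cv.subspace_add cv.subspace_diff cv.subspace_scale) auto
        finally show ?thesis using J[of "br u v"] by (metis cv.scale_zero_left diff_zero)
      qed
      then have "P J" using \<open>J \<subseteq> K\<close> \<open>J \<noteq> K\<close> by (auto simp: P_def lie_subalgebra_def J_def)
      then have "cv.dim J \<le> cv.dim K'" by (rule K'(2))
      moreover have "K' \<subset> J"
      proof (rule psubsetI)
        show "K' \<subseteq> J" unfolding J_def by (meson cv.span_base insertI2 subsetI)
        have "x \<in> J" unfolding J_def by (rule cv.span_base) simp
        then show "K' \<noteq> J" using x by blast
      qed
      moreover have "cv.span K' = K'" "cv.span J = J" using sK'(2) by (simp_all add: J_def cv.span_span)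
      ultimately show False using fdv.dim_psubset[of K' J] by (metis not_le)
    qed
    \<comment> \<open>V1 is stable under x because x normalises K', and the second use of the
      induction hypothesis provides a vector of V1 outside U.\<close>
    define V1 where "V1 = {v \<in> V. \<forall>k\<in>K'. br k v \<in> U}"
    obtain v where v: "v \<in> V - U" "\<forall>k\<in>K'. br k v \<in> U"
      using less.hyps[OF dK' sK'(1) less.prems(2) _ less.prems(4) _ less.prems(6)]
        less.prems(3,5) sK'(3) by blast
    have xV1: "br x w \<in> V1" if w: "w \<in> V1" for w
    proof -
      have "br k (br x w) \<in> U" if k: "k \<in> K'" for k
        unfolding jacobi_right[of k x w] using w k x less.prems(2,3) sK'(3)
        by (intro cv.subspace_add) (auto simp: V1_def)
      then show ?thesis using w x less.prems(5) by (auto simp: V1_def)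
    qed
    have it: "(br x ^^ n) v \<in> V1" for n
      using v xV1 by (induction n) (auto simp: V1_def)
    obtain n where "(br x ^^ n) v = 0" using nil by blast
    then have ex: "\<exists>n. (br x ^^ n) v \<in> U" using cv.subspace_0[OF less.prems(2)] by metis
    \<comment> \<open>By nilpotency the iterates of v under x reach 0, hence U; the last one before
      that is the vector sought.\<close>
    define N where "N = (LEAST n. (br x ^^ n) v \<in> U)"
    have NU: "(br x ^^ N) v \<in> U" unfolding N_def by (rule LeastI_ex[OF ex])
    then obtain N' where N': "N = Suc N'" using v by (cases N) auto
    let ?w = "(br x ^^ N') v"
    have "?w \<notin> U" using not_less_Least[of N' "\<lambda>n. (br x ^^ n) v \<in> U"] N' N_def by simp
    moreover have "br k ?w \<in> U" if "k \<in> K" for k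
    proof -
      have "k \<in> J" using that JK by simp
      then obtain c where c: "k - c *\<^sub>C x \<in> K'" unfolding J[of k] by blast
      have "br k ?w = br (k - c *\<^sub>C x) ?w + c *\<^sub>C br x ?w" by (simp add: br_simps)
      also have "\<dots> \<in> U" using it[of N'] c NU N' less.prems(2)
        by (intro cv.subspace_add cv.subspace_scale) (auto simp: V1_def)
      finally show ?thesis .
    qed
    ultimately show ?thesis using it[of N'] by (auto simp: V1_def)
  qed
qed

end

section \<open>Simple Lie algebras and Cartan's criterion\<close>

locale simple_lie = finite_dim_lie_algebra br for br :: "'g::complex_vector \<Rightarrow> 'g \<Rightarrow> 'g" +
  assumes simple: "simple_lie_algebra UNIV br"
begin

lemma ideal_cases: "lie_ideal UNIV br I \<Longrightarrow> I = {0} \<or> I = UNIV"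
  using simple by (auto simp: simple_lie_algebra_def)

lemma not_abelian: "\<exists>x y. br x y \<noteq> 0"
  using simple by (auto simp: simple_lie_algebra_def)

lemma centre_trivial:
  assumes "\<And>x. br x z = 0"
  shows "z = 0"
proof -
  let ?Z = "{z. \<forall>x. br x z = 0}"
  have "lie_ideal UNIV br ?Z"
    by (auto simp: lie_ideal_def cv.subspace_def br_simps)
  then have "?Z = {0} \<or> ?Z = UNIV" by (rule ideal_cases)
  then show ?thesis using not_abelian assms by blast
qed

lemma killing_nondegenerate:
  assumes "\<And>y. \<kappa> x y = 0"
  shows "x = 0"
proof (rule ccontr)
  assume "x \<noteq> 0"
  let ?R = "{x. \<forall>y. \<kappa> x y = 0}"
  have lin: "linear_on UNIV (\<lambda>x. \<kappa> x y)" for y using bilinear_onD(2)[OF killing_bilinear] by simp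
  have "lie_ideal UNIV br ?R"
    unfolding lie_ideal_def
  proof (intro conjI ballI)
    show "cv.subspace ?R"
      by (rule cv.subspaceI) (simp_all add: linear_on_add[OF lin] linear_on_scale[OF lin] linear_on_zero[OF lin])
    show "br a b \<in> ?R" if "b \<in> ?R" for a b
      using that killing_invariant[of b a] br_skew[of b a] by (simp add: linear_on_neg[OF lin])
  qed simp
  then have "?R = UNIV" using ideal_cases[of ?R] assms \<open>x \<noteq> 0\<close> by blast
  then have \<kappa>0: "\<kappa> a b = 0" for a b by blast
  have "lie_ideal UNIV br (cv.span {br a b | a b. True})"
    unfolding lie_ideal_def by (auto intro: cv.span_base)
  then have "cv.span {br a b | a b. True} = UNIV"
    using ideal_cases[of "cv.span {br a b | a b. True}"] not_abelian cv.span_base[of _ "{br a b | a b. True}"] by blast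
  then have nil: "gen_eigenspace (br x) 0 = UNIV" for x by (rule ad_nilpotent[OF \<kappa>0])
  have "\<exists>n. (br x ^^ n) y = 0" for x y
  proof -
    have "y \<in> gen_eigenspace (br x) 0" by (simp add: nil)
    moreover have "shift (br x) 0 = br x" by (simp add: shift_def fun_eq_iff)
    ultimately show ?thesis by (simp add: gen_eigenspace_def)
  qed
  \<comment> \<open>Engel for the whole algebra acting on itself, with U = {0}, yields a nonzero
    central vector.\<close>
  then have "\<exists>v\<in>UNIV - {0}. \<forall>x\<in>UNIV. br x v \<in> {0}"
    by (rule engel) (use \<open>x \<noteq> 0\<close> in \<open>auto simp: lie_subalgebra_def br_simps\<close>)
  then show False using centre_trivial by blast
qed

end

section \<open>Lagrangian complements and cobrackets\<close>

text \<open>The description of \<open>tensor_lift\<close> sees \<beta> only through its values on S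
  and T, so the two descriptions coincide.\<close>

lemma tensor_lift_cong:
  assumes "\<And>a b. a \<in> S \<Longrightarrow> b \<in> T \<Longrightarrow> \<beta> a b = \<gamma> a b"
  shows "tensor_lift S T \<beta> t = tensor_lift S T \<gamma> t"
proof -
  have "(\<Sum>(a, b)\<leftarrow>xs. \<beta> a b) = (\<Sum>(a, b)\<leftarrow>xs. \<gamma> a b)" if "set xs \<subseteq> S \<times> T" for xs
    using that assms by (induction xs) auto
  then show ?thesis unfolding tensor_lift_def by (metis (no_types, lifting))
qed

text \<open>Commensurability supplies the finite set in the ambient space, whereas finite-rank
  arguments want it inside W. The vectors are exchanged one at a time.\<close>

lemma finite_complement_inside:
  fixes W :: "'a::complex_vector set"
  assumes "finite B" "cv.subspace W" "U \<subseteq> W" "W \<subseteq> cv.span (U \<union> B)"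
  shows "\<exists>B'. finite B' \<and> B' \<subseteq> W \<and> W \<subseteq> cv.span (U \<union> B')"
  using assms
proof (induction B arbitrary: U rule: finite_induct)
  case empty
  then show ?case by (intro exI[of _ "{}"]) simp
next
  case (insert b B)
  show ?case
  proof (cases "W \<subseteq> cv.span (U \<union> B)")
    case True
    then show ?thesis using insert by blast
  next
    case False
    then obtain w where w: "w \<in> W" "w \<notin> cv.span (U \<union> B)" by blast
    have "w \<in> cv.span (insert b (U \<union> B))" using w(1) insert.prems(3) by auto
    then have "b \<in> cv.span (insert w (U \<union> B))" using w(2) by (rule cv.in_span_insert)
    then have "insert b (U \<union> B) \<subseteq> cv.span (insert w U \<union> B)"
      using cv.span_superset[of "insert w U \<union> B"] by auto
    then have "cv.span (U \<union> insert b B) \<subseteq> cv.span (insert w U \<union> B)"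
      using cv.span_minimal[of "insert b (U \<union> B)" "cv.span (insert w U \<union> B)"] by auto
    then obtain B' where B': "finite B'" "B' \<subseteq> W" "W \<subseteq> cv.span (insert w U \<union> B')"
      using insert.IH[of "insert w U"] insert.prems w(1) by auto
    then show ?thesis using w(1) by (intro exI[of _ "insert w B'"]) auto
  qed
qed

text \<open>The isotropic subalgebra of the double is \<open>\<iota> ` L\<close>; tensors are taken over \<open>L\<close> itself.\<close>

locale double =
  fixes R :: "'r::complex_vector set" and br :: "'r \<Rightarrow> 'r \<Rightarrow> 'r" and F :: "'r \<Rightarrow> 'r \<Rightarrow> complex"
    and L :: "'l::complex_vector set" and brL :: "'l \<Rightarrow> 'l \<Rightarrow> 'l" and \<iota> :: "'l \<Rightarrow> 'r"
  assumes lieR: "lie_algebra R br"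
    and F_bilinear: "bilinear_on R R F"
    and F_sym: "x \<in> R \<Longrightarrow> y \<in> R \<Longrightarrow> F x y = F y x"
    and F_inv: "x \<in> R \<Longrightarrow> y \<in> R \<Longrightarrow> z \<in> R \<Longrightarrow> F (br x y) z = F x (br y z)"
    and F_nondeg: "x \<in> R \<Longrightarrow> (\<And>y. y \<in> R \<Longrightarrow> F x y = 0) \<Longrightarrow> x = 0"
    and lieL: "lie_algebra L brL"
    and \<iota>_linear: "linear_on L \<iota>"
    and \<iota>_R: "a \<in> L \<Longrightarrow> \<iota> a \<in> R"
    and \<iota>_br: "a \<in> L \<Longrightarrow> b \<in> L \<Longrightarrow> \<iota> (brL a b) = br (\<iota> a) (\<iota> b)"
    and \<iota>_iso: "a \<in> L \<Longrightarrow> b \<in> L \<Longrightarrow> F (\<iota> a) (\<iota> b) = 0"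
begin

lemma R_subspace: "cv.subspace R" and br_R: "x \<in> R \<Longrightarrow> y \<in> R \<Longrightarrow> br x y \<in> R"
  using lieR by (auto simp: lie_algebra_def)

lemma L_subspace: "cv.subspace L" and brL_L: "a \<in> L \<Longrightarrow> b \<in> L \<Longrightarrow> brL a b \<in> L"
  using lieL by (auto simp: lie_algebra_def)

lemmas R_closed = cv.subspace_add[OF R_subspace] cv.subspace_scale[OF R_subspace]
  cv.subspace_neg[OF R_subspace] cv.subspace_diff[OF R_subspace] cv.subspace_0[OF R_subspace] br_R \<iota>_R
lemmas L_closed = cv.subspace_add[OF L_subspace] cv.subspace_scale[OF L_subspace]
  cv.subspace_neg[OF L_subspace] cv.subspace_diff[OF L_subspace] cv.subspace_0[OF L_subspace] brL_L

lemma br_linear: "x \<in> R \<Longrightarrow> linear_on R (br x)" "x \<in> R \<Longrightarrow> linear_on R (\<lambda>y. br y x)"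
  using lieR by (auto simp: lie_algebra_def bilinear_on_def)

lemma brL_linear: "x \<in> L \<Longrightarrow> linear_on L (brL x)" "x \<in> L \<Longrightarrow> linear_on L (\<lambda>y. brL y x)"
  using lieL by (auto simp: lie_algebra_def bilinear_on_def)

lemma F_linear: "x \<in> R \<Longrightarrow> linear_on R (F x)" "x \<in> R \<Longrightarrow> linear_on R (\<lambda>y. F y x)"
  using F_bilinear by (auto simp: bilinear_on_def)

lemmas br_simps = linear_on_add[OF br_linear(1)] linear_on_add[OF br_linear(2)]
  linear_on_diff[OF br_linear(1) R_subspace] linear_on_diff[OF br_linear(2) R_subspace]
  linear_on_neg[OF br_linear(1) R_subspace] linear_on_neg[OF br_linear(2) R_subspace]
  linear_on_zero[OF br_linear(1) R_subspace] linear_on_zero[OF br_linear(2) R_subspace]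
  linear_on_scale[OF br_linear(1)] linear_on_scale[OF br_linear(2)]

lemmas F_simps = linear_on_add[OF F_linear(1)] linear_on_add[OF F_linear(2)]
  linear_on_diff[OF F_linear(1) R_subspace] linear_on_diff[OF F_linear(2) R_subspace]
  linear_on_neg[OF F_linear(1) R_subspace] linear_on_neg[OF F_linear(2) R_subspace]
  linear_on_zero[OF F_linear(1) R_subspace] linear_on_zero[OF F_linear(2) R_subspace]
  linear_on_scale[OF F_linear(1)] linear_on_scale[OF F_linear(2)]

lemmas \<iota>_simps = linear_on_add[OF \<iota>_linear] linear_on_diff[OF \<iota>_linear L_subspace]
  linear_on_neg[OF \<iota>_linear L_subspace] linear_on_zero[OF \<iota>_linear L_subspace]
  linear_on_scale[OF \<iota>_linear]

lemma br_skew: "x \<in> R \<Longrightarrow> y \<in> R \<Longrightarrow> br y x = - br x y"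
proof -
  assume xy: "x \<in> R" "y \<in> R"
  have self: "br x x = 0" if "x \<in> R" for x using lieR that by (auto simp: lie_algebra_def)
  have "0 = br (x + y) (x + y)" using xy by (simp only: self R_closed)
  also have "\<dots> = (br x x + br y x) + (br x y + br y y)" using xy by (simp add: br_simps R_closed)
  also have "\<dots> = br x y + br y x" using xy by (simp add: self)
  finally show ?thesis using minus_unique[of "br x y" "br y x"] by simp
qed

lemma jacobi: "x \<in> R \<Longrightarrow> y \<in> R \<Longrightarrow> z \<in> R \<Longrightarrow> br x (br y z) + br y (br z x) + br z (br x y) = 0"
  using lieR by (auto simp: lie_algebra_def)

abbreviation P :: "'r \<Rightarrow> 'l \<Rightarrow> complex" where "P w a \<equiv> F w (\<iota> a)"

section \<open>Pairings and contractions of tensors over L\<close>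

definition pair :: "'r \<Rightarrow> 'r \<Rightarrow> ('l, 'l) tensor \<Rightarrow> complex" where
  "pair x y = tensor_lift L L (\<lambda>a b. P x a * P y b)"

definition contract :: "'r \<Rightarrow> ('l, 'l) tensor \<Rightarrow> 'l" where
  "contract x = tensor_lift L L (\<lambda>a b. P x a *\<^sub>C b)"

definition graph :: "('l, 'l) tensor \<Rightarrow> 'r set \<Rightarrow> 'r set" where
  "graph t W = {w + \<iota> (contract w t) | w. w \<in> W}"

lemma P_linear: "x \<in> R \<Longrightarrow> linear_on L (F x \<circ> \<iota>)"
  by (auto simp: linear_on_def F_simps \<iota>_simps R_closed)

lemmas P_simps = F_simps \<iota>_simps R_closed L_closed

lemma pair_bilinear:
  assumes "x \<in> R" "y \<in> R" shows "bilinear_on L L (\<lambda>a b. P x a * P y b)"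
  using assms by (auto simp: bilinear_on_def linear_on_def P_simps scaleC_complex_def algebra_simps)

lemma contract_bilinear:
  assumes "x \<in> R" shows "bilinear_on L L (\<lambda>a b. P x a *\<^sub>C b)"
  using assms by (auto simp: bilinear_on_def linear_on_def P_simps scaleC_complex_def
      cv.scale_right_distrib cv.scale_left_distrib mult.commute)

lemma pair_prod: "x \<in> R \<Longrightarrow> y \<in> R \<Longrightarrow> a \<in> L \<Longrightarrow> b \<in> L \<Longrightarrow> pair x y (a \<otimes>\<^sub>C b) = P x a * P y b"
  unfolding pair_def by (rule tensor_lift_prod[OF L_subspace L_subspace pair_bilinear])

lemma pair_linear: "x \<in> R \<Longrightarrow> y \<in> R \<Longrightarrow> linear_on (tensor_space L L) (pair x y)"
  unfolding pair_def by (rule tensor_lift_linear[OF L_subspace L_subspace pair_bilinear])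

lemma contract_prod: "x \<in> R \<Longrightarrow> a \<in> L \<Longrightarrow> b \<in> L \<Longrightarrow> contract x (a \<otimes>\<^sub>C b) = P x a *\<^sub>C b"
  unfolding contract_def by (rule tensor_lift_prod[OF L_subspace L_subspace contract_bilinear])

lemma contract_linear: "x \<in> R \<Longrightarrow> linear_on (tensor_space L L) (contract x)"
  unfolding contract_def by (rule tensor_lift_linear[OF L_subspace L_subspace contract_bilinear])

lemma contract_L: "x \<in> R \<Longrightarrow> t \<in> tensor_space L L \<Longrightarrow> contract x t \<in> L"
  unfolding contract_def
  by (rule tensor_lift_in[OF L_subspace L_subspace contract_bilinear _ L_subspace]) (simp_all add: L_closed)

lemma contract_linear_left:
  assumes "t \<in> tensor_space L L"
  shows "linear_on R (\<lambda>x. contract x t)"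
  using assms L_subspace
proof (induction rule: tensor_space_induct)
  case zero
  then show ?case using linear_on_zero[OF contract_linear]
    by (simp add: linear_on_def R_closed)
next
  case (prod a b)
  then show ?case by (auto simp: linear_on_def contract_prod P_simps scaleC_complex_def cv.scale_left_distrib)
next
  case (add s t)
  then show ?case
    by (auto simp: linear_on_def linear_on_add[OF contract_linear] R_closed cv.scale_right_distrib)
qed

lemma pair_contract:
  assumes "x \<in> R" "y \<in> R" "t \<in> tensor_space L L"
  shows "pair x y t = P y (contract x t)"
  unfolding pair_def contract_def using assms
  by (subst linear_on_compose_tensor_lift[OF L_subspace L_subspace contract_bilinear _ L_subspace _ P_linear, unfolded o_def])
    (auto intro!: tensor_lift_cong simp: P_simps scaleC_complex_def)

lemma wedge2_tensor_space: "t \<in> wedge2 L \<Longrightarrow> t \<in> tensor_space L L"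
  by (simp add: wedge2_def)

lemma swap_bilinear: "bilinear_on L L (\<lambda>a b. b \<otimes>\<^sub>C a)"
  by (simp add: bilinear_on_def linear_on_def tensor_prod_simps)

lemma swap_tensor_space: "t \<in> tensor_space L L \<Longrightarrow> tensor_lift L L (\<lambda>a b. b \<otimes>\<^sub>C a) t \<in> tensor_space L L"
  by (rule tensor_lift_in[OF L_subspace L_subspace swap_bilinear]) (simp_all add: tensor_space_prod)

lemma pair_swap:
  assumes "x \<in> R" "y \<in> R" "t \<in> tensor_space L L"
  shows "pair x y (tensor_lift L L (\<lambda>a b. b \<otimes>\<^sub>C a) t) = pair y x t"
proof -
  have "pair x y (tensor_lift L L (\<lambda>a b. b \<otimes>\<^sub>C a) t) = tensor_lift L L (\<lambda>a b. pair x y (b \<otimes>\<^sub>C a)) t"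
    by (rule linear_on_compose_tensor_lift[OF L_subspace L_subspace swap_bilinear assms(3) _ _ pair_linear[OF assms(1,2)]])
      (simp_all add: tensor_space_prod)
  also have "\<dots> = pair y x t"
    unfolding pair_def[of y x] by (rule tensor_lift_cong) (simp add: pair_prod assms)
  finally show ?thesis .
qed

lemma pair_skew:
  assumes "x \<in> R" "y \<in> R" "t \<in> wedge2 L"
  shows "pair x y t = - pair y x t"
proof -
  have t: "t \<in> tensor_space L L" "tensor_lift L L (\<lambda>a b. b \<otimes>\<^sub>C a) t = - t"
    using assms(3) by (auto simp: wedge2_def)
  have "pair y x t = pair x y (- t)" using pair_swap[OF assms(1,2) t(1)] t(2) by simp
  also have "\<dots> = - pair x y t" using linear_on_neg[OF pair_linear[OF assms(1,2)] _ t(1)] by simp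
  finally show ?thesis by simp
qed

lemma ad_bilinear:
  assumes "a \<in> L" shows "bilinear_on L L (\<lambda>x y. brL a x \<otimes>\<^sub>C y + x \<otimes>\<^sub>C brL a y)"
  using assms by (auto simp: bilinear_on_def linear_on_def linear_on_add[OF brL_linear(1)]
      linear_on_scale[OF brL_linear(1)] tensor_prod_simps cv.scale_right_distrib)

lemma tensor_ad_tensor_space:
  "a \<in> L \<Longrightarrow> t \<in> tensor_space L L \<Longrightarrow> tensor_ad L brL a t \<in> tensor_space L L"
  unfolding tensor_ad_def
  by (rule tensor_lift_in[OF L_subspace L_subspace ad_bilinear])
    (simp_all add: tensor_space_prod cv.subspace_add L_closed)

text \<open>Invariance of F moves the bracket with a from the tensor factors to the arguments x and
  y.\<close>

lemma pair_tensor_ad: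
  assumes a: "a \<in> L" and t: "t \<in> tensor_space L L" and x: "x \<in> R" and y: "y \<in> R"
  shows "pair x y (tensor_ad L brL a t) = pair (br x (\<iota> a)) y t + pair x (br y (\<iota> a)) t"
proof -
  have xa: "br x (\<iota> a) \<in> R" "br y (\<iota> a) \<in> R" using x y a by (simp_all add: R_closed)
  have l: "linear_on (tensor_space L L) (\<lambda>t. pair (br x (\<iota> a)) y t + pair x (br y (\<iota> a)) t)"
    by (rule linear_onI)
      (simp_all add: linear_on_add[OF pair_linear] linear_on_scale[OF pair_linear] xa x y cv.scale_right_distrib)
  have l2: "linear_on (tensor_space L L) (\<lambda>t. pair x y (tensor_ad L brL a t))"
    using tensor_lift_linear[OF L_subspace L_subspace ad_bilinear[OF a]] tensor_ad_tensor_space[OF a]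
    by (intro linear_onI)
      (simp_all add: tensor_ad_def linear_on_add linear_on_scale linear_on_add[OF pair_linear[OF x y]]
        linear_on_scale[OF pair_linear[OF x y]])
  show ?thesis
  proof (rule linear_on_tensor_eq[OF l2 l _ L_subspace t])
    fix u v assume uv: "u \<in> L" "v \<in> L"
    have "tensor_ad L brL a (u \<otimes>\<^sub>C v) = brL a u \<otimes>\<^sub>C v + u \<otimes>\<^sub>C brL a v"
      unfolding tensor_ad_def using tensor_lift_prod[OF L_subspace L_subspace ad_bilinear[OF a] uv] .
    then show "pair x y (tensor_ad L brL a (u \<otimes>\<^sub>C v)) =
        pair (br x (\<iota> a)) y (u \<otimes>\<^sub>C v) + pair x (br y (\<iota> a)) (u \<otimes>\<^sub>C v)"
      using uv a x y
      by (simp add: linear_on_add[OF pair_linear] tensor_space_prod L_closed pair_prod xa \<iota>_br F_inv R_closed)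
  qed
qed

end

text \<open>Closure of W under the bracket is deliberately absent: the graph of a skew tensor always
  satisfies these axioms, and closure is what has to be compared with the co-Jacobi
  identity.\<close>

locale lagrangian = double +
  fixes W :: "'a set"
  assumes W_subspace: "cv.subspace W" and W_R: "w \<in> W \<Longrightarrow> w \<in> R"
    and W_iso: "w \<in> W \<Longrightarrow> w' \<in> W \<Longrightarrow> F w w' = 0"
    and W_Int: "a \<in> L \<Longrightarrow> \<iota> a \<in> W \<Longrightarrow> a = 0"
    and W_sum: "x \<in> R \<Longrightarrow> \<exists>a\<in>L. x - \<iota> a \<in> W"
begin

lemmas W_closed = cv.subspace_add[OF W_subspace] cv.subspace_scale[OF W_subspace]
  cv.subspace_neg[OF W_subspace] cv.subspace_diff[OF W_subspace] cv.subspace_0[OF W_subspace]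

text \<open>The L-coordinate of the projection along W; the complementary projection onto W is
  \<open>wp\<close> below.\<close>

definition cp :: "'a \<Rightarrow> 'b" where "cp x = (THE a. a \<in> L \<and> x - \<iota> a \<in> W)"

lemma cp_eqI:
  assumes "a \<in> L" "x - \<iota> a \<in> W"
  shows "cp x = a"
  unfolding cp_def
proof (rule the_equality)
  fix b assume b: "b \<in> L \<and> x - \<iota> b \<in> W"
  have "\<iota> (b - a) = (x - \<iota> a) - (x - \<iota> b)" using assms(1) b by (simp add: \<iota>_simps)
  also have "\<dots> \<in> W" using W_closed(4)[OF assms(2), of "x - \<iota> b"] b by simp
  finally show "b = a" using W_Int[of "b - a"] assms(1) b by (simp add: L_closed)
qed (use assms in simp)

lemma cp: "x \<in> R \<Longrightarrow> cp x \<in> L" "x \<in> R \<Longrightarrow> x - \<iota> (cp x) \<in> W"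
  using W_sum[of x] cp_eqI[of _ x] by auto

lemma cp_linear: "linear_on R cp"
proof (rule linear_onI)
  fix x y c assume xy: "x \<in> R"
  show "cp (c *\<^sub>C x) = c *\<^sub>C cp x"
    using xy cp[OF xy] W_closed(2)[OF cp(2)[OF xy], of c]
    by (intro cp_eqI) (simp_all add: L_closed \<iota>_simps cv.scale_right_diff_distrib)
  assume y: "y \<in> R"
  show "cp (x + y) = cp x + cp y"
    using xy y cp[OF xy] cp[OF y] W_closed(1)[OF cp(2)[OF xy] cp(2)[OF y]]
    by (intro cp_eqI) (simp_all add: L_closed \<iota>_simps algebra_simps)
qed

text \<open>The image of L is isotropic and R is the sum of that image and W, so an element of L
  orthogonal to W is orthogonal to all of R.\<close>

lemma separation:
  assumes "a \<in> L" "\<And>w. w \<in> W \<Longrightarrow> P w a = 0"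
  shows "a = 0"
proof -
  have "\<iota> a = 0"
  proof (rule F_nondeg)
    show "\<iota> a \<in> R" using assms by (simp add: R_closed)
    fix y assume y: "y \<in> R"
    have "F (\<iota> a) y = F (\<iota> a) (\<iota> (cp y) + (y - \<iota> (cp y)))" by simp
    also have "\<dots> = F (\<iota> a) (\<iota> (cp y)) + F (\<iota> a) (y - \<iota> (cp y))"
      using assms(1) y cp[OF y] W_R by (intro linear_on_add[OF F_linear(1)]) (simp_all add: R_closed)
    also have "\<dots> = 0"
      using assms cp[OF y] W_R by (simp add: \<iota>_iso F_sym[of "\<iota> a" "y - \<iota> (cp y)"] R_closed)
    finally show "F (\<iota> a) y = 0" .
  qed
  then show ?thesis using W_Int[OF assms(1)] W_closed by simp
qed

lemma tensor_sep:
  assumes "t \<in> tensor_space L L" "\<And>w w'. w \<in> W \<Longrightarrow> w' \<in> W \<Longrightarrow> pair w w' t = 0"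
  shows "t = 0"
proof (rule tensor_separation[OF L_subspace L_subspace assms(1), where I = W and J = W and \<phi> = "\<lambda>w a. P w a" and \<psi> = "\<lambda>w a. P w a"])
  show "linear_on L (P w)" if "w \<in> W" for w
    using P_linear[OF W_R[OF that]] by (simp add: o_def)
  then show "linear_on L (P w)" if "w \<in> W" for w using that .
qed (use separation assms(2) in \<open>auto simp: pair_def\<close>)

lemma tensor_eqI:
  assumes "s \<in> tensor_space L L" "t \<in> tensor_space L L"
    and "\<And>w w'. w \<in> W \<Longrightarrow> w' \<in> W \<Longrightarrow> pair w w' s = pair w w' t"
  shows "s = t"
proof -
  have "s - t = 0"
    by (rule tensor_sep) (use assms in \<open>simp_all add: cv.subspace_diff linear_on_diff[OF pair_linear] W_R\<close>)
  then show ?thesis by simp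
qed

lemma wedge2I:
  assumes t: "t \<in> tensor_space L L" and skew: "\<And>w w'. w \<in> W \<Longrightarrow> w' \<in> W \<Longrightarrow> pair w w' t = - pair w' w t"
  shows "t \<in> wedge2 L"
proof -
  have "tensor_lift L L (\<lambda>a b. b \<otimes>\<^sub>C a) t = - t"
  proof (rule tensor_eqI)
    fix w w' assume w: "w \<in> W" "w' \<in> W"
    show "pair w w' (tensor_lift L L (\<lambda>a b. b \<otimes>\<^sub>C a) t) = pair w w' (- t)"
      using w t skew[OF w] by (simp add: pair_swap W_R linear_on_neg[OF pair_linear])
  qed (simp_all add: t swap_tensor_space cv.subspace_neg)
  then show ?thesis using t by (simp add: wedge2_def)
qed

text \<open>Gram-Schmidt for the pairing of W with L: \<open>separation\<close> guarantees a nonzero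
  pivot at each step.\<close>

lemma dual_family:
  assumes "finite E" "E \<subseteq> L" "cv.independent E"
  shows "\<exists>d. \<forall>e\<in>E. d e \<in> W \<and> (\<forall>e'\<in>E. P (d e) e' = (if e = e' then 1 else 0))"
  using assms
proof (induction E rule: finite_induct)
  case (insert e E)
  have indE: "cv.independent E" using insert.prems(2) by (rule cv.independent_mono) auto
  then obtain d where d: "\<And>x. x \<in> E \<Longrightarrow> d x \<in> W" "\<And>x y. x \<in> E \<Longrightarrow> y \<in> E \<Longrightarrow> P (d x) y = (if x = y then 1 else 0)"
    using insert by blast
  have EL: "\<And>x. x \<in> E \<Longrightarrow> x \<in> L" and eL: "e \<in> L" using insert.prems by auto
  have PS: "P (\<Sum>x\<in>E. f x *\<^sub>C d x) a = (\<Sum>x\<in>E. f x * P (d x) a)" if "a \<in> L" for f a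
    using that d(1) W_R by (subst linear_on_sum[OF F_linear(2) R_subspace])
      (auto simp: R_closed linear_on_scale[OF F_linear(2)] scaleC_complex_def intro!: sum.cong)
  \<comment> \<open>Subtracting the components along the old dual vectors makes r w orthogonal to
    E.\<close>
  define r where "r w = w - (\<Sum>x\<in>E. P w x *\<^sub>C d x)" for w
  have rW: "r w \<in> W" if "w \<in> W" for w
    unfolding r_def using that d(1) by (auto intro!: W_closed cv.subspace_sum[OF W_subspace])
  have Pr: "P (r w) a = P w a - (\<Sum>x\<in>E. P w x * P (d x) a)" if "w \<in> W" "a \<in> L" for w a
  proof -
    have "(\<Sum>x\<in>E. P w x *\<^sub>C d x) \<in> R"
      using d(1) W_R by (auto intro!: cv.subspace_sum[OF R_subspace] R_closed)
    then show ?thesis unfolding r_def using that W_R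
      by (simp add: linear_on_diff[OF F_linear(2) R_subspace] R_closed PS)
  qed
  have rE: "P (r w) x = 0" if "w \<in> W" "x \<in> E" for w x
  proof -
    have "(\<Sum>y\<in>E. P w y * P (d y) x) = (\<Sum>y\<in>E. if y = x then P w y else 0)"
      by (rule sum.cong[OF refl]) (use d(2) that in auto)
    also have "\<dots> = P w x" using insert.hyps(1) that by simp
    finally show ?thesis using Pr[OF that(1) EL[OF that(2)]] by simp
  qed
  \<comment> \<open>Otherwise all of W would pair with e as with one fixed combination of E, and e
    would lie in the span of E.\<close>
  have "\<exists>w\<in>W. P (r w) e \<noteq> 0"
  proof (rule ccontr)
    assume "\<not> ?thesis"
    then have z: "P w e = (\<Sum>x\<in>E. P w x * P (d x) e)" if "w \<in> W" for w
      using Pr[OF that eL] that by auto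
    have S: "(\<Sum>x\<in>E. P (d x) e *\<^sub>C x) \<in> L"
      using EL by (auto intro!: cv.subspace_sum[OF L_subspace] L_closed)
    have "e - (\<Sum>x\<in>E. P (d x) e *\<^sub>C x) = 0"
    proof (rule separation)
      fix w assume w: "w \<in> W"
      have "P w (\<Sum>x\<in>E. P (d x) e *\<^sub>C x) = (\<Sum>x\<in>E. P w x * P (d x) e)"
        using linear_on_sum[OF P_linear[OF W_R[OF w]] L_subspace, of E "\<lambda>x. P (d x) e *\<^sub>C x"]
          linear_on_scale[OF P_linear[OF W_R[OF w]]] EL
        by (simp add: L_closed scaleC_complex_def mult.commute)
      then show "P w (e - (\<Sum>x\<in>E. P (d x) e *\<^sub>C x)) = 0"
        using z[OF w] linear_on_diff[OF P_linear[OF W_R[OF w]] L_subspace eL S] by simp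
    qed (use eL S L_closed in auto)
    then have "e = (\<Sum>x\<in>E. P (d x) e *\<^sub>C x)" by simp
    then have "e \<in> cv.span E" by (metis (no_types, lifting) cv.span_sum cv.span_scale cv.span_base)
    then show False
      using insert.prems(2) insert.hyps(2) unfolding cv.dependent_def by fastforce
  qed
  then obtain w0 where w0: "w0 \<in> W" "P (r w0) e \<noteq> 0" by blast
  define u where "u = (1 / P (r w0) e) *\<^sub>C r w0"
  have u: "u \<in> W" "P u e = 1" "\<And>x. x \<in> E \<Longrightarrow> P u x = 0"
    using rW[OF w0(1)] w0 rE W_R eL EL unfolding u_def
    by (simp_all add: W_closed linear_on_scale[OF F_linear(2)] R_closed scaleC_complex_def)
  have du: "P (d x - P (d x) e *\<^sub>C u) y = P (d x) y - P (d x) e * P u y" if "x \<in> E" "y \<in> L" for x y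
    using that d(1) u(1) W_R by (simp add: F_simps R_closed scaleC_complex_def)
  show ?case
    by (rule exI[of _ "\<lambda>x. if x = e then u else d x - P (d x) e *\<^sub>C u"])
      (use u d du EL eL insert.hyps(2) in \<open>auto simp: W_closed\<close>)
qed simp

text \<open>T kills U, which has finite codimension, so its image lies in the span of a finite
  independent set E. Expanding T w in E by means of a dual family in W exhibits T as a
  contraction.\<close>

lemma ex_skew_tensor:
  assumes T: "linear_on W T" "\<And>w. w \<in> W \<Longrightarrow> T w \<in> L"
    and skew: "\<And>w w'. w \<in> W \<Longrightarrow> w' \<in> W \<Longrightarrow> P w' (T w) = - P w (T w')"
    and B: "finite B" "U \<subseteq> W" "W \<subseteq> cv.span (U \<union> B)" "\<And>u. u \<in> U \<Longrightarrow> T u = 0"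
  shows "\<exists>t\<in>wedge2 L. \<forall>w\<in>W. contract w t = T w"
proof -
  obtain B' where B': "finite B'" "B' \<subseteq> W" "W \<subseteq> cv.span (U \<union> B')"
    using finite_complement_inside[OF B(1) W_subspace B(2,3)] by blast
  obtain E where E: "E \<subseteq> T ` B'" "cv.independent E" "T ` B' \<subseteq> cv.span E"
    using cv.maximal_independent_subset by blast
  have fE: "finite E" using E(1) B'(1) finite_subset by blast
  have EL: "E \<subseteq> L" using E(1) B'(2) T(2) by blast
  have "cv.subspace {w \<in> W. T w \<in> cv.span E}"
    by (rule cv.subspaceI) (simp_all add: W_closed linear_on_zero[OF T(1) W_subspace] cv.span_zero
        linear_on_add[OF T(1)] linear_on_scale[OF T(1)] cv.span_add cv.span_scale)
  moreover have "U \<union> B' \<subseteq> {w \<in> W. T w \<in> cv.span E}"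
    using B(2,4) B'(2) E(3) by (auto simp: cv.span_zero)
  ultimately have TE: "T w \<in> cv.span E" if "w \<in> W" for w
    using cv.span_minimal[of "U \<union> B'"] B'(3) that by blast
  obtain d where d: "\<And>x. x \<in> E \<Longrightarrow> d x \<in> W" "\<And>x y. x \<in> E \<Longrightarrow> y \<in> E \<Longrightarrow> P (d x) y = (if x = y then 1 else 0)"
    using dual_family[OF fE EL E(2)] by blast
  have Tw: "T w = (\<Sum>e\<in>E. P (d e) (T w) *\<^sub>C e)" if w: "w \<in> W" for w
  proof -
    obtain r where r: "T w = (\<Sum>e\<in>E. r e *\<^sub>C e)"
      using TE[OF w] unfolding cv.span_finite[OF fE] by blast
    have "P (d e) (T w) = r e" if e: "e \<in> E" for e
    proof -
      have "P (d e) (T w) = (\<Sum>x\<in>E. r x * P (d e) x)"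
        unfolding r using linear_on_sum[OF P_linear[OF W_R[OF d(1)[OF e]]] L_subspace, of E "\<lambda>x. r x *\<^sub>C x"]
          linear_on_scale[OF P_linear[OF W_R[OF d(1)[OF e]]]] EL
        by (simp add: L_closed scaleC_complex_def subset_eq)
      also have "\<dots> = (\<Sum>x\<in>E. if x = e then r x else 0)"
        by (rule sum.cong[OF refl]) (use d(2) e in auto)
      finally show ?thesis using fE e by simp
    qed
    then show ?thesis using r by simp
  qed
  \<comment> \<open>By skewness the coefficient of e in T w is minus the pairing of w with T (d e);
    hence the sign of the left factor.\<close>
  define t where "t = (\<Sum>e\<in>E. (- T (d e)) \<otimes>\<^sub>C e)"
  have summand: "(- T (d e)) \<otimes>\<^sub>C e \<in> tensor_space L L" if "e \<in> E" for e
    using that EL T(2) d(1) by (intro tensor_space_prod) (auto simp: L_closed)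
  have t: "t \<in> tensor_space L L"
    unfolding t_def by (rule cv.subspace_sum) (simp_all add: summand)
  have ct: "contract w t = T w" if w: "w \<in> W" for w
  proof -
    have "contract w t = (\<Sum>e\<in>E. contract w ((- T (d e)) \<otimes>\<^sub>C e))"
      unfolding t_def by (rule linear_on_sum[OF contract_linear[OF W_R[OF w]]]) (simp_all add: summand)
    also have "\<dots> = (\<Sum>e\<in>E. P (d e) (T w) *\<^sub>C e)"
    proof (rule sum.cong[OF refl])
      fix e assume e: "e \<in> E"
      show "contract w ((- T (d e)) \<otimes>\<^sub>C e) = P (d e) (T w) *\<^sub>C e"
        using skew[OF w d(1)[OF e]] w e EL T(2) d(1) W_R
        by (simp add: contract_prod L_closed subset_eq linear_on_neg[OF \<iota>_linear L_subspace]
            linear_on_neg[OF F_linear(1) R_subspace] R_closed)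
    qed
    finally show ?thesis using Tw[OF w] by simp
  qed
  have "t \<in> wedge2 L"
  proof (rule wedge2I[OF t])
    fix w w' assume w: "w \<in> W" "w' \<in> W"
    then show "pair w w' t = - pair w' w t"
      using skew[OF w] by (simp add: pair_contract[OF W_R W_R t] ct)
  qed
  then show ?thesis using ct by blast
qed

section \<open>Cobrackets dual to a Lagrangian complement\<close>

definition dual_cobracket :: "('b \<Rightarrow> ('b, 'b) tensor) \<Rightarrow> bool" where
  "dual_cobracket \<delta> \<longleftrightarrow>
     (\<forall>a\<in>L. \<delta> a \<in> wedge2 L \<and> (\<forall>w\<in>W. \<forall>w'\<in>W. pair w w' (\<delta> a) = F (\<iota> a) (br w w')))"

text \<open>For fixed a the tensor must contract w to the L-component of [a, w]. This map is skew by
  invariance, and it has finite rank as soon as a sends a part of W of finite codimension into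
  W.\<close>

lemma ex_dual_cobracket:
  assumes "\<And>a. a \<in> L \<Longrightarrow> \<exists>U B. finite B \<and> U \<subseteq> W \<and> W \<subseteq> cv.span (U \<union> B) \<and> (\<forall>u\<in>U. br (\<iota> a) u \<in> W)"
  shows "\<exists>\<delta>. dual_cobracket \<delta>"
proof -
  have "\<exists>t\<in>wedge2 L. \<forall>w\<in>W. \<forall>w'\<in>W. pair w w' t = F (\<iota> a) (br w w')" if a: "a \<in> L" for a
  proof -
    let ?T = "\<lambda>w. cp (br (\<iota> a) w)"
    have aR: "\<iota> a \<in> R" using a by (simp add: R_closed)
    have PT: "P w' (?T w) = F (\<iota> a) (br w w')" if w: "w \<in> W" "w' \<in> W" for w w'
    proof -
      let ?x = "br (\<iota> a) w"
      have xR: "?x \<in> R" using aR w W_R by (simp add: R_closed)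
      have "F w' ?x = F w' (\<iota> (cp ?x)) + F w' (?x - \<iota> (cp ?x))"
        using linear_on_add[OF F_linear(1), of w' "\<iota> (cp ?x)" "?x - \<iota> (cp ?x)"] cp[OF xR] w W_R
        by (simp add: R_closed)
      then have "P w' (?T w) = F w' ?x" using W_iso[OF w(2) cp(2)[OF xR]] by simp
      also have "\<dots> = F ?x w'" using F_sym xR w W_R by simp
      also have "\<dots> = F (\<iota> a) (br w w')" using F_inv aR w W_R by simp
      finally show ?thesis .
    qed
    obtain U B where UB: "finite B" "U \<subseteq> W" "W \<subseteq> cv.span (U \<union> B)" "\<forall>u\<in>U. br (\<iota> a) u \<in> W"
      using assms[OF a] by blast
    have "\<exists>t\<in>wedge2 L. \<forall>w\<in>W. contract w t = ?T w"
    proof (rule ex_skew_tensor[OF _ _ _ UB(1-3)])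
      show "linear_on W ?T"
        using aR W_R by (intro linear_onI)
          (simp_all add: linear_on_add[OF br_linear(1)] linear_on_scale[OF br_linear(1)] R_closed
            linear_on_add[OF cp_linear] linear_on_scale[OF cp_linear])
      show "?T w \<in> L" if "w \<in> W" for w using that aR W_R by (simp add: cp R_closed)
      show "P w' (?T w) = - P w (?T w')" if "w \<in> W" "w' \<in> W" for w w'
        using PT that br_skew[of w w'] W_R aR by (simp add: linear_on_neg[OF F_linear(1) R_subspace] R_closed)
      show "?T u = 0" if "u \<in> U" for u
        using UB(4) that by (intro cp_eqI) (simp_all add: L_closed \<iota>_simps)
    qed
    then obtain t where "t \<in> wedge2 L" "\<And>w. w \<in> W \<Longrightarrow> contract w t = ?T w" by blast
    then show ?thesis using PT W_R by (intro bexI[of _ t]) (simp_all add: pair_contract wedge2_tensor_space)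
  qed
  then show ?thesis unfolding dual_cobracket_def by metis
qed


text \<open>Both summands of R, the image of L and W, are isotropic, so only the mixed terms
  survive.\<close>

lemma F_cp:
  assumes x: "x \<in> R" and y: "y \<in> R"
  shows "F x y = P x (cp y) + P y (cp x)"
proof -
  have m: "cp x \<in> L" "cp y \<in> L" "x - \<iota> (cp x) \<in> W" "y - \<iota> (cp y) \<in> W"
    "x - \<iota> (cp x) \<in> R" "y - \<iota> (cp y) \<in> R"
    using cp[OF x] cp[OF y] W_R by auto
  have "0 = F (x - \<iota> (cp x)) (y - \<iota> (cp y))" using W_iso m by simp
  also have "\<dots> = F x (y - \<iota> (cp y)) - F (\<iota> (cp x)) (y - \<iota> (cp y))"
    using m x by (intro linear_on_diff[OF F_linear(2) R_subspace]) (simp_all add: R_closed)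
  also have "F x (y - \<iota> (cp y)) = F x y - P x (cp y)"
    using m x y by (intro linear_on_diff[OF F_linear(1) R_subspace]) (simp_all add: R_closed)
  also have "F (\<iota> (cp x)) (y - \<iota> (cp y)) = F (\<iota> (cp x)) y - F (\<iota> (cp x)) (\<iota> (cp y))"
    using m x y by (intro linear_on_diff[OF F_linear(1) R_subspace]) (simp_all add: R_closed)
  also have "\<dots> = P y (cp x)" using m y by (simp add: \<iota>_iso F_sym R_closed)
  finally show ?thesis by (simp add: algebra_simps)
qed

text \<open>As the image of L is isotropic, pairing with L cannot see the L-component. Hence any
  argument of \<open>pair\<close> may be replaced by its W-component.\<close>

lemma P_cp:
  assumes x: "x \<in> R" and a: "a \<in> L"
  shows "P (x - \<iota> (cp x)) a = P x a"
  using assms cp[OF x] by (simp add: linear_on_diff[OF F_linear(2) R_subspace] R_closed \<iota>_iso)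

lemma pair_cp:
  assumes x: "x \<in> R" and y: "y \<in> R"
  shows "pair (x - \<iota> (cp x)) y t = pair x y t" and "pair y (x - \<iota> (cp x)) t = pair y x t"
  unfolding pair_def using assms by (intro tensor_lift_cong; simp add: P_cp)+

lemma F_br_cp:
  assumes a: "a \<in> L" and x: "x \<in> R" and w: "w \<in> R"
  shows "F (\<iota> a) (br (\<iota> (cp x)) w) = P (br w (\<iota> a)) (cp x)"
    and "F (\<iota> a) (br w (\<iota> (cp x))) = - P (br w (\<iota> a)) (cp x)"
proof -
  let ?q = "\<iota> (cp x)"
  have m: "\<iota> a \<in> R" "?q \<in> R" using a cp[OF x] by (simp_all add: R_closed)
  have "F (\<iota> a) (br w ?q) = F (br (\<iota> a) w) ?q" using F_inv m w by simp
  also have "br (\<iota> a) w = - br w (\<iota> a)" by (rule br_skew[OF w m(1)])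
  finally show *: "F (\<iota> a) (br w ?q) = - P (br w (\<iota> a)) (cp x)"
    using m w by (simp add: linear_on_neg[OF F_linear(2) R_subspace] R_closed)
  have "br ?q w = - br w ?q" by (rule br_skew[OF w m(2)])
  then show "F (\<iota> a) (br ?q w) = P (br w (\<iota> a)) (cp x)"
    using * m w by (simp add: linear_on_neg[OF F_linear(1) R_subspace] R_closed)
qed

lemma dual_cobracket_linear:
  assumes "dual_cobracket \<delta>"
  shows "linear_on L \<delta>"
proof -
  have \<delta>: "\<And>a. a \<in> L \<Longrightarrow> \<delta> a \<in> tensor_space L L"
    "\<And>a w w'. a \<in> L \<Longrightarrow> w \<in> W \<Longrightarrow> w' \<in> W \<Longrightarrow> pair w w' (\<delta> a) = F (\<iota> a) (br w w')"
    using assms by (auto simp: dual_cobracket_def wedge2_tensor_space)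
  show ?thesis
  proof (rule linear_onI)
    fix a b c assume a: "a \<in> L"
    show "\<delta> (c *\<^sub>C a) = c *\<^sub>C \<delta> a"
      by (rule tensor_eqI)
        (use a in \<open>simp_all add: \<delta> L_closed cv.subspace_scale linear_on_scale[OF pair_linear] W_R
          \<iota>_simps linear_on_scale[OF F_linear(2)] R_closed\<close>)
    assume b: "b \<in> L"
    show "\<delta> (a + b) = \<delta> a + \<delta> b"
      by (rule tensor_eqI)
        (use a b in \<open>simp_all add: \<delta> L_closed cv.subspace_add linear_on_add[OF pair_linear] W_R
          \<iota>_simps linear_on_add[OF F_linear(2)] R_closed\<close>)
  qed
qed

text \<open>\<delta> b is prescribed on W only, while moving a to the arguments produces [w, a],
  which need not lie in W. Replacing it by its W-component costs the two terms with
  \<open>cp\<close>.\<close>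

lemma pair_ad_dual:
  assumes \<delta>: "dual_cobracket \<delta>" and a: "a \<in> L" and b: "b \<in> L" and w: "w \<in> W" and w': "w' \<in> W"
  shows "pair w w' (tensor_ad L brL a (\<delta> b)) =
    F (br (\<iota> a) (\<iota> b)) (br w w') - P (br w' (\<iota> b)) (cp (br w (\<iota> a))) + P (br w (\<iota> b)) (cp (br w' (\<iota> a)))"
proof -
  let ?a = "\<iota> a" and ?b = "\<iota> b"
  let ?A = "br w ?a" and ?A' = "br w' ?a"
  have \<delta>b: "\<delta> b \<in> tensor_space L L"
    "\<And>w w'. w \<in> W \<Longrightarrow> w' \<in> W \<Longrightarrow> pair w w' (\<delta> b) = F ?b (br w w')"
    using \<delta> b by (auto simp: dual_cobracket_def wedge2_tensor_space)
  have m: "?a \<in> R" "?b \<in> R" "w \<in> R" "w' \<in> R" using a b w w' W_R by (simp_all add: R_closed)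
  then have m2: "?A \<in> R" "?A' \<in> R" "br w w' \<in> R" by (simp_all add: R_closed)
  note q = cp[OF m2(1)] cp[OF m2(2)]
  have qR: "\<iota> (cp ?A) \<in> R" "\<iota> (cp ?A') \<in> R" using q by (simp_all add: R_closed)
  have "pair ?A w' (\<delta> b) = F ?b (br (?A - \<iota> (cp ?A)) w')"
    using pair_cp(1)[OF m2(1) m(4), of "\<delta> b"] \<delta>b(2)[OF q(2) w'] by simp
  also have "\<dots> = F ?b (br ?A w') - P (br w' ?b) (cp ?A)"
    using m m2 qR by (simp add: br_simps F_simps R_closed F_br_cp(1)[OF b m2(1) m(4)])
  finally have 1: "pair ?A w' (\<delta> b) = F ?b (br ?A w') - P (br w' ?b) (cp ?A)" .
  have "pair w ?A' (\<delta> b) = F ?b (br w (?A' - \<iota> (cp ?A')))"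
    using pair_cp(2)[OF m2(2) m(3), of "\<delta> b"] \<delta>b(2)[OF w q(4)] by simp
  also have "\<dots> = F ?b (br w ?A') + P (br w ?b) (cp ?A')"
    using m m2 qR by (simp add: br_simps F_simps R_closed F_br_cp(2)[OF b m2(2) m(3)])
  finally have 2: "pair w ?A' (\<delta> b) = F ?b (br w ?A') + P (br w ?b) (cp ?A')" .
  have "br w (br w' ?a) + br w' (br ?a w) + br ?a (br w w') = 0" by (rule jacobi[OF m(3,4,1)])
  moreover have "br w' (br ?a w) = br ?A w'"
    using br_skew[OF m(3,1)] br_skew[OF m(4) m2(1)] m m2 by (simp add: br_simps)
  moreover have "br ?a (br w w') = - br (br w w') ?a" by (rule br_skew[OF m2(3) m(1)])
  ultimately have "br ?A w' + br w ?A' = br (br w w') ?a" by (simp add: algebra_simps)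
  then have "F ?b (br ?A w') + F ?b (br w ?A') = F ?b (br (br w w') ?a)"
    using linear_on_add[OF F_linear(1)[OF m(2)], of "br ?A w'" "br w ?A'"] m m2 by (simp add: R_closed)
  also have "\<dots> = F (br (br w w') ?a) ?b" using F_sym m m2 by (simp add: R_closed)
  also have "\<dots> = F (br w w') (br ?a ?b)" using F_inv m m2 by simp
  also have "\<dots> = F (br ?a ?b) (br w w')" using F_sym m m2 by (simp add: R_closed)
  finally show ?thesis
    using pair_tensor_ad[OF a \<delta>b(1) m(3,4)] 1 2 by simp
qed

text \<open>The \<open>cp\<close> terms of \<open>pair_ad_dual\<close> for (a, b) and for (b, a) are
  exactly the mixed terms of F on two pairs of brackets. They recombine by \<open>F_cp\<close>, and
  invariance with Jacobi evaluates the result.\<close>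

lemma dual_cobracket_cocycle:
  assumes \<delta>: "dual_cobracket \<delta>" and a: "a \<in> L" and b: "b \<in> L"
  shows "\<delta> (brL a b) = tensor_ad L brL a (\<delta> b) - tensor_ad L brL b (\<delta> a)"
proof (rule tensor_eqI)
  let ?a = "\<iota> a" and ?b = "\<iota> b"
  have ts: "\<delta> c \<in> tensor_space L L" if "c \<in> L" for c
    using \<delta> that by (auto simp: dual_cobracket_def wedge2_tensor_space)
  show "\<delta> (brL a b) \<in> tensor_space L L" using ts a b by (simp add: L_closed)
  have ad: "tensor_ad L brL a (\<delta> b) \<in> tensor_space L L" "tensor_ad L brL b (\<delta> a) \<in> tensor_space L L"
    using ts tensor_ad_tensor_space a b by auto
  then show "tensor_ad L brL a (\<delta> b) - tensor_ad L brL b (\<delta> a) \<in> tensor_space L L"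
    by (simp add: cv.subspace_diff)
  fix w w' assume w: "w \<in> W" "w' \<in> W"
  let ?A = "br w ?a" and ?A' = "br w' ?a" and ?B = "br w ?b" and ?B' = "br w' ?b"
  have m: "?a \<in> R" "?b \<in> R" "w \<in> R" "w' \<in> R" using a b w W_R by (simp_all add: R_closed)
  then have m2: "?A \<in> R" "?A' \<in> R" "?B \<in> R" "?B' \<in> R" "br w w' \<in> R" "br ?a ?b \<in> R" "br ?b ?a \<in> R"
    by (simp_all add: R_closed)
  have ab: "br ?b ?a = - br ?a ?b" by (rule br_skew[OF m(1,2)])
  have "br ?a (br w' ?b) + br w' (br ?b ?a) + br ?b (br ?a w') = 0" by (rule jacobi[OF m(1,4,2)])
  moreover have "br ?b (br ?a w') = - br ?b ?A'" using br_skew[OF m(4,1)] m m2 by (simp add: br_simps)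
  moreover have "br w' (br ?b ?a) = - br w' (br ?a ?b)" using ab m m2 by (simp add: br_simps)
  ultimately have J: "br ?a ?B' - br ?b ?A' = br w' (br ?a ?b)" by (simp add: algebra_simps)
  have "F ?A ?B' - F ?B ?A' = F w (br ?a ?B') - F w (br ?b ?A')" using F_inv m m2 by simp
  also have "\<dots> = F w (br ?a ?B' - br ?b ?A')"
    using m m2 by (simp add: linear_on_diff[OF F_linear(1) R_subspace] R_closed)
  also have "\<dots> = F (br w w') (br ?a ?b)" using J F_inv m m2 by simp
  also have "\<dots> = F (br ?a ?b) (br w w')" using F_sym m2 by simp
  finally have X: "F ?A ?B' - F ?B ?A' = F (br ?a ?b) (br w w')" .
  have 1: "pair w w' (\<delta> (brL a b)) = F (br ?a ?b) (br w w')"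
    using \<delta> a b w by (simp add: dual_cobracket_def L_closed \<iota>_br)
  have 2: "pair w w' (tensor_ad L brL a (\<delta> b) - tensor_ad L brL b (\<delta> a)) =
      pair w w' (tensor_ad L brL a (\<delta> b)) - pair w w' (tensor_ad L brL b (\<delta> a))"
    using ad m by (simp add: linear_on_diff[OF pair_linear])
  have 3: "F (br ?b ?a) (br w w') = - F (br ?a ?b) (br w w')"
    unfolding ab using m2 by (simp add: linear_on_neg[OF F_linear(2) R_subspace])
  \<comment> \<open>\<open>e1\<close> and \<open>e2\<close> stand for the mixed terms of F on
    ([w, a], [w', b]), \<open>e3\<close> and \<open>e4\<close> for those on ([w, b],
    [w', a]).\<close>
  have aux: "x = (x - e2 + e3) - (- x - e4 + e1)" if "(e1 + e2) - (e3 + e4) = x" for x e1 e2 e3 e4 :: complex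
    using that by (auto simp: algebra_simps)
  show "pair w w' (\<delta> (brL a b)) = pair w w' (tensor_ad L brL a (\<delta> b) - tensor_ad L brL b (\<delta> a))"
    unfolding 1 2 pair_ad_dual[OF \<delta> a b w] pair_ad_dual[OF \<delta> b a w] 3
    by (rule aux) (rule X[unfolded F_cp[OF m2(1,4)] F_cp[OF m2(3,2)]])
qed

section \<open>Co-Jacobi as the Jacobi identity of a projected bracket\<close>

definition pair3 :: "'a \<Rightarrow> 'a \<Rightarrow> 'a \<Rightarrow> (('b, 'b) tensor, 'b) tensor \<Rightarrow> complex" where
  "pair3 x y z = tensor_lift (tensor_space L L) L (\<lambda>s c. pair x y s * P z c)"

lemma pair3_bilinear:
  "x \<in> R \<Longrightarrow> y \<in> R \<Longrightarrow> z \<in> R \<Longrightarrow> bilinear_on (tensor_space L L) L (\<lambda>s c. pair x y s * P z c)"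
  unfolding bilinear_on_def linear_on_def
  by (auto simp: linear_on_add[OF pair_linear] linear_on_scale[OF pair_linear] P_simps
      scaleC_complex_def algebra_simps)

lemmas pair3_linear = tensor_lift_linear[OF subspace_tensor_space L_subspace pair3_bilinear, folded pair3_def]
lemmas pair3_prod = tensor_lift_prod[OF subspace_tensor_space L_subspace pair3_bilinear, folded pair3_def]

text \<open>Separation with a tensor space as first factor: there the functionals
  \<open>pair x y\<close> with x, y in W separate points.\<close>

lemma tensor3_sep:
  assumes "t \<in> tensor_space (tensor_space L L) L"
    and "\<And>x y z. x \<in> W \<Longrightarrow> y \<in> W \<Longrightarrow> z \<in> W \<Longrightarrow> pair3 x y z t = 0"
  shows "t = 0"
proof (rule tensor_separation[OF subspace_tensor_space L_subspace assms(1),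
      where I = "W \<times> W" and J = W and \<phi> = "\<lambda>(x, y). pair x y" and \<psi> = "\<lambda>w a. P w a"])
  show "linear_on L (P w)" if "w \<in> W" for w
    using P_linear[OF W_R[OF that]] by (simp add: o_def)
qed (use separation tensor_sep assms(2) W_R in \<open>auto simp: pair3_def intro: pair_linear\<close>)

text \<open>The summands of \<open>tensor_alt\<close>, with the last factor c as first argument so
  that the inner lift runs over a and b.\<close>

definition rotations :: "'b \<Rightarrow> 'b \<Rightarrow> 'b \<Rightarrow> (('b, 'b) tensor, 'b) tensor" where
  "rotations c a b = a \<otimes>\<^sub>C b \<otimes>\<^sub>C c + c \<otimes>\<^sub>C a \<otimes>\<^sub>C b + b \<otimes>\<^sub>C c \<otimes>\<^sub>C a"

lemma rotations_bilinear: "bilinear_on L L (rotations c)"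
  by (auto simp: bilinear_on_def linear_on_def rotations_def tensor_prod_simps cv.scale_right_distrib)

lemma tensor_alt_rotations: "tensor_alt L = tensor_lift (tensor_space L L) L (\<lambda>s c. tensor_lift L L (rotations c) s)"
  by (simp add: tensor_alt_def rotations_def[abs_def])

lemma alt_bilinear: "bilinear_on (tensor_space L L) L (\<lambda>s c. tensor_lift L L (rotations c) s)"
  unfolding bilinear_on_def
proof (intro conjI ballI)
  note lin = tensor_lift_linear[OF L_subspace L_subspace rotations_bilinear]
  note rot = tensor_lift_prod[OF L_subspace L_subspace rotations_bilinear]
  fix s assume "s \<in> tensor_space L L"
  then show "linear_on L (\<lambda>c. tensor_lift L L (rotations c) s)"
    using L_subspace
  proof (induction rule: tensor_space_induct)
    case zero
    then show ?case using linear_on_zero[OF lin] by (simp add: linear_on_def)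
  next
    case (prod a b)
    then show ?case unfolding rot[OF prod]
      by (simp add: linear_on_def rotations_def tensor_prod_simps cv.scale_right_distrib)
  next
    case (add s t)
    then show ?case
      by (auto simp: linear_on_def linear_on_add[OF lin] cv.scale_right_distrib)
  qed
qed (rule tensor_lift_linear[OF L_subspace L_subspace rotations_bilinear])

lemma rotations_space: "a \<in> L \<Longrightarrow> b \<in> L \<Longrightarrow> c \<in> L \<Longrightarrow> rotations c a b \<in> tensor_space (tensor_space L L) L"
  unfolding rotations_def by (intro cv.subspace_add subspace_tensor_space tensor_space_prod)

lemma alt_space:
  assumes "s \<in> tensor_space L L" "c \<in> L"
  shows "tensor_lift L L (rotations c) s \<in> tensor_space (tensor_space L L) L"
  by (rule tensor_lift_in[OF L_subspace L_subspace rotations_bilinear assms(1)])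
    (simp_all add: rotations_space assms(2))

lemma tensor_alt_space:
  "z \<in> tensor_space (tensor_space L L) L \<Longrightarrow> tensor_alt L z \<in> tensor_space (tensor_space L L) L"
  unfolding tensor_alt_rotations
  by (rule tensor_lift_in[OF subspace_tensor_space L_subspace alt_bilinear]) (simp_all add: alt_space)

text \<open>Rotating the three factors cyclically amounts to rotating the three arguments of the
  pairing; two nested reductions to pure tensors.\<close>

lemma pair3_alt:
  assumes x: "x \<in> R" "y \<in> R" "z \<in> R" and t: "t \<in> tensor_space (tensor_space L L) L"
  shows "pair3 x y z (tensor_alt L t) = pair3 x y z t + pair3 y z x t + pair3 z x y t"
proof (rule linear_on_tensor_eq[OF _ _ _ subspace_tensor_space t])
  note alin = tensor_lift_linear[OF subspace_tensor_space L_subspace alt_bilinear, folded tensor_alt_rotations]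
  show "linear_on (tensor_space (tensor_space L L) L) (\<lambda>t. pair3 x y z (tensor_alt L t))"
    using x by (intro linear_onI)
      (simp_all add: linear_on_add[OF alin] linear_on_scale[OF alin] tensor_alt_space
        linear_on_add[OF pair3_linear] linear_on_scale[OF pair3_linear])
  show "linear_on (tensor_space (tensor_space L L) L) (\<lambda>t. pair3 x y z t + pair3 y z x t + pair3 z x y t)"
    using x by (intro linear_onI)
      (simp_all add: linear_on_add[OF pair3_linear] linear_on_scale[OF pair3_linear] cv.scale_right_distrib)
  fix s c assume s: "s \<in> tensor_space L L" and c: "c \<in> L"
  have "tensor_alt L (s \<otimes>\<^sub>C c) = tensor_lift L L (rotations c) s"
    unfolding tensor_alt_rotations by (rule tensor_lift_prod[OF subspace_tensor_space L_subspace alt_bilinear s c])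
  moreover have "pair3 x y z (tensor_lift L L (rotations c) s) =
      pair3 x y z (s \<otimes>\<^sub>C c) + pair3 y z x (s \<otimes>\<^sub>C c) + pair3 z x y (s \<otimes>\<^sub>C c)"
  proof (rule linear_on_tensor_eq[OF _ _ _ L_subspace s])
    note rlin = tensor_lift_linear[OF L_subspace L_subspace rotations_bilinear]
    show "linear_on (tensor_space L L) (\<lambda>s. pair3 x y z (tensor_lift L L (rotations c) s))"
      using x c by (intro linear_onI)
        (simp_all add: linear_on_add[OF rlin] linear_on_scale[OF rlin] alt_space
          linear_on_add[OF pair3_linear] linear_on_scale[OF pair3_linear])
    show "linear_on (tensor_space L L) (\<lambda>s. pair3 x y z (s \<otimes>\<^sub>C c) + pair3 y z x (s \<otimes>\<^sub>C c) + pair3 z x y (s \<otimes>\<^sub>C c))"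
      using x c by (intro linear_onI)
        (simp_all add: tensor_prod_simps tensor_space_prod linear_on_add[OF pair3_linear]
          linear_on_scale[OF pair3_linear] cv.scale_right_distrib)
    fix a b assume ab: "a \<in> L" "b \<in> L"
    have r: "tensor_lift L L (rotations c) (a \<otimes>\<^sub>C b) = rotations c a b"
      by (rule tensor_lift_prod[OF L_subspace L_subspace rotations_bilinear ab])
    have sp: "a \<otimes>\<^sub>C b \<otimes>\<^sub>C c \<in> tensor_space (tensor_space L L) L"
      "c \<otimes>\<^sub>C a \<otimes>\<^sub>C b \<in> tensor_space (tensor_space L L) L" "b \<otimes>\<^sub>C c \<otimes>\<^sub>C a \<in> tensor_space (tensor_space L L) L"
      using ab c by (simp_all add: tensor_space_prod)
    show "pair3 x y z (tensor_lift L L (rotations c) (a \<otimes>\<^sub>C b)) =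
        pair3 x y z (a \<otimes>\<^sub>C b \<otimes>\<^sub>C c) + pair3 y z x (a \<otimes>\<^sub>C b \<otimes>\<^sub>C c) + pair3 z x y (a \<otimes>\<^sub>C b \<otimes>\<^sub>C c)"
      unfolding r rotations_def using x ab c sp
      by (simp add: linear_on_add[OF pair3_linear] cv.subspace_add pair3_prod tensor_space_prod pair_prod)
  qed
  ultimately show "pair3 x y z (tensor_alt L (s \<otimes>\<^sub>C c)) =
      pair3 x y z (s \<otimes>\<^sub>C c) + pair3 y z x (s \<otimes>\<^sub>C c) + pair3 z x y (s \<otimes>\<^sub>C c)" by simp
qed

abbreviation wp :: "'a \<Rightarrow> 'a" where "wp x \<equiv> x - \<iota> (cp x)"

definition co_jacobi :: "('b \<Rightarrow> ('b, 'b) tensor) \<Rightarrow> bool" where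
  "co_jacobi \<delta> \<longleftrightarrow> (\<forall>a\<in>L. tensor_alt L (tensor_lift L L (\<lambda>x y. \<delta> x \<otimes>\<^sub>C y) (\<delta> a)) = 0)"

text \<open>Dually, \<delta> is the bracket on W followed by projection to W along L. Applying
  \<delta> twice nests two such brackets, so co-Jacobi is the Jacobi identity of the projected
  bracket, tested against L.\<close>

lemma co_jacobi_iff:
  assumes \<delta>: "dual_cobracket \<delta>"
  shows "co_jacobi \<delta> \<longleftrightarrow> (\<forall>a\<in>L. \<forall>x\<in>W. \<forall>y\<in>W. \<forall>z\<in>W.
    F (\<iota> a) (br (wp (br x y)) z) + F (\<iota> a) (br (wp (br y z)) x) + F (\<iota> a) (br (wp (br z x)) y) = 0)"
proof -
  have \<delta>s: "\<delta> a \<in> tensor_space L L" if "a \<in> L" for a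
    using \<delta> that by (auto simp: dual_cobracket_def wedge2_tensor_space)
  have \<delta>p: "pair x y (\<delta> a) = F (\<iota> a) (br x y)" if "a \<in> L" "x \<in> W" "y \<in> W" for a x y
    using \<delta> that by (auto simp: dual_cobracket_def)
  note \<delta>lin = dual_cobracket_linear[OF \<delta>]
  have bil: "bilinear_on L L (\<lambda>x y. \<delta> x \<otimes>\<^sub>C y)"
    by (auto simp: bilinear_on_def linear_on_def linear_on_add[OF \<delta>lin] linear_on_scale[OF \<delta>lin] tensor_prod_simps)
  let ?D = "\<lambda>a. tensor_lift L L (\<lambda>x y. \<delta> x \<otimes>\<^sub>C y) (\<delta> a)"
  have Ds: "?D a \<in> tensor_space (tensor_space L L) L" if "a \<in> L" for a
    by (rule tensor_lift_in[OF L_subspace L_subspace bil \<delta>s[OF that]]) (simp_all add: \<delta>s tensor_space_prod)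
  have pD: "pair3 x y z (?D a) = F (\<iota> a) (br (wp (br x y)) z)"
    if a: "a \<in> L" and x: "x \<in> W" "y \<in> W" "z \<in> W" for a x y z
  proof -
    have xR: "x \<in> R" "y \<in> R" "z \<in> R" "br x y \<in> R" using x W_R by (simp_all add: R_closed)
    have "pair3 x y z (?D a) = tensor_lift L L (\<lambda>u v. pair3 x y z (\<delta> u \<otimes>\<^sub>C v)) (\<delta> a)"
      by (rule linear_on_compose_tensor_lift[OF L_subspace L_subspace bil \<delta>s[OF a]
            subspace_tensor_space _ pair3_linear[OF xR(1-3)]]) (simp add: \<delta>s tensor_space_prod)
    \<comment> \<open>Pairing \<delta> u with x and y gives the pairing of [x, y] with u, so the
      inner \<delta> disappears.\<close>
    also have "\<dots> = pair (br x y) z (\<delta> a)"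
      unfolding pair_def[of "br x y"] using xR x
      by (intro tensor_lift_cong) (simp add: pair3_prod \<delta>s \<delta>p F_sym R_closed)
    also have "\<dots> = pair (wp (br x y)) z (\<delta> a)" using pair_cp(1)[OF xR(4,3)] by simp
    also have "\<dots> = F (\<iota> a) (br (wp (br x y)) z)" using cp[OF xR(4)] a x by (simp add: \<delta>p)
    finally show ?thesis .
  qed
  have "tensor_alt L (?D a) = 0 \<longleftrightarrow> (\<forall>x\<in>W. \<forall>y\<in>W. \<forall>z\<in>W.
      F (\<iota> a) (br (wp (br x y)) z) + F (\<iota> a) (br (wp (br y z)) x) + F (\<iota> a) (br (wp (br z x)) y) = 0)"
    if a: "a \<in> L" for a
  proof -
    have *: "pair3 x y z (tensor_alt L (?D a)) =
        F (\<iota> a) (br (wp (br x y)) z) + F (\<iota> a) (br (wp (br y z)) x) + F (\<iota> a) (br (wp (br z x)) y)"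
      if "x \<in> W" "y \<in> W" "z \<in> W" for x y z
      using pair3_alt[OF _ _ _ Ds[OF a], of x y z] that W_R pD[OF a] by simp
    have z0: "pair3 x y z 0 = 0" if "x \<in> W" "y \<in> W" "z \<in> W" for x y z
      using linear_on_zero[OF pair3_linear] that W_R by simp
    show ?thesis
    proof
      assume "tensor_alt L (?D a) = 0"
      then show "\<forall>x\<in>W. \<forall>y\<in>W. \<forall>z\<in>W.
        F (\<iota> a) (br (wp (br x y)) z) + F (\<iota> a) (br (wp (br y z)) x) + F (\<iota> a) (br (wp (br z x)) y) = 0"
        using * z0 by (metis (no_types, lifting))
    next
      assume "\<forall>x\<in>W. \<forall>y\<in>W. \<forall>z\<in>W.
        F (\<iota> a) (br (wp (br x y)) z) + F (\<iota> a) (br (wp (br y z)) x) + F (\<iota> a) (br (wp (br z x)) y) = 0"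
      then show "tensor_alt L (?D a) = 0"
        by (intro tensor3_sep tensor_alt_space Ds a) (simp add: *)
    qed
  qed
  then show ?thesis unfolding co_jacobi_def by blast
qed

text \<open>Jacobi in the shape of \<open>co_jacobi_iff\<close> but without projection; the
  difference of the two isolates the terms with \<open>cp\<close>.\<close>

lemma cyclic_jacobi:
  assumes "x \<in> R" "y \<in> R" "z \<in> R" "a \<in> L"
  shows "F (\<iota> a) (br (br x y) z) + F (\<iota> a) (br (br y z) x) + F (\<iota> a) (br (br z x) y) = 0"
proof -
  have m: "\<iota> a \<in> R" "br x y \<in> R" "br y z \<in> R" "br z x \<in> R" using assms by (simp_all add: R_closed)
  have "br x (br y z) + br y (br z x) + br z (br x y) = 0" using jacobi assms by simp
  moreover have "br x (br y z) = - br (br y z) x" "br y (br z x) = - br (br z x) y" "br z (br x y) = - br (br x y) z"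
    by (rule br_skew[OF m(3) assms(1)] br_skew[OF m(4) assms(2)] br_skew[OF m(2) assms(3)])+
  ultimately have "- (br (br x y) z + br (br y z) x + br (br z x) y) = 0" by (simp add: algebra_simps)
  then have "br (br x y) z + br (br y z) x + br (br z x) y = 0" by (simp only: neg_equal_0_iff_equal)
  then have "F (\<iota> a) (br (br x y) z + br (br y z) x + br (br z x) y) = 0"
    using linear_on_zero[OF F_linear(1)[OF m(1)] R_subspace] by simp
  then show ?thesis
    using assms m by (simp add: linear_on_add[OF F_linear(1)[OF m(1)]] R_closed)
qed

text \<open>If W is closed, the projection \<open>wp\<close> does nothing to brackets of W, and
  Jacobi in R applies.\<close>

lemma co_jacobi_subalgebra:
  assumes \<delta>: "dual_cobracket \<delta>" and sub: "\<And>x y. x \<in> W \<Longrightarrow> y \<in> W \<Longrightarrow> br x y \<in> W"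
  shows "co_jacobi \<delta>"
proof -
  have "wp (br x y) = br x y" if "x \<in> W" "y \<in> W" for x y
    using cp_eqI[of 0 "br x y"] sub[OF that] by (simp add: L_closed \<iota>_simps)
  then show ?thesis unfolding co_jacobi_iff[OF \<delta>] using cyclic_jacobi W_R by simp
qed

text \<open>Pairing co-Jacobi with \<open>U\<close> shows that the orbit of the obstruction \<open>cp (br x y)\<close> under \<open>L\<close> is orthogonal
  to \<open>U\<close>.\<close>

lemma subalgebra_if_co_jacobi:
  assumes \<delta>: "dual_cobracket \<delta>" and cj: "co_jacobi \<delta>"
    and U: "U \<subseteq> W" "\<And>u x y. u \<in> U \<Longrightarrow> x \<in> W \<Longrightarrow> y \<in> W \<Longrightarrow> F u (br x y) = 0"
    and big: "\<And>c. c \<in> L \<Longrightarrow> (\<And>a u. a \<in> L \<Longrightarrow> u \<in> U \<Longrightarrow> F (br (\<iota> a) (\<iota> c)) u = 0) \<Longrightarrow> c = 0"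
    and x: "x \<in> W" and y: "y \<in> W"
  shows "br x y \<in> W"
proof -
  \<comment> \<open>Brackets of W with U stay in W: the pairing of their L-component with w is F u
    [w, v] by invariance, which vanishes by assumption.\<close>
  have q0: "cp (br v u) = 0" if u: "u \<in> U" and v: "v \<in> W" for u v
  proof (rule separation)
    have vR: "v \<in> R" "u \<in> R" "br v u \<in> R" using u v U(1) W_R by (auto simp: R_closed)
    show "cp (br v u) \<in> L" using cp[OF vR(3)] by simp
    fix w assume w: "w \<in> W"
    have "P w (cp (br v u)) = F w (br v u)"
      using F_cp[OF W_R[OF w] vR(3)] cp_eqI[of 0 w] w cp[OF vR(3)]
      by (simp add: L_closed \<iota>_simps linear_on_zero[OF F_linear(1)] R_subspace vR)
    also have "\<dots> = F (br w v) u" using F_inv W_R w vR by simp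
    also have "\<dots> = F u (br w v)" using F_sym W_R w vR by (simp add: R_closed)
    finally show "P w (cp (br v u)) = 0" using U(2)[OF u w v] by simp
  qed
  have xyR: "x \<in> R" "y \<in> R" "br x y \<in> R" using x y W_R by (auto simp: R_closed)
  have "cp (br x y) = 0"
  proof (rule big)
    show "cp (br x y) \<in> L" using cp[OF xyR(3)] by simp
    fix a u assume a: "a \<in> L" and u: "u \<in> U"
    have uW: "u \<in> W" "u \<in> R" "\<iota> a \<in> R" "\<iota> (cp (br x y)) \<in> R"
      using u U(1) W_R a cp[OF xyR(3)] by (auto simp: R_closed)
    have "cp (br u x) = - cp (br x u)"
      using br_skew[OF xyR(1) uW(2)] linear_on_neg[OF cp_linear R_subspace] xyR uW by (simp add: R_closed)
    then have wpu: "wp (br u x) = br u x" "wp (br y u) = br y u"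
      using q0[OF u x] q0[OF u y] by (simp_all add: \<iota>_simps)
    have "F (\<iota> a) (br (wp (br x y)) u) + F (\<iota> a) (br (br y u) x) + F (\<iota> a) (br (br u x) y) = 0"
      using cj unfolding co_jacobi_iff[OF \<delta>] using a x y uW(1) wpu by fastforce
    moreover have "F (\<iota> a) (br (wp (br x y)) u) = F (\<iota> a) (br (br x y) u) - F (\<iota> a) (br (\<iota> (cp (br x y))) u)"
      using xyR uW by (simp add: br_simps F_simps R_closed)
    \<comment> \<open>Of the three projections only that of [x, y] can be nontrivial, so subtracting
      Jacobi in R leaves the single term with \<open>cp (br x y)\<close>.\<close>
    ultimately have "(F (\<iota> a) (br (br x y) u) + F (\<iota> a) (br (br y u) x) + F (\<iota> a) (br (br u x) y)) -
        F (\<iota> a) (br (\<iota> (cp (br x y))) u) = 0"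
      by (simp add: algebra_simps)
    then have "F (\<iota> a) (br (\<iota> (cp (br x y))) u) = 0"
      unfolding cyclic_jacobi[OF xyR(1,2) uW(2) a] by simp
    then show "F (br (\<iota> a) (\<iota> (cp (br x y)))) u = 0" using F_inv uW by simp
  qed
  then show ?thesis using cp(2)[OF xyR(3)] by (simp add: \<iota>_simps)
qed

text \<open>Linearity, skewness and the cocycle identity are automatic for a dual cobracket, so
  co-Jacobi is all that remains.\<close>

lemma lie_bialgebra_iff:
  assumes "dual_cobracket \<delta>"
  shows "lie_bialgebra L brL \<delta> \<longleftrightarrow> co_jacobi \<delta>"
  using assms dual_cobracket_linear[OF assms] dual_cobracket_cocycle[OF assms] lieL
  unfolding lie_bialgebra_def co_jacobi_def dual_cobracket_def by blast

section \<open>Lagrangian complements as graphs of skew tensors\<close>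

lemma graph_lagrangian:
  assumes t: "t \<in> wedge2 L"
  shows "lagrangian R br F L brL \<iota> (graph t W)"
proof
  have ts: "t \<in> tensor_space L L" using t by (rule wedge2_tensor_space)
  let ?T = "\<lambda>w. contract w t"
  have TL: "?T w \<in> L" "\<iota> (?T w) \<in> R" if "w \<in> W" for w using contract_L[OF W_R[OF that] ts] by (auto simp: R_closed)
  note Tlin = contract_linear_left[OF ts]
  show "cv.subspace (graph t W)"
  proof (rule cv.subspaceI)
    show "0 \<in> graph t W"
      using W_closed linear_on_zero[OF Tlin R_subspace] by (force simp: graph_def \<iota>_simps)
    fix x y c assume "x \<in> graph t W" "y \<in> graph t W"
    then obtain u v where uv: "x = u + \<iota> (?T u)" "u \<in> W" "y = v + \<iota> (?T v)" "v \<in> W" by (auto simp: graph_def)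
    then have "x + y = (u + v) + \<iota> (?T (u + v))" "c *\<^sub>C x = (c *\<^sub>C u) + \<iota> (?T (c *\<^sub>C u))"
      using W_R TL by (simp_all add: linear_on_add[OF Tlin] linear_on_scale[OF Tlin] \<iota>_simps cv.scale_right_distrib)
    then show "x + y \<in> graph t W" "c *\<^sub>C x \<in> graph t W"
      using uv W_closed unfolding graph_def by blast+
  qed
  show "w \<in> R" if "w \<in> graph t W" for w
    using that TL W_R by (auto simp: graph_def R_closed)
  show "F w w' = 0" if "w \<in> graph t W" "w' \<in> graph t W" for w w'
  proof -
    obtain u v where uv: "w = u + \<iota> (?T u)" "u \<in> W" "w' = v + \<iota> (?T v)" "v \<in> W"
      using \<open>w \<in> graph t W\<close> \<open>w' \<in> graph t W\<close> by (auto simp: graph_def)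
    \<comment> \<open>The two mixed terms are \<open>pair u v t\<close> and
      \<open>pair v u t\<close>, so isotropy of the graph is skewness of t.\<close>
    have "F w w' = F u v + P u (?T v) + (P v (?T u) + F (\<iota> (?T u)) (\<iota> (?T v)))"
      unfolding uv using uv W_R TL F_sym by (simp add: F_simps R_closed)
    also have "\<dots> = pair v u t + pair u v t"
      using uv W_iso TL W_R by (simp add: \<iota>_iso pair_contract[OF _ _ ts])
    also have "\<dots> = 0" using pair_skew[OF _ _ t, of u v] uv W_R by simp
    finally show ?thesis .
  qed
  show "a = 0" if a: "a \<in> L" "\<iota> a \<in> graph t W" for a
  proof -
    obtain u where u: "\<iota> a = u + \<iota> (?T u)" "u \<in> W" using a(2) by (auto simp: graph_def)
    then have "\<iota> (a - ?T u) = u" using a(1) TL by (simp add: \<iota>_simps)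
    then have "a - ?T u = 0" using W_Int[of "a - ?T u"] u(2) a(1) TL by (simp add: L_closed)
    then have "u = 0" "a = ?T u" using \<open>\<iota> (a - ?T u) = u\<close> by (auto simp: \<iota>_simps)
    then show ?thesis using linear_on_zero[OF Tlin R_subspace] by simp
  qed
  show "\<exists>a\<in>L. x - \<iota> a \<in> graph t W" if x: "x \<in> R" for x
  proof -
    let ?w = "wp x"
    have w: "?w \<in> W" using cp[OF x] by simp
    \<comment> \<open>The W-component is kept, and the component in L absorbs the
      contraction.\<close>
    have "x - \<iota> (cp x - ?T ?w) = ?w + \<iota> (?T ?w)" using TL[OF w] cp[OF x] by (simp add: \<iota>_simps)
    then have "x - \<iota> (cp x - ?T ?w) \<in> graph t W" using w unfolding graph_def by blast
    moreover have "cp x - ?T ?w \<in> L" using cp[OF x] TL[OF w] by (simp add: L_closed)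
    ultimately show ?thesis by blast
  qed
qed

text \<open>Let T w be the image in R of the contraction of t with w. In [w + T w, w' + T w'] the
  two cross terms, paired with a, are by invariance and skewness the two terms of
  \<open>tensor_ad\<close> applied to t, while [T w, T w'] lies in the isotropic image of L.\<close>

lemma graph_dual_cobracket:
  assumes \<delta>: "dual_cobracket \<delta>" and t: "t \<in> wedge2 L"
  shows "lagrangian.dual_cobracket br F L \<iota> (graph t W) (\<lambda>a. \<delta> a + tensor_ad L brL a t)"
proof -
  interpret G: lagrangian R br F L brL \<iota> "graph t W" by (rule graph_lagrangian[OF t])
  have ts: "t \<in> tensor_space L L" using t by (rule wedge2_tensor_space)
  let ?T = "\<lambda>w. contract w t"
  have TL: "?T w \<in> L" "\<iota> (?T w) \<in> R" if "w \<in> W" for w using contract_L[OF W_R[OF that] ts] by (auto simp: R_closed)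
  have p: "pair w w' (\<delta> a + tensor_ad L brL a t) =
      F (\<iota> a) (br w w') + pair (br w (\<iota> a)) w' t + pair w (br w' (\<iota> a)) t"
    if "a \<in> L" "w \<in> W" "w' \<in> W" for a w w'
    using that \<delta> ts W_R by (simp add: linear_on_add[OF pair_linear] pair_tensor_ad tensor_ad_tensor_space
        dual_cobracket_def wedge2_tensor_space)
  have ds: "\<delta> a + tensor_ad L brL a t \<in> tensor_space L L" if "a \<in> L" for a
    using that \<delta> ts by (simp add: dual_cobracket_def wedge2_tensor_space tensor_ad_tensor_space cv.subspace_add)
  have main: "pair w w' (\<delta> a + tensor_ad L brL a t) = F (\<iota> a) (br (w + \<iota> (?T w)) (w' + \<iota> (?T w')))"
    if a: "a \<in> L" and w: "w \<in> W" "w' \<in> W" for a w w'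
  proof -
    let ?a = "\<iota> a" and ?u = "\<iota> (?T w)" and ?v = "\<iota> (?T w')"
    have m: "?a \<in> R" "w \<in> R" "w' \<in> R" "?u \<in> R" "?v \<in> R" using a w TL W_R by (auto simp: R_closed)
    have "F ?a (br ?u ?v) = F (br ?a ?u) ?v" using F_inv m by simp
    also have "\<dots> = F (\<iota> (brL a (?T w))) ?v" using \<iota>_br a TL w by simp
    also have "\<dots> = 0" using \<iota>_iso a TL w by (simp add: L_closed)
    finally have 0: "F ?a (br ?u ?v) = 0" .
    have "pair w (br w' ?a) t = F (br w' ?a) ?u" using pair_contract[OF _ _ ts] m by (simp add: R_closed)
    also have "\<dots> = F w' (br ?a ?u)" using F_inv m by simp
    also have "\<dots> = F (br ?a ?u) w'" using F_sym m by (simp add: R_closed)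
    also have "\<dots> = F ?a (br ?u w')" using F_inv m by simp
    finally have 1: "pair w (br w' ?a) t = F ?a (br ?u w')" .
    have "pair (br w ?a) w' t = - pair w' (br w ?a) t" using pair_skew[OF _ m(3) t, of "br w ?a"] m by (simp add: R_closed)
    also have "\<dots> = - F (br w ?a) ?v" using pair_contract[OF _ _ ts] m by (simp add: R_closed)
    also have "\<dots> = - F w (br ?a ?v)" using F_inv m by simp
    also have "\<dots> = - F (br ?a ?v) w" using F_sym m by (simp add: R_closed)
    also have "\<dots> = - F ?a (br ?v w)" using F_inv m by simp
    also have "\<dots> = F ?a (br w ?v)" using br_skew[OF m(2,5)] m by (simp add: F_simps R_closed)
    finally have 2: "pair (br w ?a) w' t = F ?a (br w ?v)" .
    have "F ?a (br (w + ?u) (w' + ?v)) = F ?a (br w w') + F ?a (br w ?v) + (F ?a (br ?u w') + F ?a (br ?u ?v))"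
      using m by (simp add: br_simps F_simps R_closed)
    then show ?thesis using 0 1 2 p[OF a w] by simp
  qed
  show ?thesis
    unfolding G.dual_cobracket_def
  proof (intro ballI conjI)
    fix a assume a: "a \<in> L"
    \<comment> \<open>Passing from w to its graph point only adds an element of the isotropic image
      of L, which \<open>pair\<close> cannot see.\<close>
    have gp: "pair x x' s = pair w w' s" if "x = w + \<iota> (?T w)" "x' = w' + \<iota> (?T w')" "w \<in> W" "w' \<in> W" for x x' w w' s
      unfolding pair_def that(1,2) using that(3,4) TL W_R
      by (intro tensor_lift_cong) (simp add: F_simps R_closed \<iota>_iso)
    fix x x' assume "x \<in> graph t W" "x' \<in> graph t W"
    then obtain w w' where w: "x = w + \<iota> (?T w)" "x' = w' + \<iota> (?T w')" "w \<in> W" "w' \<in> W" by (auto simp: graph_def)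
    show "pair x x' (\<delta> a + tensor_ad L brL a t) = F (\<iota> a) (br x x')"
      using gp[OF w] main[OF a w(3,4)] w by simp
  next
    fix a assume a: "a \<in> L"
    show "\<delta> a + tensor_ad L brL a t \<in> wedge2 L"
    proof (rule wedge2I[OF ds[OF a]])
      fix w w' assume w: "w \<in> W" "w' \<in> W"
      let ?u = "w + \<iota> (?T w)" and ?v = "w' + \<iota> (?T w')"
      have "?u \<in> R" "?v \<in> R" using w TL W_R by (auto simp: R_closed)
      then show "pair w w' (\<delta> a + tensor_ad L brL a t) = - pair w' w (\<delta> a + tensor_ad L brL a t)"
        unfolding main[OF a w] main[OF a w(2,1)] using br_skew[of ?v ?u] a
        by (simp add: F_simps R_closed)
    qed
  qed
qed

text \<open>Equal graph points have equal W-components, since the image of L meets W trivially;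
  hence all contractions agree, and these determine the tensor.\<close>

lemma graph_inj:
  assumes "s \<in> wedge2 L" "t \<in> wedge2 L" "graph s W = graph t W"
  shows "s = t"
proof (rule tensor_eqI)
  show st: "s \<in> tensor_space L L" "t \<in> tensor_space L L" using assms by (auto intro: wedge2_tensor_space)
  fix w w' assume w: "w \<in> W" "w' \<in> W"
  have "w + \<iota> (contract w s) \<in> graph t W" using assms(3) w by (auto simp: graph_def)
  then obtain u where u: "w + \<iota> (contract w s) = u + \<iota> (contract u t)" "u \<in> W" by (auto simp: graph_def)
  have L: "contract w s \<in> L" "contract u t \<in> L" using contract_L W_R w u st by auto
  have "\<iota> (contract u t - contract w s) = w - u" using u(1) L by (simp add: \<iota>_simps algebra_simps)
  then have "contract u t - contract w s = 0" using W_Int[of "contract u t - contract w s"] W_closed w u L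
    by (simp add: L_closed)
  then have "u = w" "contract w s = contract u t" using u(1) by auto
  then show "pair w w' s = pair w w' t" using W_R w st by (simp add: pair_contract)
qed

text \<open>V is the graph of minus its own L-coordinate, restricted to W. Isotropy of V and W makes
  this map skew, and it vanishes on the intersection of V and W, which has finite codimension in
  W.\<close>

lemma ex_graph:
  assumes V: "lagrangian R br F L brL \<iota> V" and B: "finite B" "W \<subseteq> cv.span ((V \<inter> W) \<union> B)"
  shows "\<exists>t\<in>wedge2 L. V = graph t W"
proof -
  interpret V: lagrangian R br F L brL \<iota> V by (rule V)
  let ?T = "\<lambda>w. - V.cp w"
  have TL: "?T w \<in> L" "\<iota> (?T w) \<in> R" if "w \<in> W" for w using V.cp[OF W_R[OF that]] by (auto simp: L_closed R_closed)
  have TV: "w + \<iota> (?T w) \<in> V" if "w \<in> W" for w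
    using V.cp[OF W_R[OF that]] by (simp add: \<iota>_simps)
  have "\<exists>t\<in>wedge2 L. \<forall>w\<in>W. contract w t = ?T w"
  proof (rule ex_skew_tensor[OF _ TL(1) _ B(1) _ B(2)])
    show "linear_on W ?T"
      using W_R by (intro linear_onI) (simp_all add: linear_on_add[OF V.cp_linear] linear_on_scale[OF V.cp_linear])
    fix w w' assume w: "w \<in> W" "w' \<in> W"
    have "0 = F (w + \<iota> (?T w)) (w' + \<iota> (?T w'))" using TV w V.W_iso by simp
    also have "\<dots> = F w w' + P w (?T w') + (F (\<iota> (?T w)) w' + F (\<iota> (?T w)) (\<iota> (?T w')))"
      using w TL W_R
      by (simp only: linear_on_add[OF F_linear(1)] linear_on_add[OF F_linear(2)] R_closed add_ac)
    also have "\<dots> = P w (?T w') + P w' (?T w)" using W_iso[OF w] \<iota>_iso[OF TL(1)[OF w(1)] TL(1)[OF w(2)]]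
        F_sym[OF TL(2)[OF w(1)] W_R[OF w(2)]] by simp
    finally show "P w' (?T w) = - P w (?T w')" by (simp add: eq_neg_iff_add_eq_0 add.commute)
  next
    show "?T u = 0" if "u \<in> V \<inter> W" for u
      using V.cp_eqI[of 0 u] that by (simp add: L_closed \<iota>_simps)
  qed simp_all
  then obtain t where t: "t \<in> wedge2 L" "\<And>w. w \<in> W \<Longrightarrow> contract w t = ?T w" by blast
  have "V \<subseteq> graph t W"
  proof
    fix v assume v: "v \<in> V"
    let ?w = "wp v"
    have vR: "v \<in> R" using v V.W_R by simp
    have w: "?w \<in> W" "cp v \<in> L" using cp[OF vR] by auto
    have "V.cp ?w = - cp v"
      by (rule V.cp_eqI) (use w v in \<open>simp_all add: L_closed \<iota>_simps\<close>)
    then have "v = ?w + \<iota> (contract ?w t)" using t(2)[OF w(1)] by simp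
    then show "v \<in> graph t W" using w(1) unfolding graph_def by blast
  qed
  moreover have "graph t W \<subseteq> V" using TV t(2) by (auto simp: graph_def)
  ultimately show ?thesis using t(1) by blast
qed

end

section \<open>Brackets and forms of formal series\<close>

definition vanishes_below :: "int \<Rightarrow> (int \<Rightarrow> 'a::zero) \<Rightarrow> bool" where
  "vanishes_below n f \<longleftrightarrow> (\<forall>k<n. f k = 0)"

lemma scaleC_apply: "(c *\<^sub>C f) k = c *\<^sub>C f k"
  by (simp add: scaleC_fun_def)

lemma vanishes_below_mono: "vanishes_below n f \<Longrightarrow> k \<le> n \<Longrightarrow> vanishes_below k f"
  by (simp add: vanishes_below_def)

lemma vanishes_below_add:
  "vanishes_below n f \<Longrightarrow> vanishes_below n g \<Longrightarrow> vanishes_below n (f + g :: int \<Rightarrow> 'a::monoid_add)"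
  by (simp add: vanishes_below_def)

lemma vanishes_below_scale: "vanishes_below n f \<Longrightarrow> vanishes_below n (c *\<^sub>C f)"
  by (simp add: vanishes_below_def scaleC_fun_def)

text \<open>Pairs (i, j) such that i, j and the third index n - i - j are all at least a. The
  condition is symmetric in the three indices, so cyclic rotations act on sums of triple
  products.\<close>

definition triangle :: "int \<Rightarrow> int \<Rightarrow> (int \<times> int) set" where
  "triangle a n = {(i, j). a \<le> i \<and> a \<le> j \<and> i + j \<le> n - a}"

lemma triangle_Sigma: "triangle a n = (SIGMA i:{a..n - (a + a)}. {a..n - i - a})"
  by (auto simp: triangle_def)

lemma sum_triangle_rotate:
  "(\<Sum>(i, j)\<in>triangle a n. \<phi> j (n - i - j) i) = (\<Sum>(i, j)\<in>triangle a n. \<phi> i j (n - i - j))"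
  by (rule sum.reindex_bij_witness[where i = "\<lambda>(i, j). (n - i - j, i)" and j = "\<lambda>(i, j). (j, n - i - j)"])
    (auto simp: triangle_def)

lemma double_eq_zero:
  fixes x :: "'a::complex_vector"
  assumes "x = - x"
  shows "x = 0"
proof -
  have "(2::complex) *\<^sub>C x = x + x"
    using cv.scale_left_distrib[of 1 1 x] by simp
  also have "\<dots> = 0" using assms by (metis add.right_inverse)
  finally show ?thesis by simp
qed

context finite_dim_lie_algebra
begin

lemmas killing_linear = bilinear_onD(1)[OF killing_bilinear UNIV_I] bilinear_onD(2)[OF killing_bilinear UNIV_I]

lemmas killing_simps = linear_on_add[OF killing_linear(1)] linear_on_add[OF killing_linear(2)]
  linear_on_scale[OF killing_linear(1)] linear_on_scale[OF killing_linear(2)]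
  linear_on_zero[OF killing_linear(1)] linear_on_zero[OF killing_linear(2)]

lemma killing_neg: "\<kappa> (- x) y = - \<kappa> x y" "\<kappa> x (- y) = - \<kappa> x y"
  by (simp_all add: linear_on_neg[OF killing_linear(1)] linear_on_neg[OF killing_linear(2)])

text \<open>Replaces the support, which varies with the series, by a fixed interval, so that sums
  for different series can be combined termwise.\<close>

lemma series_bracket_eq:
  assumes "vanishes_below a f" "vanishes_below b g"
  shows "series_bracket br f g n = (\<Sum>k\<in>{a..n - b}. br (f k) (g (n - k)))"
  unfolding series_bracket_def
proof (rule sum.mono_neutral_left)
  show "{k. f k \<noteq> 0 \<and> g (n - k) \<noteq> 0} \<subseteq> {a..n - b}"
    using assms by (force simp: vanishes_below_def not_less[symmetric])
qed (auto simp: br_simps)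

lemma series_form_eq:
  assumes "vanishes_below a f" "vanishes_below b g"
  shows "series_form br f g = (\<Sum>k\<in>{a..- b}. \<kappa> (f k) (g (- k)))"
  unfolding series_form_def
proof (rule sum.mono_neutral_left)
  show "{k. f k \<noteq> 0 \<and> g (- k) \<noteq> 0} \<subseteq> {a..- b}"
    using assms by (force simp: vanishes_below_def not_less[symmetric])
qed (auto simp: killing_simps)

lemma series_bracket_vanishes:
  assumes "vanishes_below a f" "vanishes_below b g"
  shows "vanishes_below (a + b) (series_bracket br f g)"
  unfolding vanishes_below_def by (simp add: series_bracket_eq[OF assms])

lemma series_bracket_add:
  assumes f: "vanishes_below a f" "vanishes_below a f'" and g: "vanishes_below a g"
  shows "series_bracket br (f + f') g = series_bracket br f g + series_bracket br f' g"
    "series_bracket br g (f + f') = series_bracket br g f + series_bracket br g f'"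
  by (rule ext, simp add: series_bracket_eq[of a _ a] vanishes_below_add assms br_simps sum.distrib)+

lemma series_bracket_scale:
  assumes "vanishes_below a f" "vanishes_below a g"
  shows "series_bracket br (c *\<^sub>C f) g = c *\<^sub>C series_bracket br f g"
    "series_bracket br g (c *\<^sub>C f) = c *\<^sub>C series_bracket br g f"
  by (rule ext, simp add: series_bracket_eq[of a _ a] vanishes_below_scale assms
      br_simps scaleC_apply cv.scale_sum_right)+

lemma series_form_add:
  assumes f: "vanishes_below a f" "vanishes_below a f'" and g: "vanishes_below a g"
  shows "series_form br (f + f') g = series_form br f g + series_form br f' g"
    "series_form br g (f + f') = series_form br g f + series_form br g f'"
  by (simp_all add: series_form_eq[of a _ a] vanishes_below_add assms killing_simps sum.distrib)

lemma series_form_scale: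
  assumes "vanishes_below a f" "vanishes_below a g"
  shows "series_form br (c *\<^sub>C f) g = c * series_form br f g"
    "series_form br g (c *\<^sub>C f) = c * series_form br g f"
  by (simp_all add: series_form_eq[of a _ a] vanishes_below_scale assms
      killing_simps scaleC_apply sum_distrib_left scaleC_complex_def)

lemma series_bracket_self:
  assumes "vanishes_below a f"
  shows "series_bracket br f f = 0"
proof
  fix n
  have "(\<Sum>k\<in>{a..n - a}. br (f k) (f (n - k))) = (\<Sum>k\<in>{a..n - a}. br (f (n - k)) (f k))"
    by (rule sum.reindex_bij_witness[of _ "\<lambda>k. n - k" "\<lambda>k. n - k"]) auto
  also have "\<dots> = - (\<Sum>k\<in>{a..n - a}. br (f k) (f (n - k)))"
    unfolding sum_negf[symmetric] by (rule sum.cong[OF refl]) (rule br_skew)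
  finally have "(\<Sum>k\<in>{a..n - a}. br (f k) (f (n - k))) = 0" by (rule double_eq_zero)
  then show "series_bracket br f f n = 0 n" by (simp add: series_bracket_eq[OF assms assms])
qed

lemma series_bracket_bracket:
  assumes "vanishes_below a f" "vanishes_below a g" "vanishes_below a h"
  shows "series_bracket br f (series_bracket br g h) n =
    (\<Sum>(i, j)\<in>triangle a n. br (f i) (br (g j) (h (n - i - j))))"
  unfolding series_bracket_eq[OF assms(1) series_bracket_vanishes[OF assms(2,3)]]
    series_bracket_eq[OF assms(2,3)]
  by (simp add: linear_on_sum[OF br_linear_right] sum.Sigma triangle_Sigma)

text \<open>Rotating indices brings the three double sums to the same summation variables, where
  Jacobi holds termwise.\<close>

lemma series_jacobi:
  assumes v: "vanishes_below a f" "vanishes_below a g" "vanishes_below a h"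
  shows "series_bracket br f (series_bracket br g h) + series_bracket br g (series_bracket br h f) +
    series_bracket br h (series_bracket br f g) = 0"
proof
  fix n
  have 1: "series_bracket br g (series_bracket br h f) n =
      (\<Sum>(i, j)\<in>triangle a n. br (g j) (br (h (n - i - j)) (f i)))"
    unfolding series_bracket_bracket[OF v(2,3,1)]
    by (rule sum_triangle_rotate[symmetric, where \<phi> = "\<lambda>i j k. br (g i) (br (h j) (f k))"])
  have "series_bracket br h (series_bracket br f g) n =
      (\<Sum>(i, j)\<in>triangle a n. br (h j) (br (f (n - i - j)) (g i)))"
    unfolding series_bracket_bracket[OF v(3,1,2)]
    by (rule sum_triangle_rotate[symmetric, where \<phi> = "\<lambda>i j k. br (h i) (br (f j) (g k))"])
  also have "\<dots> = (\<Sum>(i, j)\<in>triangle a n. br (h (n - i - j)) (br (f i) (g j)))"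
    by (rule sum_triangle_rotate[symmetric, where \<phi> = "\<lambda>i j k. br (h j) (br (f k) (g i))"])
  finally have 2: "series_bracket br h (series_bracket br f g) n =
      (\<Sum>(i, j)\<in>triangle a n. br (h (n - i - j)) (br (f i) (g j)))" .
  show "(series_bracket br f (series_bracket br g h) + series_bracket br g (series_bracket br h f) +
      series_bracket br h (series_bracket br f g)) n = 0 n"
    unfolding plus_fun_apply 1 2 series_bracket_bracket[OF v]
    by (simp add: sum.distrib[symmetric] case_prod_beta jacobi)
qed

lemma series_form_sym: "series_form br f g = series_form br g f"
  unfolding series_form_def
  by (rule sum.reindex_bij_witness[of _ uminus uminus]) (auto simp: killing_sym)

lemma series_form_bracket:
  assumes "vanishes_below a f" "vanishes_below a g" "vanishes_below a h"
  shows "series_form br f (series_bracket br g h) =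
    (\<Sum>(i, j)\<in>triangle a 0. \<kappa> (f i) (br (g j) (h (0 - i - j))))"
  unfolding series_form_eq[OF assms(1) series_bracket_vanishes[OF assms(2,3)]]
    series_bracket_eq[OF assms(2,3)]
  by (simp add: linear_on_sum[OF killing_linear(1)] sum.Sigma triangle_Sigma)

lemma series_form_invariant:
  assumes v: "vanishes_below a f" "vanishes_below a g" "vanishes_below a h"
  shows "series_form br (series_bracket br f g) h = series_form br f (series_bracket br g h)"
proof -
  have "series_form br (series_bracket br f g) h =
      (\<Sum>(i, j)\<in>triangle a 0. \<kappa> (h i) (br (f j) (g (0 - i - j))))"
    unfolding series_form_sym[of _ h] by (rule series_form_bracket[OF v(3,1,2)])
  also have "\<dots> = (\<Sum>(i, j)\<in>triangle a 0. \<kappa> (f j) (br (g (0 - i - j)) (h i)))"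
    by (rule sum.cong[OF refl]) (simp add: case_prod_beta killing_invariant[symmetric] killing_sym)
  also have "\<dots> = (\<Sum>(i, j)\<in>triangle a 0. \<kappa> (f i) (br (g j) (h (0 - i - j))))"
    by (rule sum_triangle_rotate[where \<phi> = "\<lambda>i j k. \<kappa> (f i) (br (g j) (h k))"])
  finally show ?thesis unfolding series_form_bracket[OF v] .
qed

lemma dagger_bracket: "dagger (series_bracket br f g) = series_bracket br (dagger f) (dagger g)"
  unfolding series_bracket_def dagger_def fun_eq_iff
  by (intro allI sum.reindex_bij_witness[of _ uminus uminus]) (auto simp: minus_diff_commute)

lemma series_form_dagger: "series_form br (dagger f) (dagger g) = series_form br f g"
  unfolding series_form_def dagger_def
  by (rule sum.reindex_bij_witness[of _ uminus uminus]) auto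

end

lemma finite_support_vanishes:
  assumes "finite {k. f k \<noteq> (0::'a::zero)}"
  shows "\<exists>n. vanishes_below n (f :: int \<Rightarrow> 'a)"
proof (cases "{k. f k \<noteq> 0} = {}")
  case False
  then have "vanishes_below (Min {k. f k \<noteq> 0}) f"
    using assms by (auto simp: vanishes_below_def dest: Min_le[rotated])
  then show ?thesis by blast
qed (auto simp: vanishes_below_def)

lemma loop_space_subset: "loop_space G \<subseteq> completed_loop_space G"
  unfolding loop_space_def completed_loop_space_def
  using finite_support_vanishes by (auto simp: vanishes_below_def)

lemma completed_loop_space_iff: "f \<in> completed_loop_space G \<longleftrightarrow> (\<forall>k. f k \<in> G k) \<and> (\<exists>n. vanishes_below n f)"
  by (auto simp: completed_loop_space_def vanishes_below_def)

lemma subspace_loop_space: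
  assumes "\<And>k. cv.subspace (G k)"
  shows "cv.subspace (loop_space G)"
proof (rule cv.subspaceI)
  fix f g c assume fg: "f \<in> loop_space G" "g \<in> loop_space G"
  have "{k. (f + g) k \<noteq> 0} \<subseteq> {k. f k \<noteq> 0} \<union> {k. g k \<noteq> 0}" "{k. (c *\<^sub>C f) k \<noteq> 0} \<subseteq> {k. f k \<noteq> 0}"
    by (auto simp: scaleC_fun_def)
  then have "finite {k. (f + g) k \<noteq> 0}" "finite {k. (c *\<^sub>C f) k \<noteq> 0}"
    using fg by (auto simp: loop_space_def intro: finite_subset)
  then show "f + g \<in> loop_space G" "c *\<^sub>C f \<in> loop_space G"
    using fg assms by (simp_all add: loop_space_def scaleC_fun_def cv.subspace_add cv.subspace_scale)
qed (use assms in \<open>simp add: loop_space_def cv.subspace_0\<close>)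

lemma subspace_completed_loop_space:
  assumes "\<And>k. cv.subspace (G k)"
  shows "cv.subspace (completed_loop_space G)"
proof (rule cv.subspaceI)
  fix f g c assume fg: "f \<in> completed_loop_space G" "g \<in> completed_loop_space G"
  then obtain a b where "vanishes_below a f" "vanishes_below b g" by (auto simp: completed_loop_space_iff)
  then have "vanishes_below (min a b) (f + g)" "vanishes_below a (c *\<^sub>C f)"
    by (auto intro!: vanishes_below_add vanishes_below_scale elim: vanishes_below_mono)
  then show "f + g \<in> completed_loop_space G" "c *\<^sub>C f \<in> completed_loop_space G"
    using fg assms
    by (auto simp: completed_loop_space_iff scaleC_fun_def cv.subspace_add cv.subspace_scale simp del: plus_fun_apply)
      (auto simp: cv.subspace_add)
qed (use assms in \<open>auto simp: completed_loop_space_def cv.subspace_0\<close>)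

definition monomial :: "int \<Rightarrow> 'a::zero \<Rightarrow> int \<Rightarrow> 'a" where
  "monomial k a = (\<lambda>j. if j = k then a else 0)"

lemma monomial_loop_space:
  assumes "\<And>k. cv.subspace (G k)" "a \<in> G k"
  shows "monomial k a \<in> loop_space G"
proof -
  have "{j. monomial k a j \<noteq> 0} \<subseteq> {k}" by (auto simp: monomial_def)
  then have "finite {j. monomial k a j \<noteq> 0}" by (rule finite_subset) simp
  then show ?thesis using assms by (auto simp: loop_space_def monomial_def cv.subspace_0)
qed

lemma (in finite_dim_lie_algebra) series_form_monomial: "series_form br f (monomial k b) = \<kappa> (f (- k)) b"
proof -
  have "series_form br f (monomial k b) = (\<Sum>j\<in>{- k}. \<kappa> (f j) (monomial k b (- j)))"
    unfolding series_form_def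
    by (rule sum.mono_neutral_left) (auto simp: monomial_def killing_simps split: if_splits)
  then show ?thesis by (simp add: monomial_def)
qed

section \<open>Twisted loop algebras\<close>

locale twisted_loop = simple_lie br for br :: "'g::complex_vector \<Rightarrow> 'g \<Rightarrow> 'g" +
  fixes \<sigma> :: "'g \<Rightarrow> 'g" and m :: nat and np h nm :: "'g set"
  assumes aut: "lie_automorphism br \<sigma>" and order: "has_order \<sigma> m"
    and tri: "triangular_decomposition (eigen_grade \<sigma> m 0) br np h nm"
begin

definition \<epsilon> :: complex where "\<epsilon> = exp (2 * pi * \<i> / of_nat m)"
abbreviation G :: "int \<Rightarrow> 'g set" where "G \<equiv> eigen_grade \<sigma> m"

lemma m_pos: "0 < m" using order by (simp add: has_order_def)

lemma \<sigma>_linear: "linear_on UNIV \<sigma>" and \<sigma>_br: "\<sigma> (br x y) = br (\<sigma> x) (\<sigma> y)"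
  using aut by (auto simp: lie_automorphism_def)

lemma \<epsilon>_nonzero [simp]: "\<epsilon> \<noteq> 0"
  by (simp add: \<epsilon>_def)

lemma \<epsilon>_power: "\<epsilon> ^ j = cis (2 * pi * real j / real m)"
proof -
  have "\<epsilon> = cis (2 * pi / real m)" by (simp add: \<epsilon>_def cis_conv_exp mult.commute)
  then show ?thesis by (simp add: DeMoivre mult.commute mult.left_commute)
qed

lemma \<epsilon>_power_m: "\<epsilon> ^ m = 1"
  using m_pos by (simp add: \<epsilon>_power)

lemma \<epsilon>_power_ne_1: "0 < j \<Longrightarrow> j < m \<Longrightarrow> \<epsilon> ^ j \<noteq> 1"
proof
  assume j: "0 < j" "j < m" "\<epsilon> ^ j = 1"
  have "inj_on (\<lambda>k. cis (2 * pi * real k / real m)) {..<m}"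
    using bij_betw_roots_unity[OF m_pos] by (simp add: bij_betw_def)
  then have "j = 0" using j m_pos by (auto simp: inj_on_def \<epsilon>_power dest!: bspec[where x = 0] bspec[where x = j])
  then show False using j by simp
qed

lemma G_iff: "a \<in> G k \<longleftrightarrow> \<sigma> a = (\<epsilon> powi k) *\<^sub>C a"
  by (simp add: eigen_grade_def \<epsilon>_def)

lemma G_subspace: "cv.subspace (G k)"
  by (rule cv.subspaceI)
    (simp_all add: G_iff linear_on_zero[OF \<sigma>_linear] linear_on_add[OF \<sigma>_linear] linear_on_scale[OF \<sigma>_linear]
      cv.scale_right_distrib mult.commute)

lemma G_br: "a \<in> G k \<Longrightarrow> b \<in> G l \<Longrightarrow> br a b \<in> G (k + l)"
  by (simp add: G_iff \<sigma>_br br_simps power_int_add mult.commute)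

lemma G_period: "G (k + int m * j) = G k"
proof -
  have "\<epsilon> powi (int m * j) = 1" by (simp add: power_int_mult \<epsilon>_power_m)
  then show ?thesis by (auto simp: G_iff power_int_add)
qed

text \<open>Averaging over the powers of \<sigma> against a character of the cyclic group of order
  m.\<close>

definition grade_proj :: "nat \<Rightarrow> 'g \<Rightarrow> 'g" where
  "grade_proj k a = (1 / of_nat m) *\<^sub>C (\<Sum>j<m. (\<epsilon> powi (- int (j * k))) *\<^sub>C (\<sigma> ^^ j) a)"

lemma grade_proj_G: "grade_proj k a \<in> G (int k)"
proof -
  let ?f = "\<lambda>j. (\<epsilon> powi (- int (j * k))) *\<^sub>C (\<sigma> ^^ j) a"
  have f: "\<sigma> (?f j) = (\<epsilon> powi (int k)) *\<^sub>C ?f (Suc j)" for j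
  proof -
    have e: "- int (j * k) = int k + - int (Suc j * k)" by (simp add: algebra_simps)
    have "\<epsilon> powi (- int (j * k)) = \<epsilon> powi (int k) * \<epsilon> powi (- int (Suc j * k))"
      by (subst e, rule power_int_add) simp
    then show ?thesis by (simp add: linear_on_scale[OF \<sigma>_linear])
  qed
  have "\<epsilon> powi (- int (m * k)) = 1"
    by (simp only: power_int_minus power_int_of_nat power_mult \<epsilon>_power_m power_one inverse_1)
  \<comment> \<open>The sum runs over a full period, so shifting its index by one does not change
    it.\<close>
  then have "?f m = ?f 0" using order by (simp add: has_order_def del: of_nat_mult)
  then have s: "(\<Sum>j<m. ?f (Suc j)) = (\<Sum>j<m. ?f j)"
    using sum.lessThan_Suc_shift[of ?f m] by simp
  have "\<sigma> (\<Sum>j<m. ?f j) = (\<Sum>j<m. \<sigma> (?f j))" by (simp add: linear_on_sum[OF \<sigma>_linear])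
  also have "\<dots> = (\<epsilon> powi (int k)) *\<^sub>C (\<Sum>j<m. ?f (Suc j))" by (simp only: f cv.scale_sum_right)
  finally have "\<sigma> (\<Sum>j<m. ?f j) = (\<epsilon> powi (int k)) *\<^sub>C (\<Sum>j<m. ?f j)" unfolding s .
  then show ?thesis unfolding G_iff grade_proj_def
    by (simp add: linear_on_scale[OF \<sigma>_linear] mult.commute)
qed

text \<open>Character orthogonality: summing over k kills every power of \<sigma> except the
  zeroth.\<close>

lemma sum_grade_proj: "(\<Sum>k<m. grade_proj k a) = a"
proof -
  have g: "(\<Sum>k<m. \<epsilon> powi (- int (j * k))) = (if j = 0 then of_nat m else 0)" if "j < m" for j
  proof (cases "j = 0")
    case False
    let ?w = "inverse (\<epsilon> ^ j)"
    have "?w \<noteq> 1" using \<epsilon>_power_ne_1[of j] False that by simp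
    moreover have "?w ^ m = 1"
      by (metis \<epsilon>_power_m inverse_1 mult.commute power_inverse power_mult power_one)
    moreover have "\<epsilon> powi (- int (j * k)) = ?w ^ k" for k
      by (simp only: power_int_minus power_int_of_nat power_mult power_inverse)
    ultimately show ?thesis using False by (simp add: geometric_sum del: of_nat_mult)
  qed simp
  have "(\<Sum>k<m. grade_proj k a) = (1 / of_nat m) *\<^sub>C (\<Sum>j<m. (\<Sum>k<m. \<epsilon> powi (- int (j * k))) *\<^sub>C (\<sigma> ^^ j) a)"
    unfolding grade_proj_def cv.scale_sum_right[symmetric] cv.scale_sum_left
    by (subst sum.swap) simp
  also have "(\<Sum>j<m. (\<Sum>k<m. \<epsilon> powi (- int (j * k))) *\<^sub>C (\<sigma> ^^ j) a) = (\<Sum>j<m. if j = 0 then of_nat m *\<^sub>C a else 0)"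
  proof (rule sum.cong[OF refl])
    fix j assume "j \<in> {..<m}"
    then show "(\<Sum>k<m. \<epsilon> powi (- int (j * k))) *\<^sub>C (\<sigma> ^^ j) a = (if j = 0 then of_nat m *\<^sub>C a else 0)"
      using g[of j] by (cases "j = 0") (simp_all del: of_nat_mult)
  qed
  finally show ?thesis using m_pos by simp
qed

text \<open>The m eigenspaces span, and by periodicity each of them reappears in degrees beyond any
  bound K.\<close>

lemma span_G_above: "cv.span (\<Union>k\<in>{K..}. G k) = UNIV"
proof -
  have "a \<in> cv.span (\<Union>k\<in>{K..}. G k)" for a
  proof -
    have "grade_proj k a \<in> cv.span (\<Union>k\<in>{K..}. G k)" for k
    proof (rule cv.span_base)
      have "int m * \<bar>K\<bar> \<ge> 1 * \<bar>K\<bar>" using m_pos by (intro mult_right_mono) auto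
      then have "K \<le> int k + int m * \<bar>K\<bar>" by linarith
      moreover have "grade_proj k a \<in> G (int k + int m * \<bar>K\<bar>)" using grade_proj_G G_period by simp
      ultimately show "grade_proj k a \<in> (\<Union>k\<in>{K..}. G k)" by auto
    qed
    then have "(\<Sum>k<m. grade_proj k a) \<in> cv.span (\<Union>k\<in>{K..}. G k)" by (rule cv.span_sum)
    then show ?thesis by (simp only: sum_grade_proj)
  qed
  then show ?thesis by auto
qed

text \<open>\<sigma> preserves \<kappa>, so \<open>G k\<close> and \<open>G l\<close> are orthogonal
  unless k + l is 0 modulo m, and then \<open>G l\<close> is \<open>G (- k)\<close>.\<close>

lemma killing_nondegenerate_graded:
  assumes x: "x \<in> G k" and z: "\<And>b. b \<in> G (- k) \<Longrightarrow> \<kappa> x b = 0"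
  shows "x = 0"
proof (rule killing_nondegenerate)
  fix y
  have "(\<Union>l\<in>{0..}. G l) \<subseteq> {y. \<kappa> x y = 0}"
  proof safe
    fix l b assume b: "b \<in> G l"
    have "\<kappa> x b = \<kappa> (\<sigma> x) (\<sigma> b)" by (simp add: killing_automorphism[OF aut])
    also have "\<dots> = \<epsilon> powi (k + l) * \<kappa> x b"
      using x b by (simp add: G_iff killing_simps scaleC_complex_def power_int_add)
    finally have "\<epsilon> powi (k + l) = 1 \<or> \<kappa> x b = 0" by auto
    moreover have "\<kappa> x b = 0" if "\<epsilon> powi (k + l) = 1"
    proof -
      have "\<epsilon> powi l = \<epsilon> powi (- k) * \<epsilon> powi (k + l)"
        using power_int_add[of \<epsilon> "- k" "k + l"] by simp
      then have "\<epsilon> powi l = \<epsilon> powi (- k)" using that by simp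
      then have "b \<in> G (- k)" using b by (simp add: G_iff)
      then show ?thesis by (rule z)
    qed
    ultimately show "\<kappa> x b = 0" by blast
  qed
  moreover have "cv.subspace {y. \<kappa> x y = 0}"
    by (rule cv.subspaceI) (simp_all add: killing_simps)
  ultimately show "\<kappa> x y = 0"
    using mem_subspace_if_spanning[OF span_G_above[of 0], of "{y. \<kappa> x y = 0}" y] by simp
qed

lemma central_above:
  assumes "\<And>k v. k \<ge> K \<Longrightarrow> v \<in> G k \<Longrightarrow> br v x = 0"
  shows "x = 0"
proof (rule centre_trivial)
  fix y
  have "cv.subspace {v. br v x = 0}" by (rule cv.subspaceI) (simp_all add: br_simps)
  moreover have "(\<Union>k\<in>{K..}. G k) \<subseteq> {v. br v x = 0}" using assms by auto
  ultimately show "br y x = 0"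
    using mem_subspace_if_spanning[OF span_G_above[of K], of "{v. br v x = 0}" y] by simp
qed


section \<open>The loop double, its completion and the filtration by degree\<close>

abbreviation L :: "'g series set" where "L \<equiv> loop_algebra \<sigma> m"
abbreviation brL :: "'g series \<Rightarrow> 'g series \<Rightarrow> 'g series" where "brL \<equiv> series_bracket br"
abbreviation D :: "('g series \<times> 'g series) set" where "D \<equiv> loop_double \<sigma> m"
abbreviation DC :: "('g series \<times> 'g series) set" where "DC \<equiv> completed_loop_double \<sigma> m"
abbreviation brD :: "'g series \<times> 'g series \<Rightarrow> 'g series \<times> 'g series \<Rightarrow> 'g series \<times> 'g series" where
  "brD \<equiv> loop_double_bracket br"
abbreviation F :: "'g series \<times> 'g series \<Rightarrow> 'g series \<times> 'g series \<Rightarrow> complex" where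
  "F \<equiv> loop_double_form br"

definition low :: "int \<Rightarrow> 'g series \<times> 'g series \<Rightarrow> bool" where
  "low n x \<longleftrightarrow> vanishes_below n (fst x) \<and> vanishes_below n (snd x)"

lemma low_mono: "low n x \<Longrightarrow> k \<le> n \<Longrightarrow> low k x"
  by (auto simp: low_def elim: vanishes_below_mono)

lemma low_add: "low n x \<Longrightarrow> low n y \<Longrightarrow> low n (x + y)"
  by (simp add: low_def vanishes_below_add)

lemma low_scale: "low n x \<Longrightarrow> low n (c *\<^sub>C x)"
  by (simp add: low_def vanishes_below_scale scaleC_prod_def)

lemma low_minus: "low n x \<Longrightarrow> low n y \<Longrightarrow> low n (x - y)"
  by (simp add: low_def vanishes_below_def)

lemma DC_iff: "x \<in> DC \<longleftrightarrow> (\<forall>k. fst x k \<in> G k \<and> snd x k \<in> G (- k)) \<and> (\<exists>n. low n x)"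
proof
  assume x: "x \<in> DC"
  then obtain a b where "vanishes_below a (fst x)" "vanishes_below b (snd x)"
    by (auto simp: completed_loop_double_def completed_loop_space_iff)
  then have "low (min a b) x" by (auto simp: low_def elim: vanishes_below_mono)
  then show "(\<forall>k. fst x k \<in> G k \<and> snd x k \<in> G (- k)) \<and> (\<exists>n. low n x)"
    using x by (auto simp: completed_loop_double_def completed_loop_space_iff)
qed (auto simp: completed_loop_double_def completed_loop_space_iff low_def mem_Times_iff)

lemma D_iff: "x \<in> D \<longleftrightarrow> (\<forall>k. fst x k \<in> G k \<and> snd x k \<in> G (- k)) \<and>
    finite {k. fst x k \<noteq> 0} \<and> finite {k. snd x k \<noteq> 0}"
  by (auto simp: loop_double_def loop_space_def mem_Times_iff)

lemma L_iff: "f \<in> L \<longleftrightarrow> (\<forall>k. f k \<in> G k) \<and> finite {k. f k \<noteq> 0}"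
  by (auto simp: loop_algebra_def loop_space_def)

lemma D_DC: "D \<subseteq> DC"
  unfolding loop_double_def completed_loop_double_def
  using loop_space_subset by blast

lemma subspace_Times: "cv.subspace A \<Longrightarrow> cv.subspace B \<Longrightarrow> cv.subspace (A \<times> B)"
  by (rule cv.subspaceI) (auto simp: zero_prod_def scaleC_prod_def cv.subspace_0 cv.subspace_add cv.subspace_scale)

lemma DC_subspace: "cv.subspace DC" and D_subspace: "cv.subspace D" and L_subspace: "cv.subspace L"
  unfolding completed_loop_double_def loop_double_def loop_algebra_def
  by (intro subspace_Times subspace_completed_loop_space subspace_loop_space G_subspace)+

lemma common_low:
  assumes "x \<in> DC" "y \<in> DC" "z \<in> DC"
  obtains n where "low n x" "low n y" "low n z"
proof -
  obtain a b c where "low a x" "low b y" "low c z" using assms by (auto simp: DC_iff)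
  then show ?thesis using that[of "min a (min b c)"] low_mono by (metis min.cobounded1 min.cobounded2 min.coboundedI2)
qed

lemma brD_low: "low a x \<Longrightarrow> low b y \<Longrightarrow> low (a + b) (brD x y)"
  by (simp add: low_def loop_double_bracket_def series_bracket_vanishes)

text \<open>F only pairs coefficients whose degrees add up to 0.\<close>

lemma F_low: "low a x \<Longrightarrow> low b y \<Longrightarrow> 0 < a + b \<Longrightarrow> F x y = 0"
  by (simp add: low_def loop_double_form_def series_form_eq[of a _ b])

lemma brD_add:
  assumes "low n x" "low n x'" "low n y"
  shows "brD (x + x') y = brD x y + brD x' y" "brD y (x + x') = brD y x + brD y x'"
  using assms by (simp_all add: low_def loop_double_bracket_def series_bracket_add[of n])

lemma brD_scale:
  assumes "low n x" "low n y"
  shows "brD (c *\<^sub>C x) y = c *\<^sub>C brD x y" "brD y (c *\<^sub>C x) = c *\<^sub>C brD y x"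
  using assms by (simp_all add: low_def loop_double_bracket_def series_bracket_scale[of n] scaleC_prod_def)

lemma F_add:
  assumes "low n x" "low n x'" "low n y"
  shows "F (x + x') y = F x y + F x' y" "F y (x + x') = F y x + F y x'"
  using assms by (simp_all add: low_def loop_double_form_def series_form_add[of n] algebra_simps)

lemma F_scale:
  assumes "low n x" "low n y"
  shows "F (c *\<^sub>C x) y = c * F x y" "F y (c *\<^sub>C x) = c * F y x"
  using assms by (simp_all add: low_def loop_double_form_def series_form_scale[of n] scaleC_prod_def algebra_simps)

lemma bilinear_on_DC:
  fixes \<beta> :: "'g series \<times> 'g series \<Rightarrow> 'g series \<times> 'g series \<Rightarrow> 'c::complex_vector"
  assumes "\<And>n x x' y. low n x \<Longrightarrow> low n x' \<Longrightarrow> low n y \<Longrightarrow>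
      \<beta> (x + x') y = \<beta> x y + \<beta> x' y \<and> \<beta> y (x + x') = \<beta> y x + \<beta> y x'"
    and "\<And>n x y c. low n x \<Longrightarrow> low n y \<Longrightarrow> \<beta> (c *\<^sub>C x) y = c *\<^sub>C \<beta> x y \<and> \<beta> y (c *\<^sub>C x) = c *\<^sub>C \<beta> y x"
  shows "bilinear_on DC DC \<beta>"
proof -
  have 1: "\<beta> (x + x') y = \<beta> x y + \<beta> x' y \<and> \<beta> y (x + x') = \<beta> y x + \<beta> y x'"
    if xy: "x \<in> DC" "x' \<in> DC" "y \<in> DC" for x x' y
  proof -
    obtain n where "low n x" "low n x'" "low n y" using common_low[OF xy] by blast
    then show ?thesis by (rule assms(1))
  qed
  have 2: "\<beta> (c *\<^sub>C x) y = c *\<^sub>C \<beta> x y \<and> \<beta> y (c *\<^sub>C x) = c *\<^sub>C \<beta> y x"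
    if xy: "x \<in> DC" "y \<in> DC" for x y c
  proof -
    obtain n where "low n x" "low n y" using common_low[OF xy xy(2)] by blast
    then show ?thesis by (rule assms(2))
  qed
  show ?thesis unfolding bilinear_on_def linear_on_def using 1 2 by blast
qed

lemma series_bracket_grade:
  assumes "\<And>k. f k \<in> H k" "\<And>k. g k \<in> H k" "\<And>k. cv.subspace (H k)"
    and "\<And>a b k l. a \<in> H k \<Longrightarrow> b \<in> H l \<Longrightarrow> br a b \<in> H (k + l)"
  shows "series_bracket br f g n \<in> H n"
  unfolding series_bracket_def
proof (rule cv.subspace_sum[OF assms(3)])
  fix k show "br (f k) (g (n - k)) \<in> H n" using assms(4)[of "f k" k "g (n - k)" "n - k"] assms(1,2) by simp
qed

lemma brD_DC: "x \<in> DC \<Longrightarrow> y \<in> DC \<Longrightarrow> brD x y \<in> DC"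
proof -
  assume x: "x \<in> DC" and y: "y \<in> DC"
  then obtain n where "low n x" "low n y" using common_low by blast
  then have "low (n + n) (brD x y)" by (rule brD_low)
  moreover have "fst (brD x y) k \<in> G k" for k
    unfolding loop_double_bracket_def fst_conv
    by (rule series_bracket_grade) (use x y G_subspace G_br in \<open>auto simp: DC_iff\<close>)
  moreover have "snd (brD x y) k \<in> G (- k)" for k
    unfolding loop_double_bracket_def snd_conv
    by (rule series_bracket_grade[of _ "\<lambda>k. G (- k)"])
      (use x y G_subspace G_br[of _ "- _" _ "- _"] in \<open>auto simp: DC_iff\<close>)
  ultimately show ?thesis by (auto simp: DC_iff)
qed

lemma lie_DC: "lie_algebra DC brD"
  unfolding lie_algebra_def
proof (intro conjI ballI)
  show "bilinear_on DC DC brD"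
    by (rule bilinear_on_DC) (simp_all add: brD_add brD_scale)
next
  fix x y z assume x: "x \<in> DC" and y: "y \<in> DC" and z: "z \<in> DC"
  then obtain n where n: "low n x" "low n y" "low n z" using common_low by blast
  show "brD x x = 0"
    using n(1) by (simp add: low_def loop_double_bracket_def series_bracket_self[of n] zero_prod_def)
  show "brD x (brD y z) + brD y (brD z x) + brD z (brD x y) = 0"
    using n by (simp add: low_def loop_double_bracket_def series_jacobi[of n] zero_prod_def)
qed (simp_all add: DC_subspace brD_DC)

lemma L_low: "a \<in> L \<Longrightarrow> \<exists>N\<ge>0. low (- N) (diag_embed a) \<and> (\<forall>k. N < \<bar>k\<bar> \<longrightarrow> a k = 0)"
proof -
  assume a: "a \<in> L"
  define N where "N = Max (insert 0 ((\<lambda>k. \<bar>k\<bar>) ` {k. a k \<noteq> 0}))"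
  have f: "finite (insert 0 ((\<lambda>k. \<bar>k\<bar>) ` {k. a k \<noteq> 0}))" using a by (simp add: L_iff)
  have N: "0 \<le> N" "\<And>k. a k \<noteq> 0 \<Longrightarrow> \<bar>k\<bar> \<le> N"
    unfolding N_def using f by (auto intro!: Max_ge)
  then have "a k = 0" if "N < \<bar>k\<bar>" for k using that by force
  moreover from this have "low (- N) (diag_embed a)"
    by (auto simp: low_def vanishes_below_def diag_embed_def dagger_def)
  ultimately show ?thesis using N(1) by blast
qed

lemma diag_D: "a \<in> L \<Longrightarrow> diag_embed a \<in> D"
proof -
  assume a: "a \<in> L"
  have "{k. a (- k) \<noteq> 0} = uminus ` {k. a k \<noteq> 0}" by force
  then show ?thesis using a by (auto simp: D_iff L_iff diag_embed_def dagger_def)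
qed

lemma diag_bracket: "diag_embed (brL a b) = brD (diag_embed a) (diag_embed b)"
  by (simp add: diag_embed_def loop_double_bracket_def dagger_bracket)

lemma diag_linear: "linear_on S diag_embed"
  by (simp add: linear_on_def diag_embed_def dagger_def scaleC_prod_def scaleC_fun_def plus_fun_def)

lemma diag_inj: "diag_embed a = diag_embed b \<Longrightarrow> a = b"
  by (simp add: diag_embed_def)

text \<open>Through the diagonal embedding both the bracket and its dagger are bounded below, so the
  support is finite.\<close>

lemma brL_L: "a \<in> L \<Longrightarrow> b \<in> L \<Longrightarrow> brL a b \<in> L"
proof -
  assume a: "a \<in> L" and b: "b \<in> L"
  let ?c = "brL a b"
  have "diag_embed ?c \<in> DC"
    unfolding diag_bracket using a b diag_D D_DC brD_DC by blast
  then obtain n where n: "vanishes_below n ?c" "vanishes_below n (dagger ?c)" and g: "\<And>k. ?c k \<in> G k"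
    by (auto simp: DC_iff low_def diag_embed_def)
  have "{k. ?c k \<noteq> 0} \<subseteq> {n..- n}"
  proof
    fix k assume k: "k \<in> {k. ?c k \<noteq> 0}"
    have "n \<le> k" using k n(1) by (force simp: vanishes_below_def)
    moreover have "n \<le> - k" using k n(2)[unfolded vanishes_below_def, rule_format, of "- k"]
      by (force simp: dagger_def)
    ultimately show "k \<in> {n..- n}" by simp
  qed
  then show ?thesis using g finite_subset by (auto simp: L_iff)
qed

lemma lie_L: "lie_algebra L brL"
  unfolding lie_algebra_def
proof (intro conjI ballI)
  have dd: "diag_embed x \<in> DC" if "x \<in> L" for x using that diag_D D_DC by blast
  have d: "diag_embed (x + y) = diag_embed x + diag_embed y" "diag_embed (c *\<^sub>C x) = c *\<^sub>C diag_embed x"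
    for x y :: "'g series" and c
    by (simp_all add: linear_on_add[OF diag_linear[of UNIV]] linear_on_scale[OF diag_linear[of UNIV]])
  have bil: "bilinear_on DC DC brD" using lie_DC by (simp add: lie_algebra_def)
  show "bilinear_on L L brL"
    unfolding bilinear_on_def linear_on_def
    by (intro conjI ballI allI; rule diag_inj)
      (simp_all add: diag_bracket d dd linear_on_add[OF bilinear_onD(1)[OF bil]] linear_on_add[OF bilinear_onD(2)[OF bil]]
        linear_on_scale[OF bilinear_onD(1)[OF bil]] linear_on_scale[OF bilinear_onD(2)[OF bil]])
  have d0: "diag_embed 0 = 0" by (simp add: diag_embed_def dagger_def zero_prod_def zero_fun_def)
  fix x y z assume x: "x \<in> L" "y \<in> L" "z \<in> L"
  show "brL x x = 0"
    by (rule diag_inj) (use lie_DC dd x in \<open>simp add: diag_bracket d0 lie_algebra_def\<close>)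
  show "brL x (brL y z) + brL y (brL z x) + brL z (brL x y) = 0"
    by (rule diag_inj) (use lie_DC dd x in \<open>simp add: diag_bracket d d0 lie_algebra_def\<close>)
qed (simp_all add: L_subspace brL_L)

text \<open>Monomials, hence elements of D, suffice as test vectors; this makes F non-degenerate on
  every double between D and its completion.\<close>

lemma F_nondegenerate:
  assumes x: "x \<in> DC" and z: "\<And>y. y \<in> D \<Longrightarrow> F x y = 0"
  shows "x = 0"
proof -
  have "fst x k = 0" for k
  proof (rule killing_nondegenerate_graded)
    show "fst x k \<in> G k" using x by (simp add: DC_iff)
    fix b assume b: "b \<in> G (- k)"
    have "(monomial (- k) b, 0) \<in> D"
      unfolding loop_double_def using monomial_loop_space[of G] G_subspace b
        cv.subspace_0[OF subspace_loop_space[of "\<lambda>k. G (- k)"]] by auto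
    from z[OF this] show "\<kappa> (fst x k) b = 0"
      by (simp add: loop_double_form_def series_form_monomial) (simp add: series_form_def)
  qed
  moreover have "snd x k = 0" for k
  proof (rule killing_nondegenerate_graded)
    show "snd x k \<in> G (- k)" using x by (simp add: DC_iff)
    fix b assume b: "b \<in> G (- (- k))"
    have "(0, monomial (- k) b) \<in> D"
      unfolding loop_double_def using monomial_loop_space[of "\<lambda>k. G (- k)"] G_subspace b
        cv.subspace_0[OF subspace_loop_space[of G]] by auto
    from z[OF this] show "\<kappa> (snd x k) b = 0"
      by (simp add: loop_double_form_def series_form_monomial) (simp add: series_form_def)
  qed
  ultimately show ?thesis by (simp add: prod_eq_iff fun_eq_iff)
qed

lemma lie_algebra_subset:
  assumes "lie_algebra R b" "S \<subseteq> R" "cv.subspace S" "\<And>x y. x \<in> S \<Longrightarrow> y \<in> S \<Longrightarrow> b x y \<in> S"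
  shows "lie_algebra S b"
  unfolding lie_algebra_def
proof (intro conjI ballI)
  show "bilinear_on S S b"
    using assms(1,2) by (auto simp: lie_algebra_def intro: bilinear_on_mono)
  fix x y z assume "x \<in> S" "y \<in> S" "z \<in> S"
  then have "x \<in> R" "y \<in> R" "z \<in> R" using assms(2) by auto
  then show "b x x = 0" "b x (b y z) + b y (b z x) + b z (b x y) = 0"
    using assms(1) by (simp_all add: lie_algebra_def)
qed (use assms(3,4) in auto)

lemma double_subset:
  assumes R: "D \<subseteq> R" "R \<subseteq> DC" "cv.subspace R" "\<And>x y. x \<in> R \<Longrightarrow> y \<in> R \<Longrightarrow> brD x y \<in> R"
  shows "double R brD F L brL diag_embed"
proof
  show "lie_algebra R brD" by (rule lie_algebra_subset[OF lie_DC R(2-4)])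
  show "lie_algebra L brL" by (rule lie_L)
  show "bilinear_on R R F"
  proof (rule bilinear_on_mono[OF _ R(2) R(2)])
    show "bilinear_on DC DC F"
      by (rule bilinear_on_DC) (simp_all add: F_add F_scale scaleC_complex_def)
  qed
  fix x y z assume x: "x \<in> R" and y: "y \<in> R"
  show "F x y = F y x" by (simp add: loop_double_form_def series_form_sym)
  assume z: "z \<in> R"
  obtain n where "low n x" "low n y" "low n z" using common_low[of x y z] x y z R(2) by blast
  then show "F (brD x y) z = F x (brD y z)"
    by (simp add: loop_double_form_def loop_double_bracket_def low_def series_form_invariant[of n])
next
  fix x assume "x \<in> R" "\<And>y. y \<in> R \<Longrightarrow> F x y = 0"
  then show "x = 0" using F_nondegenerate R(1,2) by blast
next
  fix a b assume a: "a \<in> L" and b: "b \<in> L"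
  show "diag_embed a \<in> R" using diag_D a R(1) by blast
  show "diag_embed (brL a b) = brD (diag_embed a) (diag_embed b)" by (rule diag_bracket)
  show "F (diag_embed a) (diag_embed b) = 0"
    by (simp add: loop_double_form_def diag_embed_def series_form_dagger)
qed (rule diag_linear)

end

section \<open>Manin triples as Lagrangian subalgebras\<close>

context double
begin

lemma C_subspace: "cv.subspace (\<iota> ` L)"
proof (rule cv.subspaceI)
  show "0 \<in> \<iota> ` L" using \<iota>_simps(4) L_closed by (metis imageI)
  fix x y c assume "x \<in> \<iota> ` L" "y \<in> \<iota> ` L"
  then obtain a b where ab: "a \<in> L" "b \<in> L" "x = \<iota> a" "y = \<iota> b" by blast
  then have "x + y = \<iota> (a + b)" "c *\<^sub>C x = \<iota> (c *\<^sub>C a)" by (simp_all add: \<iota>_simps)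
  then show "x + y \<in> \<iota> ` L" "c *\<^sub>C x \<in> \<iota> ` L" using ab L_closed by blast+
qed

text \<open>\<open>determines_cobracket\<close> speaks of tensors over the image of L; tensors over
  L are transported there.\<close>

abbreviation tensor_embed :: "('l, 'l) tensor \<Rightarrow> ('r, 'r) tensor" where
  "tensor_embed \<equiv> tensor_lift L L (\<lambda>a b. \<iota> a \<otimes>\<^sub>C \<iota> b)"

lemma embed_bilinear: "bilinear_on L L (\<lambda>a b. \<iota> a \<otimes>\<^sub>C \<iota> b)"
  by (auto simp: bilinear_on_def linear_on_def \<iota>_simps tensor_prod_simps)

lemma tensor_embed_space: "t \<in> tensor_space L L \<Longrightarrow> tensor_embed t \<in> tensor_space (\<iota> ` L) (\<iota> ` L)"
  by (rule tensor_lift_in[OF L_subspace L_subspace embed_bilinear]) (simp_all add: tensor_space_prod)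

lemma tensor_embed_swap:
  assumes t: "t \<in> tensor_space L L"
  shows "tensor_lift (\<iota> ` L) (\<iota> ` L) (\<lambda>a b. b \<otimes>\<^sub>C a) (tensor_embed t) =
    tensor_embed (tensor_lift L L (\<lambda>a b. b \<otimes>\<^sub>C a) t)"
proof -
  have b: "bilinear_on (\<iota> ` L) (\<iota> ` L) (\<lambda>a b. b \<otimes>\<^sub>C a)"
    by (simp add: bilinear_on_def linear_on_def tensor_prod_simps)
  have "tensor_lift (\<iota> ` L) (\<iota> ` L) (\<lambda>a b. b \<otimes>\<^sub>C a) (tensor_embed t) =
      tensor_lift L L (\<lambda>a b. tensor_lift (\<iota> ` L) (\<iota> ` L) (\<lambda>a b. b \<otimes>\<^sub>C a) (\<iota> a \<otimes>\<^sub>C \<iota> b)) t"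
    by (rule linear_on_compose_tensor_lift[OF L_subspace L_subspace embed_bilinear t subspace_tensor_space _
          tensor_lift_linear[OF C_subspace C_subspace b]]) (simp add: tensor_space_prod)
  also have "\<dots> = tensor_lift L L (\<lambda>a b. tensor_embed (b \<otimes>\<^sub>C a)) t"
    by (rule tensor_lift_cong)
      (simp add: tensor_lift_prod[OF C_subspace C_subspace b] tensor_lift_prod[OF L_subspace L_subspace embed_bilinear])
  also have "\<dots> = tensor_embed (tensor_lift L L (\<lambda>a b. b \<otimes>\<^sub>C a) t)"
    by (rule linear_on_compose_tensor_lift[OF L_subspace L_subspace swap_bilinear t subspace_tensor_space _
          tensor_lift_linear[OF L_subspace L_subspace embed_bilinear], symmetric]) (simp add: tensor_space_prod)
  finally show ?thesis .
qed

lemma tensor_embed_wedge2: "t \<in> wedge2 L \<Longrightarrow> tensor_embed t \<in> wedge2 (\<iota> ` L)"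
  using tensor_embed_swap[of t] tensor_embed_space[of t]
    linear_on_neg[OF tensor_lift_linear[OF L_subspace L_subspace embed_bilinear] subspace_tensor_space, of t]
  by (simp add: wedge2_def)

lemma pair_tensor_embed:
  assumes t: "t \<in> tensor_space L L" and x: "x \<in> R" and y: "y \<in> R"
  shows "tensor_lift (\<iota> ` L) (\<iota> ` L) (\<lambda>a b. F a x * F b y) (tensor_embed t) = pair x y t"
proof -
  have b: "bilinear_on (\<iota> ` L) (\<iota> ` L) (\<lambda>a b. F a x * F b y)"
    using x y by (auto simp: bilinear_on_def linear_on_def F_simps R_closed scaleC_complex_def algebra_simps)
  have "tensor_lift (\<iota> ` L) (\<iota> ` L) (\<lambda>a b. F a x * F b y) (tensor_embed t) =
      tensor_lift L L (\<lambda>a b. tensor_lift (\<iota> ` L) (\<iota> ` L) (\<lambda>a b. F a x * F b y) (\<iota> a \<otimes>\<^sub>C \<iota> b)) t"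
    by (rule linear_on_compose_tensor_lift[OF L_subspace L_subspace embed_bilinear t subspace_tensor_space _
          tensor_lift_linear[OF C_subspace C_subspace b]]) (simp add: tensor_space_prod)
  also have "\<dots> = pair x y t"
    unfolding pair_def using x y
    by (intro tensor_lift_cong) (simp add: tensor_lift_prod[OF C_subspace C_subspace b] F_sym R_closed)
  finally show ?thesis .
qed

text \<open>Separates what every graph satisfies from closure of V under the bracket. Injectivity of
  \<iota> enters because \<open>W_Int\<close> concerns elements of L rather than their
  images.\<close>

lemma manin_triple_iff:
  assumes inj: "\<And>a. a \<in> L \<Longrightarrow> \<iota> a = 0 \<Longrightarrow> a = 0"
  shows "manin_triple R br F (\<iota> ` L) V \<longleftrightarrow>
    lagrangian R br F L brL \<iota> V \<and> (\<forall>x\<in>V. \<forall>y\<in>V. br x y \<in> V)"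
proof
  assume mt: "manin_triple R br F (\<iota> ` L) V"
  have V: "V \<subseteq> R" "cv.subspace V" "\<And>x y. x \<in> V \<Longrightarrow> y \<in> V \<Longrightarrow> br x y \<in> V"
    "\<And>x y. x \<in> V \<Longrightarrow> y \<in> V \<Longrightarrow> F x y = 0" "\<iota> ` L \<inter> V = {0}"
    "{x + y | x y. x \<in> \<iota> ` L \<and> y \<in> V} = R"
    using mt by (auto simp: manin_triple_def lie_subalgebra_def)
  have "lagrangian R br F L brL \<iota> V"
  proof
    show "\<exists>a\<in>L. x - \<iota> a \<in> V" if "x \<in> R" for x
    proof -
      obtain a v where "a \<in> L" "v \<in> V" "x = \<iota> a + v" using V(6) \<open>x \<in> R\<close> by blast
      then show ?thesis by (intro bexI[of _ a]) simp_all
    qed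
    show "a = 0" if "a \<in> L" "\<iota> a \<in> V" for a using that V(5) inj by blast
  qed (use V in auto)
  then show "lagrangian R br F L brL \<iota> V \<and> (\<forall>x\<in>V. \<forall>y\<in>V. br x y \<in> V)" using V(3) by blast
next
  assume a: "lagrangian R br F L brL \<iota> V \<and> (\<forall>x\<in>V. \<forall>y\<in>V. br x y \<in> V)"
  then interpret V: lagrangian R br F L brL \<iota> V by blast
  have "{x + y | x y. x \<in> \<iota> ` L \<and> y \<in> V} = R"
  proof safe
    show "\<iota> a + y \<in> R" if "a \<in> L" "y \<in> V" for a y using that V.W_R by (simp add: R_closed)
    show "\<exists>u y. x = u + y \<and> u \<in> \<iota> ` L \<and> y \<in> V" if x: "x \<in> R" for x
    proof -
      obtain a where "a \<in> L" "x - \<iota> a \<in> V" using V.W_sum[OF x] by blast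
      then show ?thesis by (intro exI[of _ "\<iota> a"] exI[of _ "x - \<iota> a"]) simp
    qed
  qed
  moreover have "\<iota> ` L \<inter> V = {0}"
  proof -
    have "x = 0" if "x \<in> \<iota> ` L" "x \<in> V" for x
      using that V.W_Int \<iota>_simps(4) by blast
    then show ?thesis using V.W_closed(5) cv.subspace_0[OF C_subspace] by blast
  qed
  moreover have "lie_subalgebra R br (\<iota> ` L)"
    using C_subspace \<iota>_br brL_L by (auto simp: lie_subalgebra_def R_closed) (metis imageI)
  moreover have "lie_subalgebra R br V"
    using a V.W_subspace V.W_R by (auto simp: lie_subalgebra_def)
  ultimately show "manin_triple R br F (\<iota> ` L) V"
    unfolding manin_triple_def using lieR F_bilinear F_sym F_inv F_nondeg \<iota>_iso V.W_iso by auto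
qed

end

context twisted_loop
begin

sublocale dc: double DC brD F L brL diag_embed
  by (rule double_subset[OF D_DC order.refl DC_subspace brD_DC])

section \<open>The triangular decomposition\<close>

abbreviation RS :: "('g \<Rightarrow> complex) \<Rightarrow> 'g set" where "RS \<equiv> root_space (G 0) br h"
abbreviation \<Phi> :: "('g \<Rightarrow> complex) set" where "\<Phi> \<equiv> root_set (G 0) br h"

definition nil_part :: "('g \<Rightarrow> complex) set \<Rightarrow> 'g set" where
  "nil_part S = cv.span (\<Union>\<alpha>\<in>S. RS \<alpha>)"

text \<open>What isotropy asks of a set of roots. P and - P both satisfy it, so \<open>np\<close>
  and \<open>nm\<close> are treated by the same lemmas.\<close>

definition half_system :: "('g \<Rightarrow> complex) set \<Rightarrow> bool" where
  "half_system S \<longleftrightarrow> S \<subseteq> \<Phi> \<and> (\<forall>\<alpha>\<in>S. \<forall>\<beta>\<in>S. \<alpha> + \<beta> \<noteq> 0)"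

lemma cartan: "cv.subspace h" "h \<subseteq> G 0" "\<And>x y. x \<in> h \<Longrightarrow> y \<in> h \<Longrightarrow> br x y = 0"
  using tri by (auto simp: triangular_decomposition_def cartan_subalgebra_def lie_subalgebra_def)

lemma ex_half_systems: "\<exists>S T. half_system S \<and> half_system T \<and> np = nil_part S \<and> nm = nil_part T"
proof -
  obtain P where P: "positive_system \<Phi> P" "np = cv.span (\<Union>\<alpha>\<in>P. RS \<alpha>)" "nm = cv.span (\<Union>\<alpha>\<in>P. RS (- \<alpha>))"
    using tri by (auto simp: triangular_decomposition_def)
  have P1: "P \<union> uminus ` P = \<Phi>" "P \<inter> uminus ` P = {}"
    using P(1) by (auto simp: positive_system_def)
  have ne: "\<alpha> + \<beta> \<noteq> 0" if "\<alpha> \<in> P" "\<beta> \<in> P" for \<alpha> \<beta>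
    using that P1(2) by (auto simp: eq_neg_iff_add_eq_0[symmetric])
  have "half_system P" using P1 ne by (auto simp: half_system_def)
  moreover have "half_system (uminus ` P)"
    unfolding half_system_def
  proof (intro conjI ballI)
    show "uminus ` P \<subseteq> \<Phi>" using P1(1) by blast
    fix \<alpha> \<beta> assume "\<alpha> \<in> uminus ` P" "\<beta> \<in> uminus ` P"
    then obtain a b where ab: "a \<in> P" "b \<in> P" "\<alpha> = - a" "\<beta> = - b" by blast
    then have e: "\<alpha> + \<beta> = - (a + b)" by simp
    show "\<alpha> + \<beta> \<noteq> 0" unfolding e using ne[OF ab(1,2)] by (simp only: neg_equal_0_iff_equal not_False_eq_True)
  qed
  moreover have "nm = nil_part (uminus ` P)" unfolding P(3) nil_part_def by (simp add: image_image)
  ultimately show ?thesis using P(2) unfolding nil_part_def by blast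
qed

lemma root_space_iff: "x \<in> RS \<alpha> \<longleftrightarrow> x \<in> G 0 \<and> (\<forall>y\<in>h. br y x = \<alpha> y *\<^sub>C x)"
  by (auto simp: root_space_def)

lemma bilinear_span_subset:
  assumes "bilinear_on UNIV UNIV \<beta>" "cv.subspace V" "\<And>x y. x \<in> A \<Longrightarrow> y \<in> B \<Longrightarrow> \<beta> x y \<in> V"
    and "x \<in> cv.span A" "y \<in> cv.span B"
  shows "\<beta> x y \<in> V"
proof -
  note l = bilinear_onD(1)[OF assms(1) UNIV_I] and r = bilinear_onD(2)[OF assms(1) UNIV_I]
  have "cv.subspace {y. \<beta> x y \<in> V}" for x
    by (rule cv.subspaceI)
      (simp_all add: linear_on_zero[OF l] linear_on_add[OF l] linear_on_scale[OF l] cv.subspace_0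
        cv.subspace_add cv.subspace_scale assms(2))
  then have 1: "\<beta> x y \<in> V" if "x \<in> A" for x
    using cv.span_minimal[of B "{y. \<beta> x y \<in> V}"] assms(3,5) that by blast
  have "cv.subspace {x. \<beta> x y \<in> V}"
    by (rule cv.subspaceI)
      (simp_all add: linear_on_zero[OF r] linear_on_add[OF r] linear_on_scale[OF r] cv.subspace_0
        cv.subspace_add cv.subspace_scale assms(2))
  then show ?thesis using cv.span_minimal[of A "{x. \<beta> x y \<in> V}"] assms(4) 1 by blast
qed

lemma nil_part_subspace: "cv.subspace (nil_part S)"
  by (simp add: nil_part_def)

lemma nil_part_G: "nil_part S \<subseteq> G 0"
  unfolding nil_part_def by (rule cv.span_minimal) (auto simp: root_space_iff G_subspace)

text \<open>For root vectors u, v and t in h, invariance gives (\<alpha> t + \<beta> t) \<kappa> u v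
  = 0, and \<alpha> + \<beta> is nonzero.\<close>

lemma killing_nil_part:
  assumes S: "half_system S" and "x \<in> nil_part S" "y \<in> nil_part S"
  shows "\<kappa> x y = 0"
proof -
  have "\<kappa> x y \<in> {0}"
  proof (rule bilinear_span_subset[OF killing_bilinear _ _ assms(2,3)[unfolded nil_part_def]])
    fix u v assume "u \<in> (\<Union>\<alpha>\<in>S. RS \<alpha>)" "v \<in> (\<Union>\<alpha>\<in>S. RS \<alpha>)"
    then obtain \<alpha> \<beta> where ab: "\<alpha> \<in> S" "\<beta> \<in> S" "u \<in> RS \<alpha>" "v \<in> RS \<beta>" by blast
    have z: "\<forall>x. x \<notin> h \<longrightarrow> \<alpha> x = 0" "\<forall>x. x \<notin> h \<longrightarrow> \<beta> x = 0" and ne: "\<alpha> + \<beta> \<noteq> 0"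
      using S ab by (auto simp: half_system_def root_set_def)
    obtain t where t: "\<alpha> t + \<beta> t \<noteq> 0" using ne by (auto simp: fun_eq_iff)
    \<comment> \<open>Roots are extended by zero outside h, so a point where their sum does not
      vanish lies in h.\<close>
    have th: "t \<in> h" by (rule ccontr) (use t z in simp)
    have "\<alpha> t * \<kappa> u v = \<kappa> (br t u) v" using ab th by (simp add: root_space_iff killing_simps scaleC_complex_def)
    also have "\<dots> = - \<kappa> (br u t) v" by (simp add: br_skew[of u t] killing_neg)
    also have "\<dots> = - (\<beta> t * \<kappa> u v)"
      using ab th by (simp add: killing_invariant root_space_iff killing_simps scaleC_complex_def)
    finally have "(\<alpha> t + \<beta> t) * \<kappa> u v = 0" by (simp add: algebra_simps)
    then show "\<kappa> u v \<in> {0}" using t by simp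
  qed simp
  then show ?thesis by simp
qed

text \<open>The same argument with the second root replaced by zero, as h is abelian.\<close>

lemma killing_nil_part_h:
  assumes S: "half_system S" and "x \<in> nil_part S" "y \<in> h"
  shows "\<kappa> x y = 0" "\<kappa> y x = 0"
proof -
  have "\<kappa> x y \<in> {0}"
  proof (rule bilinear_span_subset[OF killing_bilinear _ _ assms(2)[unfolded nil_part_def] cv.span_base[OF assms(3)]])
    fix u v assume "u \<in> (\<Union>\<alpha>\<in>S. RS \<alpha>)" and v: "v \<in> h"
    then obtain \<alpha> where ab: "\<alpha> \<in> S" "u \<in> RS \<alpha>" by blast
    have z: "\<forall>x. x \<notin> h \<longrightarrow> \<alpha> x = 0" and ne: "\<alpha> \<noteq> 0"
      using S ab by (auto simp: half_system_def root_set_def)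
    obtain t where t: "\<alpha> t \<noteq> 0" using ne by (auto simp: fun_eq_iff)
    then have th: "t \<in> h" using z by auto
    have "\<alpha> t * \<kappa> u v = \<kappa> (br t u) v" using ab th by (simp add: root_space_iff killing_simps scaleC_complex_def)
    also have "\<dots> = - \<kappa> (br u t) v"
      by (simp add: br_skew[of u t] killing_neg)
    also have "\<dots> = 0" using cartan(3)[OF th v] by (simp add: killing_invariant killing_simps)
    finally show "\<kappa> u v \<in> {0}" using t by simp
  qed simp
  then show "\<kappa> x y = 0" "\<kappa> y x = 0" by (simp_all add: killing_sym)
qed

lemma triangular_sum: "{x + y + z | x y z. x \<in> np \<and> y \<in> h \<and> z \<in> nm} = G 0"
  and triangular_direct: "x \<in> np \<Longrightarrow> y \<in> h \<Longrightarrow> z \<in> nm \<Longrightarrow> x + y + z = 0 \<Longrightarrow> x = 0 \<and> y = 0 \<and> z = 0"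
  using tri by (auto simp: triangular_decomposition_def)

section \<open>The standard complements\<close>

text \<open>The condition cutting out the standard complement, with explicit witnesses: the Cartan
  parts y and - y replace the two values of \<open>cartan_proj\<close>, a description that
  directness of the triangular decomposition resolves.\<close>

definition borel_condition :: "'g series \<times> 'g series \<Rightarrow> bool" where
  "borel_condition x \<longleftrightarrow> low 0 x \<and> (\<exists>p\<in>np. \<exists>y\<in>h. \<exists>q\<in>nm. fst x 0 = p + y \<and> snd x 0 = q - y)"

lemma np_subspace: "cv.subspace np" and nm_subspace: "cv.subspace nm"
  using ex_half_systems nil_part_subspace by auto

lemma cartan_proj_np:
  assumes "p \<in> np" "y \<in> h" "f 0 = p + y"
  shows "cartan_proj np h f = y"
  unfolding cartan_proj_def
proof (rule the_equality)
  fix z assume z: "z \<in> h \<and> f 0 - z \<in> np"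
  have "(f 0 - z - p) + (z - y) + 0 = 0" using assms(3) by simp
  then have "z - y = 0"
    using triangular_direct[of "f 0 - z - p" "z - y" 0] z assms(1,2) np_subspace nm_subspace cartan(1)
    by (simp add: cv.subspace_diff cv.subspace_0)
  then show "z = y" by simp
qed (use assms in simp)

lemma cartan_proj_nm:
  assumes "q \<in> nm" "y \<in> h" "f 0 = q + y"
  shows "cartan_proj nm h f = y"
  unfolding cartan_proj_def
proof (rule the_equality)
  fix z assume z: "z \<in> h \<and> f 0 - z \<in> nm"
  have "0 + (z - y) + (f 0 - z - q) = 0" using assms(3) by simp
  then have "z - y = 0"
    using triangular_direct[of 0 "z - y" "f 0 - z - q"] z assms(1,2) np_subspace nm_subspace cartan(1)
    by (simp add: cv.subspace_diff cv.subspace_0)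
  then show "z = y" by simp
qed (use assms in simp)

lemma standard_complement_iff:
  "x \<in> standard_complement Lp Lm np h nm \<longleftrightarrow> x \<in> Lp \<times> Lm \<and> borel_condition x"
proof
  assume "x \<in> standard_complement Lp Lm np h nm"
  then obtain f g where x: "x = (f, g)" "f \<in> borel_part Lp np h" "g \<in> borel_part Lm nm h"
    "cartan_proj np h f + cartan_proj nm h g = 0" by (auto simp: standard_complement_def)
  then obtain p y q y' where py: "p \<in> np" "y \<in> h" "f 0 = p + y" "q \<in> nm" "y' \<in> h" "g 0 = q + y'"
    by (auto simp: borel_part_def)
  then have "y + y' = 0" using x(4) cartan_proj_np[of p y f, OF py(1-3)] cartan_proj_nm[of q y' g, OF py(4-6)] by simp
  then have "g 0 = q - y" using py(6) by (simp add: eq_neg_iff_add_eq_0[symmetric] add.commute)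
  then show "x \<in> Lp \<times> Lm \<and> borel_condition x"
    using x py by (auto simp: borel_condition_def low_def vanishes_below_def borel_part_def)
next
  assume x: "x \<in> Lp \<times> Lm \<and> borel_condition x"
  then obtain p y q where py: "p \<in> np" "y \<in> h" "q \<in> nm" "fst x 0 = p + y" "snd x 0 = q - y" and l: "low 0 x"
    by (auto simp: borel_condition_def)
  have ny: "- y \<in> h" "snd x 0 = q + - y" using py cv.subspace_neg[OF cartan(1)] by auto
  have "cartan_proj np h (fst x) + cartan_proj nm h (snd x) = 0"
    using cartan_proj_np[of p y "fst x", OF py(1,2,4)] cartan_proj_nm[of q "- y" "snd x", OF py(3) ny] by simp
  moreover have "fst x \<in> borel_part Lp np h" "snd x \<in> borel_part Lm nm h"
  proof -
    have "fst x 0 \<in> {u + v | u v. u \<in> np \<and> v \<in> h}" using py(1,2,4) by blast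
    moreover have "snd x 0 \<in> {u + v | u v. u \<in> nm \<and> v \<in> h}" using py(3) ny by blast
    ultimately show "fst x \<in> borel_part Lp np h" "snd x \<in> borel_part Lm nm h"
      using x l by (auto simp only: borel_part_def low_def vanishes_below_def mem_Times_iff mem_Collect_eq)
  qed
  ultimately show "x \<in> standard_complement Lp Lm np h nm"
    unfolding standard_complement_def by (metis (mono_tags, lifting) mem_Collect_eq prod.collapse)
qed

lemma W_std_iff: "W_std \<sigma> m np h nm = {x \<in> D. borel_condition x}"
  and W_std_completed_iff: "W_std_completed \<sigma> m np h nm = {x \<in> DC. borel_condition x}"
  by (auto simp: W_std_def W_std_completed_def loop_double_def completed_loop_double_def standard_complement_iff)

lemma borel_subspace: "cv.subspace {x. borel_condition x}"
proof (rule cv.subspaceI)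
  have "fst (0 :: 'g series \<times> 'g series) 0 = 0 + 0" "snd (0 :: 'g series \<times> 'g series) 0 = 0 - 0"
    "low 0 (0 :: 'g series \<times> 'g series)"
    by (simp_all add: low_def vanishes_below_def)
  then show "0 \<in> {x. borel_condition x}"
    unfolding borel_condition_def
    using cv.subspace_0[OF np_subspace] cv.subspace_0[OF nm_subspace] cv.subspace_0[OF cartan(1)] by blast
  fix x x' c assume "x \<in> {x. borel_condition x}" "x' \<in> {x. borel_condition x}"
  then obtain p y q p' y' q' where
    x: "p \<in> np" "y \<in> h" "q \<in> nm" "fst x 0 = p + y" "snd x 0 = q - y" "low 0 x" and
    x': "p' \<in> np" "y' \<in> h" "q' \<in> nm" "fst x' 0 = p' + y'" "snd x' 0 = q' - y'" "low 0 x'"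
    by (auto simp: borel_condition_def)
  have "fst (x + x') 0 = (p + p') + (y + y')" "snd (x + x') 0 = (q + q') - (y + y')"
    unfolding fst_add snd_add plus_fun_apply x(4,5) x'(4,5) by (simp_all add: algebra_simps)
  moreover have "p + p' \<in> np" "y + y' \<in> h" "q + q' \<in> nm"
    using x x' np_subspace nm_subspace cartan(1) by (simp_all add: cv.subspace_add)
  ultimately show "x + x' \<in> {x. borel_condition x}"
    using low_add[OF x(6) x'(6)] unfolding borel_condition_def by blast
  have "fst (c *\<^sub>C x) 0 = c *\<^sub>C p + c *\<^sub>C y" "snd (c *\<^sub>C x) 0 = c *\<^sub>C q - c *\<^sub>C y"
    using x by (simp_all add: scaleC_prod_def scaleC_apply cv.scale_right_distrib cv.scale_right_diff_distrib)
  moreover have "c *\<^sub>C p \<in> np" "c *\<^sub>C y \<in> h" "c *\<^sub>C q \<in> nm"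
    using x np_subspace nm_subspace cartan(1) by (simp_all add: cv.subspace_scale)
  ultimately show "c *\<^sub>C x \<in> {x. borel_condition x}"
    using low_scale[OF x(6)] unfolding borel_condition_def by blast
qed

lemma borel_condition_low: "low 1 x \<Longrightarrow> borel_condition x"
proof -
  assume x: "low 1 x"
  then have "fst x 0 = 0 + 0" "snd x 0 = 0 - 0" "low 0 x"
    using low_mono[of 1 x 0] by (simp_all add: low_def vanishes_below_def)
  then show ?thesis
    unfolding borel_condition_def
    using cv.subspace_0[OF np_subspace] cv.subspace_0[OF nm_subspace] cv.subspace_0[OF cartan(1)] by blast
qed

text \<open>Only degree 0 contributes. There the nilpotent parts drop out and the Cartan parts give
  \<kappa> y y' - \<kappa> (- y) (- y').\<close>

lemma borel_iso:
  assumes "borel_condition x" "borel_condition x'"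
  shows "F x x' = 0"
proof -
  obtain p y q p' y' q' where
    x: "p \<in> np" "y \<in> h" "q \<in> nm" "fst x 0 = p + y" "snd x 0 = q - y" "low 0 x" and
    x': "p' \<in> np" "y' \<in> h" "q' \<in> nm" "fst x' 0 = p' + y'" "snd x' 0 = q' - y'" "low 0 x'"
    using assms by (auto simp: borel_condition_def)
  have ny: "- y \<in> h" "- y' \<in> h" using x x' cv.subspace_neg[OF cartan(1)] by auto
  obtain S T where ST: "half_system S" "half_system T" "np = nil_part S" "nm = nil_part T"
    using ex_half_systems by blast
  have c: "\<kappa> (a + b) (a' + b') = \<kappa> b b'" if "half_system S'" "a \<in> nil_part S'" "a' \<in> nil_part S'" "b \<in> h" "b' \<in> h"
    for a b a' b' S'
    using killing_nil_part[OF that(1-3)] killing_nil_part_h(1)[OF that(1,2,5)]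
      killing_nil_part_h(2)[OF that(1,3,4)] by (simp add: killing_simps)
  have "\<kappa> (fst x 0) (fst x' 0) = \<kappa> y y'"
    unfolding x(4) x'(4) using x x' ST by (intro c[OF ST(1)]) auto
  moreover have "\<kappa> (q + - y) (q' + - y') = \<kappa> (- y) (- y')"
    using x x' ny ST by (intro c[OF ST(2)]) auto
  moreover have "\<kappa> (- y) (- y') = \<kappa> y y'"
    by (simp add: killing_neg)
  moreover have "F x x' = \<kappa> (fst x 0) (fst x' 0) - \<kappa> (snd x 0) (snd x' 0)"
    using x(6) x'(6) by (simp add: loop_double_form_def low_def series_form_eq[of 0 _ 0])
  ultimately show ?thesis unfolding x(5) x'(5) by simp
qed

lemma borel_Int:
  assumes "a \<in> L" "borel_condition (diag_embed a)"
  shows "a = 0"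
proof -
  obtain p y q where pyq: "p \<in> np" "y \<in> h" "q \<in> nm" "fst (diag_embed a) 0 = p + y"
    "snd (diag_embed a) 0 = q - y" "low 0 (diag_embed a)"
    using assms(2) unfolding borel_condition_def by blast
  have x: "p \<in> np" "y \<in> h" "q \<in> nm" "a 0 = p + y" "a 0 = q - y" "low 0 (diag_embed a)"
    using pyq by (simp_all add: diag_embed_def dagger_def)
  have "a k = 0" if "k \<noteq> 0" for k
  proof (cases "k < 0")
    case True
    then show ?thesis using x(6) by (simp add: low_def diag_embed_def vanishes_below_def)
  next
    case False
    then have "- k < 0" using that by simp
    moreover have "\<forall>j<0. a (- j) = 0" using x(6) by (simp add: low_def diag_embed_def dagger_def vanishes_below_def)
    ultimately have "a (- (- k)) = 0" by blast
    then show ?thesis by simp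
  qed
  moreover have "a 0 = 0"
  proof -
    \<comment> \<open>The two components of a diagonal element agree in degree 0: p + y = q - y, to
      which directness applies.\<close>
    have "p + (y + y) + - q = 0" using x(4,5) by (simp add: algebra_simps)
    then have "p = 0" "q = 0"
      using triangular_direct[of p "y + y" "- q"] x np_subspace nm_subspace cartan(1)
      by (simp_all add: cv.subspace_add cv.subspace_neg)
    then have "y = - y" using x(4,5) by simp
    then show ?thesis using double_eq_zero[of y] x(4) \<open>p = 0\<close> by simp
  qed
  ultimately show ?thesis by (metis ext zero_fun_apply)
qed

lemma borel_sum:
  assumes x: "x \<in> DC"
  shows "\<exists>a\<in>L. borel_condition (x - diag_embed a)"
proof -
  have xG: "fst x k \<in> G k" "snd x k \<in> G (- k)" for k using x by (auto simp: DC_iff)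
  obtain n where n: "low n x" using x by (auto simp: DC_iff)
  have "fst x 0 - snd x 0 \<in> G 0" using xG[of 0] G_subspace by (simp add: cv.subspace_diff)
  then obtain p y q where py: "p \<in> np" "y \<in> h" "q \<in> nm" "fst x 0 - snd x 0 = p + y + q"
    using triangular_sum by blast
  \<comment> \<open>The Cartan part of the difference is shared equally, since it must appear as y2
    in one component and as - y2 in the other.\<close>
  define y2 where "y2 = (1/2 :: complex) *\<^sub>C y"
  have y2: "y2 \<in> h" "y2 + y2 = y"
    using py(2) cartan(1) cv.scale_left_distrib[of "1/2" "1/2" y] by (simp_all add: y2_def cv.subspace_scale)
  \<comment> \<open>The principal part of the first series prescribes a in negative degrees, that of
    the second in positive degrees; degree 0 is settled by the triangular decomposition.\<close>
  define a where "a k = (if k < 0 then fst x k else if k = 0 then fst x 0 - p - y2 else snd x (- k))" for k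
  have npG: "np \<subseteq> G 0" using ex_half_systems nil_part_G by auto
  have "a k \<in> G k" for k
  proof -
    have "p \<in> G 0" "y2 \<in> G 0" using py(1) y2(1) npG cartan(2) by auto
    then have "fst x 0 - p - y2 \<in> G 0" using xG(1)[of 0] G_subspace[of 0] by (simp add: cv.subspace_diff)
    then show ?thesis using xG(1)[of k] xG(2)[of "- k"] by (simp add: a_def)
  qed
  moreover have "{k. a k \<noteq> 0} \<subseteq> {n..- n} \<union> {0}"
    using n by (auto simp: a_def low_def vanishes_below_def not_less[symmetric] split: if_splits)
  then have "finite {k. a k \<noteq> 0}" by (rule finite_subset) simp
  ultimately have "a \<in> L" by (simp add: L_iff)
  moreover have "borel_condition (x - diag_embed a)"
  proof -
    have "fst (x - diag_embed a) 0 = p + y2" by (simp add: diag_embed_def a_def)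
    moreover have "snd (x - diag_embed a) 0 = - q - y2"
    proof -
      have "snd x 0 = fst x 0 - (p + (y2 + y2) + q)" using py(4) y2(2) by (simp add: algebra_simps)
      then show ?thesis by (simp add: diag_embed_def dagger_def a_def algebra_simps)
    qed
    moreover have "low 0 (x - diag_embed a)"
      by (auto simp: low_def vanishes_below_def diag_embed_def dagger_def a_def)
    ultimately show ?thesis
      unfolding borel_condition_def using py y2 cv.subspace_neg[OF nm_subspace] by blast
  qed
  ultimately show ?thesis by blast
qed

end

context twisted_loop
begin

section \<open>Truncation\<close>

definition truncate :: "int \<Rightarrow> 'g series \<times> 'g series \<Rightarrow> 'g series \<times> 'g series" where
  "truncate n x = ((\<lambda>k. if k < n then fst x k else 0), (\<lambda>k. if k < n then snd x k else 0))"

lemma low_iff: "low n x \<longleftrightarrow> (\<forall>k<n. fst x k = 0 \<and> snd x k = 0)"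
  by (auto simp: low_def vanishes_below_def)

lemma low_truncate: "low n (x - truncate n x)"
  by (simp add: low_iff truncate_def)

lemma truncate_low: "low k x \<Longrightarrow> low k (truncate n x)"
  by (simp add: low_iff truncate_def)

lemma truncate_D:
  assumes "x \<in> DC"
  shows "truncate n x \<in> D"
proof -
  obtain a where a: "low a x" using assms by (auto simp: DC_iff)
  have k: "a \<le> k" if "fst x k \<noteq> 0 \<or> snd x k \<noteq> 0" for k
    using a that unfolding low_iff by (meson not_le)
  have "{k. fst (truncate n x) k \<noteq> 0} \<subseteq> {a..<n}" "{k. snd (truncate n x) k \<noteq> 0} \<subseteq> {a..<n}"
    using k by (auto simp: truncate_def split: if_splits)
  then have "finite {k. fst (truncate n x) k \<noteq> 0}" "finite {k. snd (truncate n x) k \<noteq> 0}"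
    by (meson finite_atLeastLessThan_int finite_subset)+
  then show ?thesis
    using assms G_subspace by (auto simp: D_iff DC_iff truncate_def cv.subspace_0)
qed

lemma ex_finite_span_truncate:
  "\<exists>B. finite B \<and> (\<forall>x. low a x \<longrightarrow> truncate n x \<in> cv.span B)"
proof -
  obtain B0 :: "'g set" where B0: "cv.independent B0" "cv.span B0 = UNIV" "finite B0"
    using independent_extend_basis_empty span_extend_basis_empty finite_dimensional_basis[OF fd] by blast
  define B where "B = (\<lambda>(k, b). (monomial k b, 0)) ` ({a..<n} \<times> B0) \<union> (\<lambda>(k, b). (0, monomial k b)) ` ({a..<n} \<times> B0)"
  have "truncate n x \<in> cv.span B" if x: "low a x" for x
  proof -
    have sp: "f \<in> cv.span ((\<lambda>(k, b). monomial k b) ` ({a..<n} \<times> B0))" if f: "\<And>k. k \<notin> {a..<n} \<Longrightarrow> f k = 0" for f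
    proof -
      have "f = (\<Sum>k\<in>{a..<n}. \<Sum>b\<in>B0. cv.representation B0 (f k) b *\<^sub>C monomial k b)"
      proof
        fix j
        have 1: "(\<Sum>k\<in>A. g k) j = (\<Sum>k\<in>A. g k j)" for A and g :: "'i \<Rightarrow> 'g series"
          by (induction A rule: infinite_finite_induct) auto
        have "(\<Sum>k\<in>{a..<n}. \<Sum>b\<in>B0. cv.representation B0 (f k) b *\<^sub>C monomial k b) j =
            (\<Sum>k\<in>{a..<n}. if k = j then f j else 0)"
          unfolding 1
        proof (rule sum.cong[OF refl])
          fix k
          show "(\<Sum>b\<in>B0. (cv.representation B0 (f k) b *\<^sub>C monomial k b) j) = (if k = j then f j else 0)"
            using sum_representation_UNIV[OF B0] by (auto simp: scaleC_apply monomial_def)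
        qed
        also have "\<dots> = f j" using f[of j] by simp
        finally show "f j = (\<Sum>k\<in>{a..<n}. \<Sum>b\<in>B0. cv.representation B0 (f k) b *\<^sub>C monomial k b) j" by simp
      qed
      also have "\<dots> \<in> cv.span ((\<lambda>(k, b). monomial k b) ` ({a..<n} \<times> B0))"
        by (intro cv.span_sum cv.span_scale cv.span_base) force
      finally show ?thesis .
    qed
    have emb: "Vector_Spaces.linear scaleC scaleC (\<lambda>f. (f, 0) :: 'g series \<times> 'g series)"
      "Vector_Spaces.linear scaleC scaleC (\<lambda>f. (0, f) :: 'g series \<times> 'g series)"
      by (simp_all add: linear_on_UNIV_iff[symmetric] linear_on_def scaleC_prod_def)
    let ?E = "(\<lambda>(k, b). monomial k b) ` ({a..<n} \<times> B0)"
    have "(\<lambda>f. (f, 0)) ` ?E \<subseteq> B" "(\<lambda>f. (0, f)) ` ?E \<subseteq> B" unfolding B_def by force+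
    then have "(\<lambda>f. (f, 0)) ` cv.span ?E \<subseteq> cv.span B" "(\<lambda>f. (0, f)) ` cv.span ?E \<subseteq> cv.span B"
      unfolding cvp.linear_span_image[OF emb(1), symmetric] cvp.linear_span_image[OF emb(2), symmetric]
      by (simp_all add: cv.span_mono)
    then have m: "(f, 0) \<in> cv.span B" "(0, f) \<in> cv.span B" if "f \<in> cv.span ?E" for f
      using that by (auto simp: image_subset_iff)
    have "(fst (truncate n x), 0) \<in> cv.span B" "(0, snd (truncate n x)) \<in> cv.span B"
      using x by (auto intro!: m sp simp: truncate_def low_iff)
    then have "(fst (truncate n x), 0) + (0, snd (truncate n x)) \<in> cv.span B" by (rule cv.span_add)
    then show ?thesis by simp
  qed
  moreover have "finite B" using B0(3) by (simp add: B_def)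
  ultimately show ?thesis by blast
qed

text \<open>A tensor involves finitely many elements of L: the left factors govern the first bound,
  the right factors the second.\<close>

lemma contract_bounds:
  assumes "t \<in> tensor_space L L"
  shows "\<exists>N\<ge>0. (\<forall>x\<in>DC. low N x \<longrightarrow> dc.contract x t = 0) \<and>
    (\<forall>x\<in>DC. low (- N) (diag_embed (dc.contract x t)))"
  using assms L_subspace
proof (induction rule: tensor_space_induct)
  case zero
  have z: "dc.contract x 0 = 0" if "x \<in> DC" for x
    using linear_on_zero[OF dc.contract_linear[OF that]] by simp
  have "low (- 0) (diag_embed (0 :: 'g series))"
    by (simp add: low_def vanishes_below_def diag_embed_def dagger_def)
  then have "low (- 0) (diag_embed (dc.contract x 0))" if "x \<in> DC" for x
    by (simp only: z[OF that])
  then show ?case using z by (intro exI[of _ 0]) blast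
next
  case (prod a b)
  obtain N where N: "0 \<le> N" "low (- N) (diag_embed a)" using L_low[OF prod(1)] by blast
  obtain M where M: "0 \<le> M" "low (- M) (diag_embed b)" using L_low[OF prod(2)] by blast
  have c: "dc.contract x (a \<otimes>\<^sub>C b) = F x (diag_embed a) *\<^sub>C b" if "x \<in> DC" for x
    by (rule dc.contract_prod[OF that prod])
  \<comment> \<open>N + 1, because \<open>F_low\<close> needs the two bounds to have a strictly
    positive sum.\<close>
  let ?N = "max (N + 1) M"
  have "dc.contract x (a \<otimes>\<^sub>C b) = 0" if "x \<in> DC" "low ?N x" for x
    using c[OF that(1)] F_low[OF that(2) N(2)] by simp
  moreover have "low (- ?N) (diag_embed (dc.contract x (a \<otimes>\<^sub>C b)))" if "x \<in> DC" for x
  proof -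
    have "diag_embed (dc.contract x (a \<otimes>\<^sub>C b)) = F x (diag_embed a) *\<^sub>C diag_embed b"
      unfolding c[OF that] by (rule linear_on_scale[OF diag_linear[of UNIV]]) simp
    then show ?thesis using low_scale[OF low_mono[OF M(2)]] by simp
  qed
  ultimately show ?case using N(1) by (intro exI[of _ ?N]) auto
next
  case (add s t)
  then obtain N M where N: "N \<ge> 0" "\<forall>x\<in>DC. low N x \<longrightarrow> dc.contract x s = 0"
      "\<forall>x\<in>DC. low (- N) (diag_embed (dc.contract x s))"
    and M: "M \<ge> 0" "\<forall>x\<in>DC. low M x \<longrightarrow> dc.contract x t = 0"
      "\<forall>x\<in>DC. low (- M) (diag_embed (dc.contract x t))" by blast
  have c: "dc.contract x (s + t) = dc.contract x s + dc.contract x t" if "x \<in> DC" for x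
    using linear_on_add[OF dc.contract_linear[OF that] add(1,2)] .
  have "dc.contract x (s + t) = 0" if "x \<in> DC" "low (max N M) x" for x
    using N(2) M(2) that low_mono[OF that(2), of N] low_mono[OF that(2), of M] by (simp add: c)
  moreover have "low (- max N M) (diag_embed (dc.contract x (s + t)))" if "x \<in> DC" for x
  proof -
    have "diag_embed (dc.contract x (s + t)) = diag_embed (dc.contract x s) + diag_embed (dc.contract x t)"
      unfolding c[OF that] by (rule linear_on_add[OF diag_linear[of UNIV]]) simp_all
    moreover have "low (- max N M) (diag_embed (dc.contract x s))" "low (- max N M) (diag_embed (dc.contract x t))"
      using low_mono[of "- N" "diag_embed (dc.contract x s)" "- max N M"] N(3)
        low_mono[of "- M" "diag_embed (dc.contract x t)" "- max N M"] M(3) that by simp_all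
    ultimately show ?thesis by (simp add: low_add)
  qed
  ultimately show ?case using N(1) by (intro exI[of _ "max N M"]) auto
qed

end

text \<open>R is D in one instance and the completion in the other; the arguments only use that it
  is a bracket-closed subspace between them.\<close>

locale loop_model = twisted_loop br \<sigma> m np h nm
  for br :: "'g::complex_vector \<Rightarrow> 'g \<Rightarrow> 'g" and \<sigma> m np h nm +
  fixes R :: "('g series \<times> 'g series) set"
  assumes D_R: "D \<subseteq> R" and R_DC: "R \<subseteq> DC" and R_subspace: "cv.subspace R"
    and R_brD: "x \<in> R \<Longrightarrow> y \<in> R \<Longrightarrow> brD x y \<in> R"
begin

definition W0 :: "('g series \<times> 'g series) set" where "W0 = {x \<in> R. borel_condition x}"

sublocale lag: lagrangian R brD F L brL diag_embed W0
proof (intro lagrangian.intro double_subset D_R R_DC R_subspace R_brD lagrangian_axioms.intro)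
  have "W0 = R \<inter> {x. borel_condition x}" by (auto simp: W0_def)
  then show "cv.subspace W0" using R_subspace borel_subspace cv.subspace_inter by metis
  show "F w w' = 0" if "w \<in> W0" "w' \<in> W0" for w w' using that borel_iso by (simp add: W0_def)
  show "a = 0" if "a \<in> L" "diag_embed a \<in> W0" for a using that borel_Int by (simp add: W0_def)
  show "\<exists>a\<in>L. x - diag_embed a \<in> W0" if x: "x \<in> R" for x
  proof -
    obtain a where a: "a \<in> L" "borel_condition (x - diag_embed a)" using borel_sum x R_DC by blast
    then have "x - diag_embed a \<in> R" using diag_D D_R R_subspace x by (auto intro: cv.subspace_diff)
    then show ?thesis using a by (auto simp: W0_def)
  qed
qed (auto simp: W0_def)

lemma W0_low: "x \<in> W0 \<Longrightarrow> low 0 x"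
  by (simp add: W0_def borel_condition_def)

lemma low_W0: "x \<in> R \<Longrightarrow> low 1 x \<Longrightarrow> x \<in> W0"
  by (simp add: W0_def borel_condition_low)

definition tail :: "int \<Rightarrow> ('g series \<times> 'g series) set" where "tail n = {x \<in> R. low n x}"

lemma tail_W0: "1 \<le> n \<Longrightarrow> tail n \<subseteq> W0"
proof
  show "x \<in> W0" if "1 \<le> n" "x \<in> tail n" for x
    using that low_W0[of x] low_mono[of n x 1] by (simp add: tail_def)
qed

text \<open>Truncation splits off a finite-dimensional part. This is the source of the finite sets
  needed for dual cobrackets and for commensurability of graphs.\<close>

lemma cofinite_tail: "\<exists>B. finite B \<and> (\<forall>x\<in>R. low a x \<longrightarrow> x \<in> cv.span (tail n \<union> B))"
proof -
  obtain B where B: "finite B" "\<And>x. low a x \<Longrightarrow> truncate n x \<in> cv.span B"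
    using ex_finite_span_truncate by blast
  have "x \<in> cv.span (tail n \<union> B)" if x: "x \<in> R" "low a x" for x
  proof -
    have "truncate n x \<in> R" using truncate_D x R_DC D_R by blast
    then have "x - truncate n x \<in> tail n" using x low_truncate R_subspace by (simp add: tail_def cv.subspace_diff)
    then have "x - truncate n x \<in> cv.span (tail n \<union> B)" by (intro cv.span_base) simp
    moreover have "truncate n x \<in> cv.span (tail n \<union> B)" using B(2)[OF x(2)] cv.span_mono[of B "tail n \<union> B"] by blast
    ultimately have "(x - truncate n x) + truncate n x \<in> cv.span (tail n \<union> B)" by (rule cv.span_add)
    then show ?thesis by simp
  qed
  then show ?thesis using B(1) by blast
qed

lemma ex_dual: "\<exists>\<delta>. lag.dual_cobracket \<delta>"
proof (rule lag.ex_dual_cobracket)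
  fix a assume a: "a \<in> L"
  obtain N where N: "0 \<le> N" "low (- N) (diag_embed a)" using L_low[OF a] by blast
  \<comment> \<open>Bracketing with a lowers degrees by at most N, so this tail is sent to degrees
    >= 1, all of which lie in \<open>W0\<close>.\<close>
  obtain B where B: "finite B" "\<And>x. x \<in> R \<Longrightarrow> low 0 x \<Longrightarrow> x \<in> cv.span (tail (N + 1) \<union> B)"
    using cofinite_tail[of 0 "N + 1"] by blast
  have "brD (diag_embed a) u \<in> W0" if "u \<in> tail (N + 1)" for u
  proof (rule low_W0)
    show "brD (diag_embed a) u \<in> R"
      by (rule R_brD) (use diag_D[OF a] D_R that in \<open>auto simp: tail_def\<close>)
    show "low 1 (brD (diag_embed a) u)" using brD_low[OF N(2), of "N + 1" u] that by (simp add: tail_def)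
  qed
  moreover have "W0 \<subseteq> cv.span (tail (N + 1) \<union> B)" using B(2) W0_low by (auto simp: W0_def)
  ultimately show "\<exists>U B. finite B \<and> U \<subseteq> W0 \<and> W0 \<subseteq> cv.span (U \<union> B) \<and> (\<forall>u\<in>U. brD (diag_embed a) u \<in> W0)"
    using B(1) tail_W0 N(1) by (intro exI[of _ "tail (N + 1)"] exI[of _ B]) simp
qed

lemma graph_bounds:
  assumes t: "t \<in> wedge2 L"
  shows "\<exists>N\<ge>1. tail N \<subseteq> lag.graph t W0 \<and> (\<forall>x\<in>lag.graph t W0. low (- N) x)"
proof -
  obtain N where N: "0 \<le> N" "\<And>x. x \<in> DC \<Longrightarrow> low N x \<Longrightarrow> lag.contract x t = 0"
    "\<And>x. x \<in> DC \<Longrightarrow> low (- N) (diag_embed (lag.contract x t))"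
    using contract_bounds[of t] t unfolding wedge2_def by blast
  \<comment> \<open>N may be 0, but only from degree 1 on is a tail contained in
    \<open>W0\<close>.\<close>
  have "tail (N + 1) \<subseteq> lag.graph t W0"
  proof
    fix x assume x: "x \<in> tail (N + 1)"
    then have "x \<in> W0" using tail_W0[of "N + 1"] N(1) by auto
    moreover have "x \<in> DC" "low N x" using x R_DC low_mono[of "N + 1" x N] by (simp_all add: tail_def subset_eq)
    then have "lag.contract x t = 0" by (rule N(2))
    moreover have "diag_embed (0 :: 'g series) = 0" by (rule lag.\<iota>_simps(4))
    ultimately have "x \<in> W0" "x = x + diag_embed (lag.contract x t)" by simp_all
    then show "x \<in> lag.graph t W0" unfolding lag.graph_def by blast
  qed
  moreover have "low (- (N + 1)) x" if "x \<in> lag.graph t W0" for x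
  proof -
    obtain w where w: "w \<in> W0" "x = w + diag_embed (lag.contract w t)" using \<open>x \<in> _\<close> by (auto simp: lag.graph_def)
    have "w \<in> DC" using w(1) R_DC by (auto simp: W0_def)
    then show ?thesis unfolding w(2)
      using low_mono[OF W0_low[OF w(1)], of "- (N + 1)"] low_mono[OF N(3), of w "- (N + 1)"] N(1)
      by (intro low_add) simp_all
  qed
  ultimately show ?thesis using N(1) by (intro exI[of _ "N + 1"]) auto
qed

text \<open>The graph and \<open>W0\<close> both contain the tail from N on and lie in degrees >=
  -N, which leaves finitely many dimensions.\<close>

lemma commensurable_graph:
  assumes t: "t \<in> wedge2 L"
  shows "lag.graph t W0 \<asymp> W0"
proof -
  obtain N where N: "1 \<le> N" "tail N \<subseteq> lag.graph t W0" "\<forall>x\<in>lag.graph t W0. low (- N) x"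
    using graph_bounds[OF t] by blast
  interpret V: lagrangian R brD F L brL diag_embed "lag.graph t W0" by (rule lag.graph_lagrangian[OF t])
  obtain B where B: "finite B" "\<And>x. x \<in> R \<Longrightarrow> low (- N) x \<Longrightarrow> x \<in> cv.span (tail N \<union> B)"
    using cofinite_tail[of "- N" N] by blast
  have "{x + y | x y. x \<in> lag.graph t W0 \<and> y \<in> W0} \<subseteq> cv.span ((lag.graph t W0 \<inter> W0) \<union> B)"
  proof
    fix z assume "z \<in> {x + y | x y. x \<in> lag.graph t W0 \<and> y \<in> W0}"
    then obtain x y where x: "x \<in> lag.graph t W0" and y: "y \<in> W0" and zxy: "z = x + y" by blast
    have "x + y \<in> R" by (rule cv.subspace_add[OF R_subspace V.W_R[OF x] lag.W_R[OF y]])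
    moreover have "low (- N) (x + y)" using N x low_mono[OF W0_low[OF y], of "- N"] by (intro low_add) simp_all
    ultimately have "x + y \<in> cv.span (tail N \<union> B)" by (rule B(2))
    moreover have "tail N \<union> B \<subseteq> (lag.graph t W0 \<inter> W0) \<union> B" using N(2) tail_W0[OF N(1)] by blast
    ultimately show "z \<in> cv.span ((lag.graph t W0 \<inter> W0) \<union> B)" unfolding zxy
      using cv.span_mono[of "tail N \<union> B" "(lag.graph t W0 \<inter> W0) \<union> B"] by blast
  qed
  then show ?thesis using B(1) unfolding commensurable_def by blast
qed

text \<open>The coefficient of [v z^k, c] in degree k + i is [v, c i]. For large k the tail detects
  it, so c i commutes with \<open>G k\<close> for all large k and is therefore central.\<close>

lemma orthogonal_orbit_zero:
  assumes c: "c \<in> L" and z: "\<And>a u. a \<in> L \<Longrightarrow> u \<in> tail n \<Longrightarrow> F (brD (diag_embed a) (diag_embed c)) u = 0"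
  shows "c = 0"
proof
  fix i
  have "c i = 0"
  proof (rule central_above)
    fix k v assume k: "n + 1 + \<bar>i\<bar> \<le> k" and v: "v \<in> G k"
    have aL: "monomial k v \<in> L" unfolding loop_algebra_def using v G_subspace by (rule monomial_loop_space[rotated])
    define e where "e = brL (monomial k v) c"
    have eL: "e \<in> L" unfolding e_def using aL c brL_L by blast
    have "e (k + i) = 0"
    proof (rule killing_nondegenerate_graded)
      show "e (k + i) \<in> G (k + i)" using eL by (simp add: L_iff)
      fix b assume b: "b \<in> G (- (k + i))"
      \<comment> \<open>The second component of the diagonal is reversed, so the coefficient e (k +
        i) is met by a positive power of \<open>z_-\<close>.\<close>
      let ?u = "(0, monomial (k + i) b) :: 'g series \<times> 'g series"
      have "?u \<in> D"
        unfolding loop_double_def using monomial_loop_space[of "\<lambda>k. G (- k)"] G_subspace b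
          cv.subspace_0[OF subspace_loop_space[of G]] by auto
      moreover have "low n ?u" using k by (auto simp: low_iff monomial_def)
      ultimately have "?u \<in> tail n" using D_R by (auto simp: tail_def)
      from z[OF aL this] have "F (diag_embed e) ?u = 0" by (simp add: e_def diag_bracket)
      then have "\<kappa> (dagger e (- (k + i))) b = 0"
        by (simp add: loop_double_form_def diag_embed_def series_form_monomial) (simp add: series_form_def)
      then show "\<kappa> (e (k + i)) b = 0" by (simp only: dagger_def minus_minus)
    qed
    moreover have "e (k + i) = br v (c i)"
    proof -
      have "e (k + i) = (\<Sum>j\<in>{k}. br (monomial k v j) (c (k + i - j)))"
        unfolding e_def series_bracket_def
        by (rule sum.mono_neutral_left) (auto simp: monomial_def br_simps split: if_splits)
      then show ?thesis by (simp add: monomial_def)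
    qed
    ultimately show "br v (c i) = 0" by simp
  qed
  then show "c i = 0 i" by simp
qed

abbreviation bialgebra_tensors :: "('g series \<Rightarrow> ('g series, 'g series) tensor) \<Rightarrow> ('g series, 'g series) tensor set" where
  "bialgebra_tensors \<delta> \<equiv> {t \<in> wedge2 L. lie_bialgebra L brL (\<lambda>a. \<delta> a + tensor_ad L brL a t)}"

lemma bialgebra_iff_closed:
  assumes \<delta>: "lag.dual_cobracket \<delta>" and t: "t \<in> wedge2 L"
  shows "lie_bialgebra L brL (\<lambda>a. \<delta> a + tensor_ad L brL a t) \<longleftrightarrow>
    (\<forall>x\<in>lag.graph t W0. \<forall>y\<in>lag.graph t W0. brD x y \<in> lag.graph t W0)"
proof -
  interpret V: lagrangian R brD F L brL diag_embed "lag.graph t W0" by (rule lag.graph_lagrangian[OF t])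
  have dual: "V.dual_cobracket (\<lambda>a. \<delta> a + tensor_ad L brL a t)" by (rule lag.graph_dual_cobracket[OF \<delta> t])
  obtain N where N: "1 \<le> N" "tail N \<subseteq> lag.graph t W0" "\<forall>x\<in>lag.graph t W0. low (- N) x"
    using graph_bounds[OF t] by blast
  have "brD x y \<in> lag.graph t W0" if cj: "V.co_jacobi (\<lambda>a. \<delta> a + tensor_ad L brL a t)"
    and x: "x \<in> lag.graph t W0" and y: "y \<in> lag.graph t W0" for x y
  \<comment> \<open>Brackets of elements of the graph lie in degrees >= -2N and are therefore
    orthogonal to this tail.\<close>
  proof (rule V.subalgebra_if_co_jacobi[OF dual cj, of "tail (N + N + 1)"])
    have "tail (N + N + 1) \<subseteq> tail N" using N(1) low_mono by (auto simp: tail_def)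
    then show "tail (N + N + 1) \<subseteq> lag.graph t W0" using N(2) by blast
    show "F u (brD x y) = 0" if "u \<in> tail (N + N + 1)" "x \<in> lag.graph t W0" "y \<in> lag.graph t W0" for u x y
      using F_low[of "N + N + 1" u "- N + - N" "brD x y"] brD_low[of "- N" x "- N" y] N(3) that by (simp add: tail_def)
  qed (use x y orthogonal_orbit_zero in blast)+
  then show ?thesis
    unfolding V.lie_bialgebra_iff[OF dual] using V.co_jacobi_subalgebra[OF dual] by blast
qed

lemma diag_zero: "a \<in> L \<Longrightarrow> diag_embed a = 0 \<Longrightarrow> a = 0"
  by (rule diag_inj) (simp add: lag.\<iota>_simps(4))

lemma manin_triple_lagrangian_iff:
  "manin_triple R brD F (diagonal \<sigma> m) V \<longleftrightarrow>
    lagrangian R brD F L brL diag_embed V \<and> (\<forall>x\<in>V. \<forall>y\<in>V. brD x y \<in> V)"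
  unfolding diagonal_def by (rule lag.manin_triple_iff) (rule diag_zero)

lemma bij_graph:
  assumes \<delta>: "lag.dual_cobracket \<delta>"
  shows "bij_betw (\<lambda>t. lag.graph t W0) (bialgebra_tensors \<delta>) (manin_triples R brD F (diagonal \<sigma> m) W0)"
proof (rule bij_betwI')
  fix s t assume "s \<in> bialgebra_tensors \<delta>" "t \<in> bialgebra_tensors \<delta>"
  then show "(lag.graph s W0 = lag.graph t W0) = (s = t)" using lag.graph_inj by blast
next
  fix t assume t: "t \<in> bialgebra_tensors \<delta>"
  then have tw: "t \<in> wedge2 L" by simp
  have "manin_triple R brD F (diagonal \<sigma> m) (lag.graph t W0)"
    unfolding manin_triple_lagrangian_iff
    using lag.graph_lagrangian[OF tw] bialgebra_iff_closed[OF \<delta> tw] t by blast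
  moreover have "lag.graph t W0 \<subseteq> R"
    using lagrangian.W_R[OF lag.graph_lagrangian[OF tw]] by blast
  ultimately show "lag.graph t W0 \<in> manin_triples R brD F (diagonal \<sigma> m) W0"
    unfolding manin_triples_def using commensurable_graph[OF tw] by blast
next
  fix V assume "V \<in> manin_triples R brD F (diagonal \<sigma> m) W0"
  then have V: "lagrangian R brD F L brL diag_embed V" "\<forall>x\<in>V. \<forall>y\<in>V. brD x y \<in> V" "V \<asymp> W0"
    unfolding manin_triples_def manin_triple_lagrangian_iff by blast+
  interpret V: lagrangian R brD F L brL diag_embed V by (rule V(1))
  obtain B where B: "finite B" "{x + y | x y. x \<in> V \<and> y \<in> W0} \<subseteq> cv.span ((V \<inter> W0) \<union> B)"
    using V(3) unfolding commensurable_def by blast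
  have "W0 \<subseteq> cv.span ((V \<inter> W0) \<union> B)"
  proof
    fix y assume "y \<in> W0"
    then have "0 + y \<in> {x + y | x y. x \<in> V \<and> y \<in> W0}" using V.W_closed(5) by blast
    then have "0 + y \<in> cv.span ((V \<inter> W0) \<union> B)" using B(2) by blast
    then show "y \<in> cv.span ((V \<inter> W0) \<union> B)" by simp
  qed
  then obtain t where t: "t \<in> wedge2 L" "V = lag.graph t W0" using lag.ex_graph[OF V(1) B(1)] by blast
  then show "\<exists>t\<in>bialgebra_tensors \<delta>. V = lag.graph t W0"
    using bialgebra_iff_closed[OF \<delta> t(1)] V(2) by blast
qed

text \<open>\<open>dual_cobracket\<close> lives on L, \<open>determines_cobracket\<close> on the
  diagonal. They match because \<open>diagonal_cobracket\<close> is transport by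
  \<open>tensor_embed\<close>, which preserves skewness and pairings.\<close>

lemma dual_iff_determines:
  assumes "lagrangian R brD F L brL diag_embed V"
  shows "lagrangian.dual_cobracket brD F L diag_embed V \<delta> \<longleftrightarrow> (\<forall>a\<in>L. \<delta> a \<in> wedge2 L) \<and>
    determines_cobracket brD F (diagonal \<sigma> m) V (diagonal_cobracket \<sigma> m \<delta>)"
proof -
  interpret V: lagrangian R brD F L brL diag_embed V by (rule assms)
  have dc: "diagonal_cobracket \<sigma> m \<delta> (diag_embed a) = lag.tensor_embed (\<delta> a)" for a
    by (simp add: diagonal_cobracket_def diag_embed_def)
  show ?thesis
    unfolding V.dual_cobracket_def determines_cobracket_def diagonal_def ball_simps dc
    using lag.tensor_embed_wedge2 lag.pair_tensor_embed V.W_R lag.wedge2_tensor_space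
    by (smt (verit, ccfv_threshold))
qed

end

section \<open>The two instances of the model\<close>

context twisted_loop
begin

sublocale std: loop_model br \<sigma> m np h nm D
proof
  show "brD x y \<in> D" if x: "x \<in> D" and y: "y \<in> D" for x y
  proof -
    have "finite {k. series_bracket br f g k \<noteq> 0}" if fg: "finite {k. f k \<noteq> 0}" "finite {k. g k \<noteq> 0}" for f g
    proof (rule finite_subset)
      \<comment> \<open>A nonzero coefficient comes from a pair of nonzero coefficients, so the
        support lies in the sum of two finite supports.\<close>
      show "{k. series_bracket br f g k \<noteq> 0} \<subseteq> (\<lambda>(i, j). i + j) ` ({k. f k \<noteq> 0} \<times> {k. g k \<noteq> 0})"
      proof
        fix n assume n: "n \<in> {k. series_bracket br f g k \<noteq> 0}"
        have "{k. f k \<noteq> 0 \<and> g (n - k) \<noteq> 0} \<noteq> {}"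
        proof
          assume e: "{k. f k \<noteq> 0 \<and> g (n - k) \<noteq> 0} = {}"
          have "series_bracket br f g n = 0" unfolding series_bracket_def e by simp
          then show False using n by simp
        qed
        then obtain k where "f k \<noteq> 0" "g (n - k) \<noteq> 0" by blast
        then show "n \<in> (\<lambda>(i, j). i + j) ` ({k. f k \<noteq> 0} \<times> {k. g k \<noteq> 0})"
          by (intro image_eqI[of _ _ "(k, n - k)"]) auto
      qed
    qed (use fg in simp)
    moreover have "brD x y \<in> DC" using brD_DC x y D_DC by blast
    ultimately show ?thesis using x y by (simp add: D_iff DC_iff loop_double_bracket_def)
  qed
qed (use D_DC D_subspace in auto)

sublocale cmp: loop_model br \<sigma> m np h nm DC
  by unfold_locales (use D_DC DC_subspace brD_DC in auto)

lemma W_std_W0: "W_std \<sigma> m np h nm = std.W0" "W_std_completed \<sigma> m np h nm = cmp.W0"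
  by (simp_all add: W_std_iff W_std_completed_iff std.W0_def cmp.W0_def)

text \<open>\<open>W_twist\<close> contracts inside the diagonal, \<open>graph\<close> inside L;
  linearity of \<open>diag_embed\<close> carries one to the other.\<close>

lemma W_twist_graph:
  assumes t: "t \<in> wedge2 L"
  shows "W_twist br \<sigma> m np h nm t = dc.graph t std.W0"
proof -
  have "tensor_lift L L (\<lambda>a b. F w (diag_embed a) *\<^sub>C diag_embed b) t = diag_embed (dc.contract w t)"
    if w: "w \<in> std.W0" for w
  proof -
    have w: "w \<in> DC" using w std.lag.W_R D_DC by blast
    have "diag_embed (dc.contract w t) = tensor_lift L L (\<lambda>a b. diag_embed (F w (diag_embed a) *\<^sub>C b)) t"
      unfolding dc.contract_def
      by (rule linear_on_compose_tensor_lift[OF L_subspace L_subspace dc.contract_bilinear[OF w]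
            dc.wedge2_tensor_space[OF t] L_subspace _ diag_linear]) (rule dc.L_closed(2))
    also have "\<dots> = tensor_lift L L (\<lambda>a b. F w (diag_embed a) *\<^sub>C diag_embed b) t"
      by (simp add: linear_on_scale[OF diag_linear[of UNIV]])
    finally show ?thesis by simp
  qed
  then show ?thesis unfolding W_twist_def W_std_W0 dc.graph_def by (metis (no_types, lifting))
qed

text \<open>By \<open>ex_dual\<close> the choice in \<open>standard_cobracket\<close> has a
  candidate, so the chosen map has the defining property.\<close>

lemma standard_dual: "std.lag.dual_cobracket (standard_cobracket br \<sigma> m np h nm)"
proof -
  have iff: "std.lag.dual_cobracket \<delta> \<longleftrightarrow> (\<forall>a\<in>L. \<delta> a \<in> wedge2 L) \<and>
    determines_cobracket brD F (diagonal \<sigma> m) (W_std \<sigma> m np h nm) (diagonal_cobracket \<sigma> m \<delta>)" for \<delta>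
    unfolding W_std_W0 by (rule std.dual_iff_determines) (rule std.lag.lagrangian_axioms)
  from someI_ex[OF std.ex_dual[unfolded iff]] show ?thesis
    unfolding iff standard_cobracket_def .
qed

text \<open>By uniqueness of the cobracket on \<open>std.W0\<close> it suffices to restrict any cobracket dual to the completion.\<close>

lemma completed_dual: "cmp.lag.dual_cobracket (standard_cobracket br \<sigma> m np h nm)"
proof -
  let ?\<delta> = "standard_cobracket br \<sigma> m np h nm"
  obtain \<delta> where \<delta>: "cmp.lag.dual_cobracket \<delta>" using cmp.ex_dual by blast
  have W: "std.W0 \<subseteq> cmp.W0" using D_DC by (auto simp: std.W0_def cmp.W0_def)
  have "?\<delta> a = \<delta> a" if a: "a \<in> L" for a
  proof (rule std.lag.tensor_eqI)
    show "?\<delta> a \<in> tensor_space L L" "\<delta> a \<in> tensor_space L L"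
      using standard_dual \<delta> a dc.wedge2_tensor_space
      by (auto simp: std.lag.dual_cobracket_def cmp.lag.dual_cobracket_def)
    fix w w' assume w: "w \<in> std.W0" "w' \<in> std.W0"
    then have "w \<in> cmp.W0" "w' \<in> cmp.W0" using W by auto
    then show "dc.pair w w' (?\<delta> a) = dc.pair w w' (\<delta> a)"
      using standard_dual \<delta> a w by (simp add: std.lag.dual_cobracket_def cmp.lag.dual_cobracket_def)
  qed
  then show ?thesis using \<delta> by (simp add: cmp.lag.dual_cobracket_def)
qed

section \<open>Completions\<close>

lemma max_ideal_mult_iff:
  "x \<in> max_ideal_mult m V \<longleftrightarrow> (\<exists>y\<in>V. \<exists>z\<in>V. x = (t_mult m (fst y), 0) + (0, t_mult m (snd z)))"
  unfolding max_ideal_mult_def by blast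

lemma t_mult_low: "low n x \<Longrightarrow> low n y \<Longrightarrow> low (n + int m) ((t_mult m (fst x), 0) + (0, t_mult m (snd y)))"
  by (simp add: low_iff t_mult_def)

text \<open>Each multiplication by \<open>t_+\<close> or \<open>t_-\<close> raises degrees by
  m.\<close>

lemma max_ideal_power_low:
  assumes "\<And>x. x \<in> V \<Longrightarrow> low n x" "x \<in> (max_ideal_mult m ^^ k) V"
  shows "low (n + int k * int m) x"
  using assms(2)
proof (induction k arbitrary: x)
  case 0
  then show ?case using assms(1) by simp
next
  case (Suc k)
  then have "x \<in> max_ideal_mult m ((max_ideal_mult m ^^ k) V)" by simp
  then obtain y z where "x = (t_mult m (fst y), 0) + (0, t_mult m (snd z))"
    "y \<in> (max_ideal_mult m ^^ k) V" "z \<in> (max_ideal_mult m ^^ k) V"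
    unfolding max_ideal_mult_iff by blast
  then show ?case using t_mult_low[of "n + int k * int m" y z] Suc.IH by (simp add: algebra_simps)
qed

text \<open>Multiplication by the d-th powers of \<open>z_+\<close> and \<open>z_-\<close> on the
  two components. For d = k m with k >= 1 it is the action of \<open>t_+^k + t_-^k\<close>, an
  element of the k-th power of the ideal; a negative d undoes it.\<close>

definition shift_up :: "int \<Rightarrow> 'g series \<times> 'g series \<Rightarrow> 'g series \<times> 'g series" where
  "shift_up d x = ((\<lambda>k. fst x (k - d)), (\<lambda>k. snd x (k - d)))"

lemma shift_up_max_ideal: "x \<in> V \<Longrightarrow> shift_up (int k * int m) x \<in> (max_ideal_mult m ^^ k) V"
proof (induction k)
  case (Suc k)
  let ?y = "shift_up (int k * int m) x"
  have "shift_up (int (Suc k) * int m) x = (t_mult m (fst ?y), 0) + (0, t_mult m (snd ?y))"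
    by (simp add: shift_up_def t_mult_def algebra_simps)
  then have "shift_up (int (Suc k) * int m) x \<in> max_ideal_mult m ((max_ideal_mult m ^^ k) V)"
    using Suc.IH[OF Suc.prems] unfolding max_ideal_mult_iff by blast
  then show ?case by simp
qed (simp add: shift_up_def)

lemma shift_up_D:
  assumes "x \<in> D"
  shows "shift_up (int m * d) x \<in> D"
proof -
  have G: "G (k - int m * d) = G k" "G (- (k - int m * d)) = G (- k)" for k
    using G_period[of k "- d"] G_period[of "- k" d] by simp_all
  have "fst x (k - int m * d) \<in> G (k - int m * d)" "snd x (k - int m * d) \<in> G (- (k - int m * d))" for k
    using assms by (simp_all only: D_iff)
  then have "fst x (k - int m * d) \<in> G k" "snd x (k - int m * d) \<in> G (- k)" for k
    unfolding G by blast+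
  moreover have "finite {k. f (k - d) \<noteq> 0}" if "finite {k. f k \<noteq> 0}" for f :: "'g series" and d
  proof -
    have "{k. f (k - d) \<noteq> 0} = (\<lambda>k. k + d) ` {k. f k \<noteq> 0}" by force
    then show ?thesis using that by simp
  qed
  ultimately show ?thesis using assms by (simp add: D_iff shift_up_def)
qed

text \<open>The contraction with t ignores degrees >= n. One way, w is approximated by truncations
  having the same contraction as w. The other way, the approximating sequence becomes constant
  modulo degrees >= n, so its limit is a graph point plus an element of the completed complement
  with contraction 0.\<close>

lemma completion_graph:
  assumes t: "t \<in> wedge2 L"
  shows "W_completion \<sigma> m (dc.graph t std.W0) = dc.graph t cmp.W0"
proof -
  let ?V = "dc.graph t std.W0"
  let ?c = "\<lambda>w. diag_embed (dc.contract w t)"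
  have ts: "t \<in> tensor_space L L" using t by (rule dc.wedge2_tensor_space)
  obtain N where N: "1 \<le> N" "std.tail N \<subseteq> ?V" "\<forall>x\<in>?V. low (- N) x" using std.graph_bounds[OF t] by blast
  obtain N' where N': "0 \<le> N'" "\<And>x. x \<in> DC \<Longrightarrow> low N' x \<Longrightarrow> dc.contract x t = 0"
    using contract_bounds[OF ts] by blast
  \<comment> \<open>n combines three bounds: from 1 on everything satisfies the Borel condition,
    from N on elements of D lie in V, and from N' on the contraction vanishes.\<close>
  define n where "n = max N N'"
  have n: "1 \<le> n" "N \<le> n" "N' \<le> n" using N(1) by (auto simp: n_def)
  have contract_eq: "dc.contract x t = dc.contract y t" if xy: "x \<in> DC" "y \<in> DC" "low n (x - y)" for x y
  proof -
    have "dc.contract (x - y) t = 0"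
      using N'(2)[of "x - y"] low_mono[OF xy(3) n(3)] cv.subspace_diff[OF DC_subspace xy(1,2)] by simp
    then show ?thesis using linear_on_diff[OF dc.contract_linear_left[OF ts] DC_subspace xy(1,2)] by simp
  qed
  have m1: "int k \<le> int k * int m" for k using mult_left_mono[of 1 "int m" "int k"] m_pos by simp
  show ?thesis
  proof (rule set_eqI, rule iffI)
    fix x assume "x \<in> dc.graph t cmp.W0"
    then obtain w where w: "w \<in> cmp.W0" "x = w + ?c w" by (auto simp: dc.graph_def)
    have wDC: "w \<in> DC" and wb: "borel_condition w" using w(1) by (auto simp: cmp.W0_def)
    \<comment> \<open>Cutting at n + k m rather than at k m keeps the contraction and the degree-0
      part of w intact for every k.\<close>
    define u where "u k = truncate (n + int k * int m) w" for k :: nat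
    have uD: "u k \<in> D" for k unfolding u_def using wDC by (rule truncate_D)
    have low_wu: "low (n + int k * int m) (w - u k)" for k unfolding u_def by (rule low_truncate)
    have uW: "u k \<in> std.W0" for k
    proof -
      have "0 < n + int k * int m" using n(1) by (simp add: add_pos_nonneg)
      then have "fst (u k) 0 = fst w 0" "snd (u k) 0 = snd w 0" by (simp_all add: u_def truncate_def)
      moreover have "low 0 (u k)" unfolding u_def using wb by (intro truncate_low) (simp add: borel_condition_def)
      ultimately show ?thesis using wb uD by (simp add: std.W0_def borel_condition_def)
    qed
    have cu: "dc.contract (u k) t = dc.contract w t" for k
      using contract_eq[of w "u k"] wDC uD D_DC low_mono[OF low_wu[of k], of n] by (auto simp: subset_eq)
    define v where "v k = u k + ?c w" for k
    have vV: "v k \<in> ?V" for k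
      unfolding dc.graph_def v_def using uW[of k] cu[of k] by (intro CollectI exI[of _ "u k"]) simp
    have step: "v (Suc k) - v k \<in> (max_ideal_mult m ^^ k) ?V" for k
    proof -
      let ?s = "u (Suc k) - u k"
      have sD: "?s \<in> D" using uD D_subspace by (simp add: cv.subspace_diff)
      have "?s = (w - u k) - (w - u (Suc k))" by simp
      moreover have "low (n + int k * int m) (w - u (Suc k))" using low_mono[OF low_wu[of "Suc k"]] by (simp add: algebra_simps)
      ultimately have sl: "low (n + int k * int m) ?s" by (simp only: low_minus[OF low_wu[of k]])
      \<comment> \<open>Shifting the increment down by k m leaves an element in degrees >= N, which
        lies in V; shifting back up puts the increment into the k-th power of the ideal times
        V.\<close>
      let ?s' = "shift_up (- (int k * int m)) ?s"
      have "low N ?s'" using sl n(2) by (simp add: low_iff shift_up_def)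
      moreover have "?s' \<in> D" using shift_up_D[OF sD, of "- int k"] by (simp add: mult.commute)
      ultimately have "?s' \<in> ?V" using N(2) by (auto simp: std.tail_def)
      then have "shift_up (int k * int m) ?s' \<in> (max_ideal_mult m ^^ k) ?V" by (rule shift_up_max_ideal)
      moreover have "shift_up (int k * int m) ?s' = ?s" by (simp add: shift_up_def prod_eq_iff fun_eq_iff)
      ultimately show ?thesis by (simp add: v_def)
    qed
    have xv: "x - v k = w - u k" for k by (simp add: w(2) v_def)
    have lim: "\<forall>k\<ge>nat l. \<forall>j<l. fst (v k) j = fst x j \<and> snd (v k) j = snd x j" for l
    proof (intro allI impI)
      fix k j assume k: "nat l \<le> k" and j: "j < l"
      have "j < n + int k * int m" using k j m1[of k] n(1) by linarith
      then have "fst (x - v k) j = 0 \<and> snd (x - v k) j = 0"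
        using low_wu[of k] unfolding xv low_iff by blast
      then show "fst (v k) j = fst x j \<and> snd (v k) j = snd x j" by simp
    qed
    have "x \<in> DC" unfolding w(2)
      using wDC diag_D dc.contract_L[OF wDC ts] D_DC by (intro cv.subspace_add[OF DC_subspace]) auto
    then show "x \<in> W_completion \<sigma> m ?V"
      unfolding W_completion_def using vV step lim by blast
  next
    fix x assume "x \<in> W_completion \<sigma> m ?V"
    then obtain v :: "nat \<Rightarrow> 'g series \<times> 'g series" where xDC: "x \<in> DC" and vV: "\<And>k. v k \<in> ?V"
      and step: "\<And>k. v (Suc k) - v k \<in> (max_ideal_mult m ^^ k) ?V"
      and lim: "\<And>l::int. \<exists>K. \<forall>k\<ge>K. \<forall>j<l. fst (v k) j = fst x j \<and> snd (v k) j = snd x j"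
      unfolding W_completion_def by blast
    \<comment> \<open>From \<open>k0\<close> on the increments lie in degrees >= -N + k m, hence >=
      n.\<close>
    define k0 where "k0 = nat (n + N)"
    have stepl: "low n (v (Suc k) - v k)" if "k0 \<le> k" for k
    proof (rule low_mono[OF max_ideal_power_low[OF _ step]])
      show "low (- N) y" if "y \<in> ?V" for y using N(3) that by blast
      show "n \<le> - N + int k * int m" using that m1[of k] by (simp add: k0_def)
    qed
    have vl: "low n (v (k0 + k) - v k0)" for k
    proof (induction k)
      case (Suc k)
      then show ?case using low_add[OF stepl[of "k0 + k"] Suc] by simp
    qed (simp add: low_iff)
    have xl: "low n (x - v k0)"
    proof -
      obtain K where K: "\<forall>k\<ge>K. \<forall>j<n. fst (v k) j = fst x j \<and> snd (v k) j = snd x j" using lim by blast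
      then have "low n (x - v (k0 + K))" by (simp add: low_iff)
      from low_add[OF this vl[of K]] show ?thesis by simp
    qed
    obtain u where u: "u \<in> std.W0" "v k0 = u + ?c u" using vV[of k0] by (auto simp: dc.graph_def)
    have uD: "u \<in> D" "borel_condition u" using u(1) by (auto simp: std.W0_def)
    let ?s = "x - v k0"
    have "v k0 \<in> DC" unfolding u(2)
      using uD diag_D dc.contract_L[OF _ ts, of u] D_DC by (intro cv.subspace_add[OF DC_subspace]) auto
    then have sDC: "?s \<in> DC" using xDC cv.subspace_diff[OF DC_subspace] by blast
    have "borel_condition ?s" using low_mono[OF xl n(1)] by (rule borel_condition_low)
    then have "borel_condition (u + ?s)"
      using uD(2) cv.subspace_add[OF borel_subspace] by auto
    moreover have usDC: "u + ?s \<in> DC" using uD(1) D_DC sDC cv.subspace_add[OF DC_subspace] by blast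
    ultimately have "u + ?s \<in> cmp.W0" by (simp add: cmp.W0_def)
    moreover have "dc.contract (u + ?s) t = dc.contract u t"
      by (rule contract_eq[OF usDC]) (use uD(1) D_DC xl in auto)
    moreover have "x = (u + ?s) + ?c u" using u(2) by simp
    ultimately show "x \<in> dc.graph t cmp.W0" unfolding dc.graph_def by (intro CollectI exI[of _ "u + ?s"]) simp
  qed
qed

end

theorem proposition4p5:
  fixes br :: "'g::complex_vector \<Rightarrow> 'g \<Rightarrow> 'g" and \<sigma> :: "'g \<Rightarrow> 'g" and m :: nat
    and np h nm :: "'g set"
  assumes "finite_dimensional (UNIV :: 'g set)"
    and "simple_lie_algebra UNIV br"
    and "lie_automorphism br \<sigma>" and "has_order \<sigma> m"
    and "triangular_decomposition (eigen_grade \<sigma> m 0) br np h nm"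
  defines "L \<equiv> loop_algebra \<sigma> m" and "C \<equiv> diagonal \<sigma> m"
    and "brD \<equiv> loop_double_bracket br" and "F \<equiv> loop_double_form br"
    and "\<delta> \<equiv> twisted_cobracket br \<sigma> m np h nm" and "W \<equiv> W_twist br \<sigma> m np h nm"
  defines "T \<equiv> {t \<in> wedge2 L. lie_bialgebra L (series_bracket br) (\<delta> t)}"
    and "M \<equiv> manin_triples (loop_double \<sigma> m) brD F C (W_std \<sigma> m np h nm)"
    and "M' \<equiv> manin_triples (completed_loop_double \<sigma> m) brD F C (W_std_completed \<sigma> m np h nm)"
  shows "bij_betw W T M \<and>
    bij_betw (W_completion \<sigma> m) M M' \<and>
    bij_betw (\<lambda>t. W_completion \<sigma> m (W t)) T M' \<and>
    (\<forall>t\<in>T. manin_triple (completed_loop_double \<sigma> m) brD F C (W_completion \<sigma> m (W t)) \<and>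
       determines_cobracket brD F C (W_completion \<sigma> m (W t)) (diagonal_cobracket \<sigma> m (\<delta> t)))"
proof -
  interpret tl: twisted_loop br \<sigma> m np h nm
    using assms(1-5) by unfold_locales (simp_all add: simple_lie_algebra_def)
  let ?\<delta>0 = "standard_cobracket br \<sigma> m np h nm"
  have \<delta>: "\<delta> t = (\<lambda>a. ?\<delta>0 a + tensor_ad L (series_bracket br) a t)" for t
    by (simp add: fun_eq_iff \<delta>_def twisted_cobracket_def L_def)
  have T: "T = tl.std.bialgebra_tensors ?\<delta>0"
    by (simp add: T_def \<delta> L_def)
  have W: "W t = tl.dc.graph t tl.std.W0" if "t \<in> T" for t
    using that tl.W_twist_graph by (simp add: W_def T_def L_def)
  have What: "W_completion \<sigma> m (W t) = tl.dc.graph t tl.cmp.W0" if "t \<in> T" for t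
    using that tl.completion_graph by (simp add: W T_def L_def)
  have "bij_betw (\<lambda>t. tl.dc.graph t tl.std.W0) T M"
    unfolding T M_def C_def brD_def F_def tl.W_std_W0 by (rule tl.std.bij_graph[OF tl.standard_dual])
  then have 1: "bij_betw W T M" by (subst bij_betw_cong[OF W])
  have "bij_betw (\<lambda>t. tl.dc.graph t tl.cmp.W0) T M'"
    unfolding T M'_def C_def brD_def F_def tl.W_std_W0 by (rule tl.cmp.bij_graph[OF tl.completed_dual])
  then have 3: "bij_betw (\<lambda>t. W_completion \<sigma> m (W t)) T M'" by (subst bij_betw_cong[OF What])
  \<comment> \<open>No inverse of the completion is constructed: it is bijective because t -> W t
    and the composition are.\<close>
  have 2: "bij_betw (W_completion \<sigma> m) M M'"
    using bij_betw_comp_iff[OF 1, of "W_completion \<sigma> m" M'] 3 by (simp add: o_def)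
  have 4: "manin_triple (completed_loop_double \<sigma> m) brD F C (W_completion \<sigma> m (W t)) \<and>
      determines_cobracket brD F C (W_completion \<sigma> m (W t)) (diagonal_cobracket \<sigma> m (\<delta> t))" if t: "t \<in> T" for t
  proof
    show "manin_triple (completed_loop_double \<sigma> m) brD F C (W_completion \<sigma> m (W t))"
      using bij_betwE[OF 3] t by (auto simp: M'_def manin_triples_def)
    have tw: "t \<in> wedge2 (loop_algebra \<sigma> m)" using t by (simp add: T_def L_def)
    \<comment> \<open>The standard cobracket is dual to the completed standard complement, so its
      twist by t is dual to the graph of t over it, which is the completion of W t.\<close>
    show "determines_cobracket brD F C (W_completion \<sigma> m (W t)) (diagonal_cobracket \<sigma> m (\<delta> t))"
      using tl.cmp.lag.graph_dual_cobracket[OF tl.completed_dual tw]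
        tl.cmp.dual_iff_determines[OF tl.cmp.lag.graph_lagrangian[OF tw], of "\<delta> t"]
      by (simp add: What[OF t] \<delta> L_def C_def brD_def F_def)
  qed
  show ?thesis using 1 2 3 4 by blast
qed

end
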